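(* Let $L\ge 2$ and $\nu\ge 3$ be integers, let $\tau>0$, and let $\Sigma=\Sigma(L,\nu,\tau)\subset\{0,1,\dots,L\nu\}^{\mathbb Z}$ be the $L$-coloured subshift defined in the context. Let $f:\Sigma_1\to\mathbb{R}$ be a Hölder continuous function with $P_1(f)>\sup f+\log 2$, where $P_1(f)$ is the pressure of $f$ on the full shift $\Sigma_1$, and let $g:\Sigma\to\mathbb{R}$ be the Hölder continuous extension of $f$ described in the context. If $$\tau\ge\frac{\log(5\nu)}{P_1(f)-\sup f}-1,$$ then there are $L$ mutually singular equilibrium states for $g$ on $\Sigma$.
   Context: Alphabet: $\mathcal{A}=\{0,1,\dots,L\nu\}$. For $j=1,\dots,L$ the symbols of colour $j$ are $\mathcal{A}_j=\{(j-1)\nu+1,\dots,j\nu\}$, and $\Sigma_j=\mathcal{A}_j^{\mathbb Z}$ is the corresponding full $\nu$-shift; nonzero symbols are called coloured. Definition of $\Sigma$: a sequence $x\in\mathcal{A}^{\mathbb Z}$ belongs to $\Sigma$ if and only if either $x\in\bigcup_{j=1}^L\Sigma_j$ (then $x$ is called monochromatic), or the following holds. Every maximal block of consecutive coloured symbols in $x$ consists of symbols of a single colour. Any two successive such blocks $\alpha,\beta$ (i.e. separated only by zeros) are both of finite lengths $|\alpha|,|\beta|$, have colours $j$ and $j'$ with $j'=j-1$ or $j'=j+1$ (with $j,j'\in\{1,\dots,L\}$), and are separated by a string of zeros of length at least $\tau(|\alpha|+|\beta|)$. In particular, an infinitely long coloured block can only be adjacent to an infinite string of zeros. Sequences with at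 most one coloured block, and zeros elsewhere, are allowed. The shift is $(\sigma x)_i=x_{i+1}$, and $\Sigma$ carries the topology induced from the product topology. Hölder continuity: a real function $f$ on a shift space is Hölder continuous if there are $\vartheta\in(0,1)$ and $C$ such that for every $n>0$, $|f(x)-f(y)|\le C\vartheta^n$ for all $x,y$ in the space with $x_i=y_i$ for all $|i|<n$ and either $x_{-n}\ne y_{-n}$ or $x_n\neq y_n$. Extension $g$ of $f$: (1) on $\Sigma_1$, $g=f$. (2) On $\Sigma_j$, $j=2,\dots,L$, $g(y)=f(x)$, where $x\in\Sigma_1$ is given by $y_i=x_i+(j-1)\nu$ for all $i$. (3) If $x\in\Sigma$ and $x_0=0$, then $g(x)=\sup f$. (4) If $x\in\Sigma$ is not monochromatic and $x_0\neq 0$, let $x_{-n}\cdots x_n$ be the longest symmetric string around coordinate $0$ consisting of symbols of one colour $j$ (so $x_{-n-1}=0$ or $x_{n+1}=0$). Then $g(x)=g(y)$, where $y\in\Sigma_j$ is a monochromatic point with $y_i=x_i$ for $|i|\le n$, one such $y$ being fixed for each word $x_{-n}\cdots x_n$. Pressure: for a Hölder continuous $\varphi$ on a subshift $X$, $P(\varphi)$ is the exponential growth rate in $n$ of the partition function $Z_n=\sum_{\alpha}e^{\varphi^n(x(\alpha))}$, the sum being over words $\alpha$ of length $n$ occurring in $X$, with $x(\alpha)$ an arbitrary point of the cylinder of $\alpha$ and $\varphi^n=\varphi+\varphi\circ\sigma+\cdots+\varphi\circ\sigma^{n-1}$. $P_1(f)$ is the pressure for $X=\Sigma_1$, and $P(g)$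 is the pressure for $X=\Sigma$. An equilibrium state for $g$ on $\Sigma$ is a $\sigma$-invariant Borel probability measure $\mu$ with $h_\mu(\sigma)+\int g\,d\mu=P(g)$, where $h_\mu(\sigma)$ is the metric entropy. *)

theory Defs
  imports "HOL-Probability.Probability"
begin

definition shift :: "(int \<Rightarrow> 'a) \<Rightarrow> (int \<Rightarrow> 'a)" where
  "shift x = (\<lambda>i. x (i + 1))"

text \<open>\<open>window x k n\<close> is the word \<open>x\<^sub>k \<dots> x\<^sub>k\<^sub>+\<^sub>n\<^sub>-\<^sub>1\<close>; \<open>central x n\<close> is \<open>x\<^sub>-\<^sub>n \<dots> x\<^sub>n\<close>.\<close>

definition window :: "(int \<Rightarrow> 'a) \<Rightarrow> int \<Rightarrow> nat \<Rightarrow> 'a list" where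
  "window x k n = map (\<lambda>i. x (k + int i)) [0..<n]"

definition central :: "(int \<Rightarrow> 'a) \<Rightarrow> nat \<Rightarrow> 'a list" where
  "central x n = window x (- int n) (2 * n + 1)"

definition language :: "(int \<Rightarrow> 'a) set \<Rightarrow> nat \<Rightarrow> 'a list set" where
  "language X n = {window x k n | x k. x \<in> X}"

definition cylinder :: "(int \<Rightarrow> 'a) set \<Rightarrow> 'a list \<Rightarrow> (int \<Rightarrow> 'a) set" where
  "cylinder X w = {x \<in> X. window x 0 (length w) = w}"

definition holder_continuous :: "(int \<Rightarrow> 'a) set \<Rightarrow> ((int \<Rightarrow> 'a) \<Rightarrow> real) \<Rightarrow> bool" where
  "holder_continuous X f \<longleftrightarrow>
     (\<exists>\<theta> C. 0 < \<theta> \<and> \<theta> < 1 \<and>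
       (\<forall>n>0. \<forall>x\<in>X. \<forall>y\<in>X.
          (\<forall>i. \<bar>i\<bar> < int n \<longrightarrow> x i = y i) \<and>
          (x (- int n) \<noteq> y (- int n) \<or> x (int n) \<noteq> y (int n))
          \<longrightarrow> \<bar>f x - f y\<bar> \<le> C * \<theta> ^ n))"

definition colour_symbols :: "nat \<Rightarrow> nat \<Rightarrow> nat set" where
  "colour_symbols \<nu> j = {(j - 1) * \<nu> + 1 .. j * \<nu>}"

definition mono_shift :: "nat \<Rightarrow> nat \<Rightarrow> (int \<Rightarrow> nat) set" where
  "mono_shift \<nu> j = {x. \<forall>i. x i \<in> colour_symbols \<nu> j}"

definition monochromatic :: "nat \<Rightarrow> nat \<Rightarrow> (int \<Rightarrow> nat) \<Rightarrow> bool" where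
  "monochromatic L \<nu> x \<longleftrightarrow> (\<exists>j\<in>{1..L}. x \<in> mono_shift \<nu> j)"

text \<open>A block is given by its set of positions, so that it may be finite, a half-line or all of
  \<open>\<int>\<close>.\<close>

definition coloured_interval :: "(int \<Rightarrow> nat) \<Rightarrow> int set \<Rightarrow> bool" where
  "coloured_interval x I \<longleftrightarrow>
     I \<noteq> {} \<and> (\<forall>a\<in>I. \<forall>b\<in>I. {a..b} \<subseteq> I) \<and> (\<forall>i\<in>I. x i \<noteq> 0)"

definition max_block :: "(int \<Rightarrow> nat) \<Rightarrow> int set \<Rightarrow> bool" where
  "max_block x I \<longleftrightarrow>
     coloured_interval x I \<and> (\<forall>J. coloured_interval x J \<and> I \<subseteq> J \<longrightarrow> J = I)"

definition gap :: "int set \<Rightarrow> int set \<Rightarrow> int set" where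
  "gap I J = {k. (\<forall>i\<in>I. i < k) \<and> (\<forall>j\<in>J. k < j)}"

definition successive_blocks :: "(int \<Rightarrow> nat) \<Rightarrow> int set \<Rightarrow> int set \<Rightarrow> bool" where
  "successive_blocks x I J \<longleftrightarrow>
     max_block x I \<and> max_block x J \<and> (\<forall>i\<in>I. \<forall>j\<in>J. i < j) \<and> (\<forall>k\<in>gap I J. x k = 0)"

definition coloured_shift :: "nat \<Rightarrow> nat \<Rightarrow> real \<Rightarrow> (int \<Rightarrow> nat) set" where
  "coloured_shift L \<nu> \<tau> =
     {x. (\<forall>i. x i \<le> L * \<nu>) \<and>
         (monochromatic L \<nu> x \<or>
          (\<forall>I. max_block x I \<longrightarrow> (\<exists>j\<in>{1..L}. x ` I \<subseteq> colour_symbols \<nu> j)) \<and>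
          (\<forall>I J. successive_blocks x I J \<longrightarrow>
             finite I \<and> finite J \<and>
             (\<exists>j\<in>{1..L}. \<exists>j'\<in>{1..L}. (j' = j + 1 \<or> j = j' + 1) \<and>
                x ` I \<subseteq> colour_symbols \<nu> j \<and> x ` J \<subseteq> colour_symbols \<nu> j') \<and>
             real (card (gap I J)) \<ge> \<tau> * real (card I + card J)))}"

text \<open>In the last clause the point \<open>y\<close> depends only on
  the word \<open>w\<close>; as its choice is arbitrary, the extension is described by a predicate.\<close>

definition colour_extension ::
    "nat \<Rightarrow> nat \<Rightarrow> real \<Rightarrow> ((int \<Rightarrow> nat) \<Rightarrow> real) \<Rightarrow> ((int \<Rightarrow> nat) \<Rightarrow> real) \<Rightarrow> bool" where
  "colour_extension L \<nu> \<tau> f g \<longleftrightarrow>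
     (\<forall>x\<in>mono_shift \<nu> 1. g x = f x) \<and>
     (\<forall>j\<in>{2..L}. \<forall>y\<in>mono_shift \<nu> j. \<forall>x\<in>mono_shift \<nu> 1.
        (\<forall>i. y i = x i + (j - 1) * \<nu>) \<longrightarrow> g y = f x) \<and>
     (\<forall>x\<in>coloured_shift L \<nu> \<tau>. x 0 = 0 \<longrightarrow> g x = (SUP z\<in>mono_shift \<nu> 1. f z)) \<and>
     (\<forall>j\<in>{1..L}. \<forall>n. \<forall>w. length w = 2 * n + 1 \<and> set w \<subseteq> colour_symbols \<nu> j \<longrightarrow>
        (\<exists>y\<in>mono_shift \<nu> j. central y n = w \<and>
          (\<forall>x\<in>coloured_shift L \<nu> \<tau>.
             \<not> monochromatic L \<nu> x \<and> central x n = w \<and>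
             \<not> set (central x (n + 1)) \<subseteq> colour_symbols \<nu> j \<longrightarrow> g x = g y)))"

definition birkhoff_sum :: "((int \<Rightarrow> 'a) \<Rightarrow> real) \<Rightarrow> nat \<Rightarrow> (int \<Rightarrow> 'a) \<Rightarrow> real" where
  "birkhoff_sum \<phi> n x = (\<Sum>k<n. \<phi> ((shift ^^ k) x))"

definition partition_function ::
    "(int \<Rightarrow> 'a) set \<Rightarrow> ((int \<Rightarrow> 'a) \<Rightarrow> real) \<Rightarrow> ('a list \<Rightarrow> int \<Rightarrow> 'a) \<Rightarrow> nat \<Rightarrow> real" where
  "partition_function X \<phi> p n = (\<Sum>w\<in>language X n. exp (birkhoff_sum \<phi> n (p w)))"

text \<open>The growth rate common to all choices \<open>p\<close> of points in the cylinders; it exists for Hoelder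
  continuous \<open>\<phi>\<close> on a nonempty shift-invariant \<open>X\<close> over a finite alphabet.\<close>

definition pressure :: "(int \<Rightarrow> 'a) set \<Rightarrow> ((int \<Rightarrow> 'a) \<Rightarrow> real) \<Rightarrow> real" where
  "pressure X \<phi> =
     (THE P. \<forall>p. (\<forall>n. \<forall>w\<in>language X n. p w \<in> cylinder X w) \<longrightarrow>
        (\<lambda>n. ln (partition_function X \<phi> p n) / real n) \<longlonglongrightarrow> P)"

definition finite_partition :: "'a measure \<Rightarrow> 'a set set \<Rightarrow> bool" where
  "finite_partition M \<P> \<longleftrightarrow> finite \<P> \<and> \<P> \<subseteq> sets M \<and> partition_on (space M) \<P>"

definition partition_entropy :: "'a measure \<Rightarrow> 'a set set \<Rightarrow> real" where
  "partition_entropy M \<P> = - (\<Sum>A\<in>\<P>. measure M A * ln (measure M A))"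

text \<open>The join of \<open>T\<^sup>-\<^sup>i \<P>\<close> over \<open>i < n\<close>; it may contain the empty set, which does not contribute
  to the entropy.\<close>

definition iterated_join :: "'a measure \<Rightarrow> ('a \<Rightarrow> 'a) \<Rightarrow> 'a set set \<Rightarrow> nat \<Rightarrow> 'a set set" where
  "iterated_join M T \<P> n =
     {{x \<in> space M. \<forall>i<n. (T ^^ i) x \<in> A i} | A. \<forall>i<n. A i \<in> \<P>}"

definition metric_entropy :: "'a measure \<Rightarrow> ('a \<Rightarrow> 'a) \<Rightarrow> ereal" where
  "metric_entropy M T =
     (SUP \<P>\<in>{\<P>. finite_partition M \<P>}.
        ereal (lim (\<lambda>n. partition_entropy M (iterated_join M T \<P> n) / real n)))"

definition invariant_measure :: "('a::topological_space) set \<Rightarrow> ('a \<Rightarrow> 'a) \<Rightarrow> 'a measure \<Rightarrow> bool" where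
  "invariant_measure X T \<mu> \<longleftrightarrow>
     prob_space \<mu> \<and> space \<mu> = X \<and> sets \<mu> = sets (restrict_space borel X) \<and>
     T \<in> measurable \<mu> \<mu> \<and> distr \<mu> \<mu> T = \<mu>"

definition equilibrium_state ::
    "(int \<Rightarrow> 'a::topological_space) set \<Rightarrow> ((int \<Rightarrow> 'a) \<Rightarrow> real) \<Rightarrow> (int \<Rightarrow> 'a) measure \<Rightarrow> bool" where
  "equilibrium_state X \<phi> \<mu> \<longleftrightarrow>
     invariant_measure X shift \<mu> \<and> integrable \<mu> \<phi> \<and>
     metric_entropy \<mu> shift + ereal (integral\<^sup>L \<mu> \<phi>) = ereal (pressure X \<phi>)"

definition mutually_singular :: "'a measure \<Rightarrow> 'a measure \<Rightarrow> bool" where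
  "mutually_singular \<mu> \<mu>' \<longleftrightarrow>
     sets \<mu> = sets \<mu>' \<and>
     (\<exists>A\<in>sets \<mu>. emeasure \<mu> A = 0 \<and> emeasure \<mu>' (space \<mu>' - A) = 0)"

end

theory Submission
  imports Defs
begin

text \<open>Put \<open>P = P\<^sub>1(f)\<close> and \<open>S = sup f\<close>. All copies of the full shift carry the same potential, so it is
  enough to show that \<open>P(g) = P\<close> and that \<open>f\<close> has an equilibrium state on the full shift; its \<open>L\<close>
  recoloured images are then equilibrium states with disjoint supports.

  For \<open>P(g) \<le> P\<close>, words with at most one coloured block contribute \<open>e\<^sup>n\<^sup>P\<close> up to a polynomial factor. In
  words with several blocks every symbol is given the weight \<open>e\<^sup>S\<close>. Relative to \<open>P\<close>, each symbol then carries
  a factor \<open>c = e\<^sup>S\<^sup>-\<^sup>P < 1/2\<close>, and since the gaps are at least \<open>\<tau>\<close> times as long as the adjacent blocks, a block of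
  length \<open>l\<close> costs at most \<open>(\<nu> c\<^sup>1\<^sup>+\<^sup>\<tau>)\<^sup>l \<le> 5\<^sup>-\<^sup>l\<close>, which outweighs the choices of colour and of gap length.

  The equilibrium state is a limit of weighted measures on periodic points, as in Misiurewicz's proof of
  the variational principle. Both entropy estimates come from the Gibbs inequality
  \<open>- \<Sum> p log p \<le> - \<Sum> p log q\<close> with a suitable \<open>q\<close>: a Markov measure for the lower bound; for the
  upper bound, over arbitrary partitions, the Gibbs weights of words followed by random errors.\<close>

subsection \<open>Translations, windows and Birkhoff sums\<close>

text \<open>Words with one block and words with several blocks are treated differently because a
  single block has no neighbour that forces a long gap: nothing pays for its
  \<open>\<nu> ^ l\<close> contents, so its weight must be compared with the partition function of
  the full shift itself. With several blocks the crude weight suffices. The hypothesis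
  \<open>S + ln 2 < P\<close> keeps the sum over the possible lengths of a gap within twice its
  first term.

  The limit is taken of word frequencies, as points of a compact product of intervals, and the
  measure is built afterwards from its cylinder probabilities. Every inequality that has to survive
  the limit therefore involves finitely many words only: entropies of words of fixed length, and
  \<open>F\<close> read off a central word.

  \<open>metric_entropy\<close> ranges over all finite measurable partitions, which need not be
  visible in any finite window. Such a partition agrees, up to small probability, with one that is
  visible; the random errors keep the comparison weights positive where the two disagree, at a cost
  per symbol that tends to 0.\<close>

definition translate :: "int \<Rightarrow> (int \<Rightarrow> 'a) \<Rightarrow> int \<Rightarrow> 'a" where
  "translate t x = (\<lambda>i. x (i + t))"

lemma translate_apply [simp]: "translate t x i = x (i + t)"
  by (simp add: translate_def)

lemma translate_translate [simp]: "translate s (translate t x) = translate (s + t) x"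
  by (simp add: translate_def add_ac)

lemma translate_0 [simp]: "translate 0 x = x"
  by (simp add: translate_def)

lemma shift_eq_translate: "shift x = translate 1 x"
  by (simp add: fun_eq_iff shift_def)

lemma shift_funpow: "(shift ^^ k) x = translate (int k) x"
  by (induction k) (simp_all add: shift_eq_translate add.assoc)

lemma length_window [simp]: "length (window x k n) = n"
  by (simp add: window_def)

lemma nth_window [simp]: "i < n \<Longrightarrow> window x k n ! i = x (k + int i)"
  by (simp add: window_def)

lemma window_0 [simp]: "window x k 0 = []"
  by (simp add: window_def)

lemma window_eq_iff: "window x k n = window y l n \<longleftrightarrow> (\<forall>i<n. x (k + int i) = y (l + int i))"
  by (auto simp: list_eq_iff_nth_eq)

lemma window_translate [simp]: "window (translate t x) k n = window x (k + t) n"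
  by (simp add: window_def add_ac)

lemma window_add: "window x k (m + n) = window x k m @ window x (k + int m) n"
  by (rule nth_equalityI) (auto simp: nth_append)

lemma window_Suc: "window x k (Suc n) = window x k n @ [x (k + int n)]"
  by (simp add: window_def)

lemma take_drop_window: "i + m \<le> n \<Longrightarrow> take m (drop i (window x k n)) = window x (k + int i) m"
  by (rule nth_equalityI) (auto simp: add_ac)

lemma set_window: "set (window x k n) = x ` {k..<k + int n}"
proof -
  have "j \<in> (\<lambda>i. k + int i) ` {0..<n}" if "k \<le> j" "j < k + int n" for j
    using that by (intro image_eqI[of _ _ "nat (j - k)"]) auto
  then have "(\<lambda>i. k + int i) ` {0..<n} = {k..<k + int n}"
    by auto
  moreover have "set (window x k n) = x ` (\<lambda>i. k + int i) ` {0..<n}"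
    by (auto simp: window_def)
  ultimately show ?thesis
    by metis
qed

lemma window_eq_iff':
  "window x k n = window y k n \<longleftrightarrow> (\<forall>i. k \<le> i \<and> i < k + int n \<longrightarrow> x i = y i)"
proof
  assume *: "window x k n = window y k n"
  show "\<forall>i. k \<le> i \<and> i < k + int n \<longrightarrow> x i = y i"
  proof (intro allI impI)
    fix i assume "k \<le> i \<and> i < k + int n"
    with * show "x i = y i"
      unfolding window_eq_iff by (auto dest: spec[of _ "nat (i - k)"])
  qed
qed (auto simp: window_eq_iff)

lemma central_eq_iff: "central x n = central y n \<longleftrightarrow> (\<forall>i. \<bar>i\<bar> \<le> int n \<longrightarrow> x i = y i)"
  unfolding central_def window_eq_iff' by (rule iff_allI) auto

lemma set_central: "set (central x n) = x ` {- int n..int n}"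
  unfolding central_def set_window by (rule arg_cong[where f = "\<lambda>A. x ` A"]) auto

lemma length_central [simp]: "length (central x n) = 2 * n + 1"
  by (simp add: central_def)

lemma birkhoff_sum_translate: "birkhoff_sum \<phi> n x = (\<Sum>k<n. \<phi> (translate (int k) x))"
  by (simp add: birkhoff_sum_def shift_funpow)

lemma birkhoff_sum_add:
  "birkhoff_sum \<phi> (m + n) x = birkhoff_sum \<phi> m x + birkhoff_sum \<phi> n (translate (int m) x)"
proof -
  have "(\<Sum>k=m..<m+n. \<phi> (translate (int k) x)) = (\<Sum>k<n. \<phi> (translate (int k) (translate (int m) x)))"
    using sum.shift_bounds_nat_ivl[of "\<lambda>k. \<phi> (translate (int k) x)" 0 m n]
    by (simp add: lessThan_atLeast0 add.commute)
  moreover have "(\<Sum>k<m+n. \<phi> (translate (int k) x))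
      = (\<Sum>k<m. \<phi> (translate (int k) x)) + (\<Sum>k=m..<m+n. \<phi> (translate (int k) x))"
    by (simp add: lessThan_atLeast0 sum.atLeastLessThan_concat)
  ultimately show ?thesis
    by (simp add: birkhoff_sum_translate)
qed

section \<open>Finite words and the periodic points they generate\<close>

definition words :: "nat \<Rightarrow> nat \<Rightarrow> nat list set" where
  "words \<nu> n = {w. set w \<subseteq> {..<\<nu>} \<and> length w = n}"

lemma finite_words [simp]: "finite (words \<nu> n)"
  unfolding words_def by (rule finite_lists_length_eq) simp

lemma words_0 [simp]: "words \<nu> 0 = {[]}"
  by (auto simp: words_def)

lemma sum_words_add:
  "(\<Sum>w\<in>words \<nu> (m + n). h w) = (\<Sum>u\<in>words \<nu> m. \<Sum>v\<in>words \<nu> n. h (u @ v))"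
proof -
  have "(\<Sum>w\<in>words \<nu> (m + n). h w) = (\<Sum>(u, v)\<in>words \<nu> m \<times> words \<nu> n. h (u @ v))"
    by (rule sum.reindex_bij_witness[of _ "\<lambda>(u, v). u @ v" "\<lambda>w. (take m w, drop m w)"])
       (auto simp: words_def dest: in_set_takeD in_set_dropD)
  then show ?thesis
    by (simp add: sum.cartesian_product)
qed

lemma words_1: "words \<nu> (Suc 0) = (\<lambda>a. [a]) ` {..<\<nu>}"
  by (auto simp: words_def length_Suc_conv)

lemma sum_words_1: "(\<Sum>w\<in>words \<nu> (Suc 0). h w) = (\<Sum>a<\<nu>. h [a])"
  unfolding words_1 by (subst sum.reindex) (auto simp: inj_on_def)

lemma sum_words_snoc: "(\<Sum>w\<in>words \<nu> (Suc n). h w) = (\<Sum>u\<in>words \<nu> n. \<Sum>a<\<nu>. h (u @ [a]))"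
  using sum_words_add[where m = n and n = "Suc 0"] by (simp add: sum_words_1)

lemma sum_words_Cons: "(\<Sum>w\<in>words \<nu> (Suc n). h w) = (\<Sum>u\<in>words \<nu> n. \<Sum>a<\<nu>. h (a # u))"
  using sum_words_add[where m = "Suc 0" and n = n, of h]
  by (simp add: sum_words_1) (rule sum.swap)

text \<open>The chosen point of the cylinder of \<open>w\<close>; that its orbit closes up after
  \<open>length w\<close> steps makes orbit averages invariant later. For \<open>w = []\<close> the
  symbols are unspecified; only windows and Birkhoff sums of length 0 are taken there.\<close>

definition periodic :: "'a list \<Rightarrow> int \<Rightarrow> 'a" where
  "periodic w = (\<lambda>i. w ! nat (i mod int (length w)))"

lemma window_periodic [simp]: "window (periodic w) 0 (length w) = w"
  by (rule nth_equalityI) (auto simp: periodic_def)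

lemma window_periodic_words [simp]: "w \<in> words \<nu> n \<Longrightarrow> window (periodic w) 0 n = w"
  using window_periodic[of w] by (simp add: words_def)

lemma periodic_in: "w \<noteq> [] \<Longrightarrow> periodic w i \<in> set w"
  by (auto simp: periodic_def nat_less_iff intro!: nth_mem)

lemma periodic_less: "w \<in> words \<nu> n \<Longrightarrow> 0 < n \<Longrightarrow> periodic w i < \<nu>"
  using periodic_in[of w i] by (auto simp: words_def)

lemma translate_periodic [simp]: "translate (int (length w)) (periodic w) = periodic w"
  by (simp add: fun_eq_iff periodic_def)

section \<open>Subadditive sequences and the Gibbs inequality\<close>

text \<open>Fekete's lemma; \<open>lower\<close> keeps the infimum of \<open>a n / n\<close> finite.
  Being an infimum, the limit also bounds every single term, which the second conclusion
  records.\<close>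

lemma fekete:
  fixes a :: "nat \<Rightarrow> real"
  assumes subadd: "\<And>m n. a (m + n) \<le> a m + a n" and lower: "\<And>n. c * real n \<le> a n"
  obtains l where "(\<lambda>n. a n / real n) \<longlonglongrightarrow> l" and "\<And>n. real n * l \<le> a n"
proof -
  define A where "A = (\<lambda>n. a n / real n) ` {1..}"
  define l where "l = Inf A"
  have bdd: "bdd_below A"
    unfolding A_def bdd_below_def using lower by (auto simp: field_simps intro!: exI[of _ c])
  have le: "l \<le> a n / real n" if "n \<ge> 1" for n
    unfolding l_def by (rule cInf_lower) (use that bdd in \<open>auto simp: A_def\<close>)
  have mult: "a (q * N + r) \<le> real q * a N + a r" for q N r
  proof (induction q)
    case (Suc q)
    have "a (Suc q * N + r) \<le> a N + a (q * N + r)"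
      using subadd[of N "q * N + r"] by (simp add: add_ac)
    with Suc show ?case
      by (simp add: algebra_simps)
  qed simp
  have upper: "\<forall>\<^sub>F n in sequentially. a n / real n < l + e" if "e > 0" for e
  proof -
    have "\<exists>x\<in>A. x < l + e / 2"
      using cInf_lessD[of A "l + e / 2"] that unfolding l_def A_def by auto
    then obtain N where N: "N \<ge> 1" "a N / real N < l + e / 2"
      by (auto simp: A_def)
    \<comment> \<open>Absorbs the remainder of the division \<open>n = q * N + r\<close>: the term
      \<open>a r\<close>, and the amount by which \<open>q * N\<close> falls short of
      \<open>n\<close>, worth at most \<open>\<bar>a N\<bar>\<close>.\<close>
    define B where "B = (\<Sum>r<N. \<bar>a r\<bar>) + \<bar>a N\<bar>"
    have "(\<lambda>n. B / real n) \<longlonglongrightarrow> 0"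
      by (rule lim_const_over_n)
    then have "\<forall>\<^sub>F n in sequentially. B / real n < e / 2"
      by (rule order_tendstoD) (use that in simp)
    with eventually_gt_at_top[of 0] show ?thesis
    proof eventually_elim
      case (elim n)
      define q r where "q = n div N" and "r = n mod N"
      have n: "n = q * N + r" and r: "r < N"
        using N by (auto simp: q_def r_def)
      have "\<bar>a r\<bar> \<le> (\<Sum>r<N. \<bar>a r\<bar>)"
        by (rule member_le_sum) (use r in auto)
      moreover have "real q * a N = (real n - real r) * (a N / real N)"
        using N n by (simp add: field_simps)
      moreover have "\<bar>real r * (a N / real N)\<bar> \<le> \<bar>a N\<bar>"
        using r N by (simp add: abs_mult field_simps mult_right_mono)
      moreover have "(real n - real r) * (a N / real N) = real n * (a N / real N) - real r * (a N / real N)"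
        by (rule left_diff_distrib)
      ultimately have "a n \<le> real n * (a N / real N) + B"
        using mult[of q N r] unfolding n[symmetric] B_def by linarith
      then have "a n / real n \<le> a N / real N + B / real n"
        using elim by (simp add: field_simps)
      with N elim show ?case by linarith
    qed
  qed
  have "(\<lambda>n. a n / real n) \<longlonglongrightarrow> l"
  proof (rule order_tendstoI)
    fix b assume "b < l"
    show "\<forall>\<^sub>F n in sequentially. b < a n / real n"
      using eventually_ge_at_top[of 1] by eventually_elim (rule less_le_trans[OF \<open>b < l\<close> le])
  next
    fix b assume "l < b"
    then show "\<forall>\<^sub>F n in sequentially. a n / real n < b"
      using upper[of "b - l"] by simp
  qed
  moreover have "real n * l \<le> a n" for n
    using le[of n] lower[of 0] by (cases "n = 0") (auto simp: field_simps)
  ultimately show thesis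
    by (rule that)
qed

text \<open>Both \<open>b + K\<close> and \<open>- b + K\<close> are subadditive. The two infima of
  Fekete's lemma bound \<open>b n\<close> from both sides, so the error stays within
  \<open>K\<close> for every \<open>n\<close> and not only in the limit.\<close>

lemma quasi_additive_limit:
  fixes b :: "nat \<Rightarrow> real"
  assumes quasi: "\<And>m n. \<bar>b (m + n) - b m - b n\<bar> \<le> K"
  obtains P where "(\<lambda>n. b n / real n) \<longlonglongrightarrow> P" and "\<And>n. \<bar>b n - real n * P\<bar> \<le> K"
proof -
  \<comment> \<open>Supplies the linear lower bounds that Fekete's lemma asks for.\<close>
  have growth: "\<bar>b n - real n * b 1\<bar> \<le> K + K * real n" for n
  proof (induction n)
    case 0
    with quasi[of 0 0] show ?case by simp
  next
    case (Suc n)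
    with quasi[of n 1] show ?case by (simp add: algebra_simps)
  qed
  have "b (m + n) + K \<le> b m + K + (b n + K)" for m n
    using quasi[of m n] by linarith
  moreover have "(b 1 - K) * real n \<le> b n + K" for n
    using growth[of n] by (simp add: algebra_simps)
  ultimately obtain l where l: "(\<lambda>n. (b n + K) / real n) \<longlonglongrightarrow> l" "\<And>n. real n * l \<le> b n + K"
    using fekete[of "\<lambda>n. b n + K" "b 1 - K"] by blast
  have "- b (m + n) + K \<le> - b m + K + (- b n + K)" for m n
    using quasi[of m n] by linarith
  moreover have "(- b 1 - K) * real n \<le> - b n + K" for n
    using growth[of n] by (simp add: algebra_simps)
  ultimately obtain l' where l': "(\<lambda>n. (- b n + K) / real n) \<longlonglongrightarrow> l'" "\<And>n. real n * l' \<le> - b n + K"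
    using fekete[of "\<lambda>n. - b n + K" "- b 1 - K"] by blast
  have lim: "(\<lambda>n. b n / real n) \<longlonglongrightarrow> l"
    using tendsto_diff[OF l(1) lim_const_over_n[of K]] by (simp add: add_divide_distrib)
  have "(\<lambda>n. - (b n / real n)) \<longlonglongrightarrow> l'"
    using tendsto_diff[OF l'(1) lim_const_over_n[of K]] by (simp add: diff_divide_distrib)
  with tendsto_minus[OF lim] have "l' = - l"
    using LIMSEQ_unique by blast
  then have "\<bar>b n - real n * l\<bar> \<le> K" for n
    using l(2)[of n] l'(2)[of n] by simp
  with lim show thesis
    by (rule that)
qed

text \<open>Termwise \<open>ln t \<le> t - 1\<close> at \<open>t = q s / p s\<close>. The condition
  \<open>pos\<close> matters because of \<open>ln 0 = 0\<close>: a point with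
  \<open>q s = 0 < p s\<close> would cost nothing instead of infinitely much.\<close>

lemma gibbs_inequality:
  fixes p q :: "'a \<Rightarrow> real"
  assumes "finite S" and p: "\<And>s. s \<in> S \<Longrightarrow> 0 \<le> p s" "sum p S = 1"
    and q: "\<And>s. s \<in> S \<Longrightarrow> 0 \<le> q s" "sum q S \<le> 1" and pos: "\<And>s. s \<in> S \<Longrightarrow> 0 < p s \<Longrightarrow> 0 < q s"
  shows "- (\<Sum>s\<in>S. p s * ln (p s)) \<le> (\<Sum>s\<in>S. p s * - ln (q s))"
proof -
  have "p s * ln (q s) - p s * ln (p s) \<le> q s - p s" if s: "s \<in> S" for s
  proof (cases "p s = 0")
    case False
    then have "0 < p s" "0 < q s"
      using p(1)[OF s] pos[OF s] by auto
    then have "ln (q s / p s) \<le> q s / p s - 1"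
      by (intro ln_le_minus_one) simp
    then have "p s * ln (q s / p s) \<le> p s * (q s / p s - 1)"
      using \<open>0 < p s\<close> by (intro mult_left_mono) auto
    then show ?thesis
      using \<open>0 < p s\<close> \<open>0 < q s\<close> by (simp add: ln_div algebra_simps)
  qed (use q(1)[OF s] in simp)
  then have "(\<Sum>s\<in>S. p s * ln (q s) - p s * ln (p s)) \<le> (\<Sum>s\<in>S. q s - p s)"
    by (rule sum_mono)
  with p(2) q(2) show ?thesis
    by (simp add: sum_subtractf sum_negf)
qed

subsection \<open>Hoelder continuity and bounded distortion\<close>

text \<open>Unlike in \<open>holder_continuous\<close>, the points may agree beyond distance
  \<open>m\<close>; the constants are parameters, since \<open>C\<close> and \<open>\<theta>\<close>
  enter later bounds.\<close>

definition locally_holder :: "(int \<Rightarrow> 'a) set \<Rightarrow> ((int \<Rightarrow> 'a) \<Rightarrow> real) \<Rightarrow> real \<Rightarrow> real \<Rightarrow> bool" where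
  "locally_holder X \<phi> C \<theta> \<longleftrightarrow> 0 \<le> C \<and> 0 < \<theta> \<and> \<theta> < 1 \<and>
     (\<forall>m>0. \<forall>x\<in>X. \<forall>y\<in>X. (\<forall>i. \<bar>i\<bar> < int m \<longrightarrow> x i = y i) \<longrightarrow> \<bar>\<phi> x - \<phi> y\<bar> \<le> C * \<theta> ^ m)"

lemma locally_holderD:
  "locally_holder X \<phi> C \<theta> \<Longrightarrow> 0 < m \<Longrightarrow> x \<in> X \<Longrightarrow> y \<in> X \<Longrightarrow> (\<And>i. \<bar>i\<bar> < int m \<Longrightarrow> x i = y i)
    \<Longrightarrow> \<bar>\<phi> x - \<phi> y\<bar> \<le> C * \<theta> ^ m"
  by (simp add: locally_holder_def)

text \<open>Points that agree at distances below \<open>m\<close> first differ at some distance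
  \<open>n \<ge> m\<close>, where the hypothesis applies, and the powers of \<open>\<theta>\<close>
  decrease. \<open>\<bar>C\<bar>\<close> is taken because \<open>C\<close> may be negative.\<close>

lemma holder_imp_locally_holder:
  assumes "holder_continuous X \<phi>"
  obtains C \<theta> where "locally_holder X \<phi> C \<theta>"
proof -
  obtain \<theta> C where \<theta>: "0 < \<theta>" "\<theta> < 1" and h: "\<And>n x y. n > 0 \<Longrightarrow> x \<in> X \<Longrightarrow> y \<in> X \<Longrightarrow>
      (\<forall>i. \<bar>i\<bar> < int n \<longrightarrow> x i = y i) \<and> (x (- int n) \<noteq> y (- int n) \<or> x (int n) \<noteq> y (int n))
      \<Longrightarrow> \<bar>\<phi> x - \<phi> y\<bar> \<le> C * \<theta> ^ n"
    using assms unfolding holder_continuous_def by metis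
  have "\<bar>\<phi> x - \<phi> y\<bar> \<le> \<bar>C\<bar> * \<theta> ^ m"
    if m: "m > 0" "x \<in> X" "y \<in> X" and agree: "\<forall>i. \<bar>i\<bar> < int m \<longrightarrow> x i = y i" for m x y
  proof (cases "x = y")
    case False
    define Q where "Q n \<longleftrightarrow> x (- int n) \<noteq> y (- int n) \<or> x (int n) \<noteq> y (int n)" for n
    obtain i where i: "x i \<noteq> y i"
      using False by blast
    have "Q (nat \<bar>i\<bar>)"
      using i by (cases "i \<ge> 0") (auto simp: Q_def)
    then have Q: "Q (LEAST n. Q n)"
      by (rule LeastI)
    define n where "n = (LEAST n. Q n)"
    have below: "x i = y i" if "\<bar>i\<bar> < int n" for i
    proof -
      have "\<not> Q (nat \<bar>i\<bar>)"
        unfolding n_def by (rule not_less_Least) (use that in \<open>simp add: n_def nat_less_iff\<close>)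
      then show ?thesis
        by (cases "i \<ge> 0") (auto simp: Q_def)
    qed
    have "m \<le> n"
    proof (rule ccontr)
      assume "\<not> m \<le> n"
      then have "\<not> Q n"
        using agree by (auto simp: Q_def)
      with Q show False by (simp add: n_def)
    qed
    moreover have "x (- int n) \<noteq> y (- int n) \<or> x (int n) \<noteq> y (int n)"
      using Q unfolding n_def[symmetric] unfolding Q_def .
    ultimately have "\<bar>\<phi> x - \<phi> y\<bar> \<le> C * \<theta> ^ n"
      using below m(1) by (intro h[OF _ m(2,3)] conjI allI impI) simp_all
    also have "\<dots> \<le> \<bar>C\<bar> * \<theta> ^ m"
      using \<theta> \<open>m \<le> n\<close> by (intro mult_mono power_decreasing) auto
    finally show ?thesis .
  qed (use \<theta> in simp)
  then have "locally_holder X \<phi> \<bar>C\<bar> \<theta>"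
    using \<theta> by (auto simp: locally_holder_def)
  then show thesis by (rule that)
qed

text \<open>One geometric series for each end of the window on which two points agree.\<close>

definition distortion :: "real \<Rightarrow> real \<Rightarrow> real" where
  "distortion C \<theta> = 2 * C / (1 - \<theta>)"

lemma birkhoff_sum_distortion:
  assumes hol: "locally_holder X \<phi> C \<theta>" and X: "\<And>k. translate k x \<in> X" "\<And>k. translate k y \<in> X"
    and win: "window x 0 n = window y 0 n"
  shows "\<bar>birkhoff_sum \<phi> n x - birkhoff_sum \<phi> n y\<bar> \<le> distortion C \<theta>"
proof -
  have C: "0 \<le> C" "0 < \<theta>" "\<theta> < 1"
    using hol by (auto simp: locally_holder_def)
  have geo: "(\<Sum>k<n. \<theta> ^ Suc k) \<le> 1 / (1 - \<theta>)"
  proof -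
    have "(\<Sum>k<n. \<theta> ^ Suc k) \<le> (\<Sum>k<n. \<theta> ^ k)"
      using C by (intro sum_mono power_decreasing) auto
    also have "\<dots> = (1 - \<theta> ^ n) / (1 - \<theta>)"
      using C by (simp add: sum_gp_strict)
    also have "\<dots> \<le> 1 / (1 - \<theta>)"
      using C by (intro divide_right_mono) auto
    finally show ?thesis .
  qed
  have "\<bar>\<phi> (translate (int k) x) - \<phi> (translate (int k) y)\<bar> \<le> C * (\<theta> ^ Suc k + \<theta> ^ Suc (n - Suc k))"
    if k: "k < n" for k
  proof -
    \<comment> \<open>Inside the window, position \<open>k\<close> has \<open>k\<close> neighbours
      on its left and \<open>n - 1 - k\<close> on its right, so the translates agree at all
      distances below this minimum.\<close>
    define m where "m = min (Suc k) (n - k)"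
    have "\<bar>\<phi> (translate (int k) x) - \<phi> (translate (int k) y)\<bar> \<le> C * \<theta> ^ m"
    proof (rule locally_holderD[OF hol])
      fix i assume "\<bar>i\<bar> < int m"
      then have "0 \<le> i + int k" "i + int k < int n"
        using k by (auto simp: m_def min_def split: if_splits)
      then show "translate (int k) x i = translate (int k) y i"
        using win by (simp add: window_eq_iff')
    qed (use k X in \<open>auto simp: m_def\<close>)
    also have "\<theta> ^ m \<le> \<theta> ^ Suc k + \<theta> ^ Suc (n - Suc k)"
      using C k by (simp add: m_def min_def Suc_diff_Suc)
    finally show ?thesis
      using C by (simp add: mult_left_mono)
  qed
  then have "(\<Sum>k<n. \<bar>\<phi> (translate (int k) x) - \<phi> (translate (int k) y)\<bar>)
      \<le> (\<Sum>k<n. C * (\<theta> ^ Suc k + \<theta> ^ Suc (n - Suc k)))"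
    by (intro sum_mono) simp
  also have "\<dots> = C * ((\<Sum>k<n. \<theta> ^ Suc k) + (\<Sum>k<n. \<theta> ^ Suc (n - Suc k)))"
    by (simp only: sum_distrib_left sum.distrib distrib_left)
  also have "(\<Sum>k<n. \<theta> ^ Suc (n - Suc k)) = (\<Sum>k<n. \<theta> ^ Suc k)"
    by (rule sum.nat_diff_reindex)
  also have "C * ((\<Sum>k<n. \<theta> ^ Suc k) + (\<Sum>k<n. \<theta> ^ Suc k)) \<le> C * (1 / (1 - \<theta>) + 1 / (1 - \<theta>))"
    using C geo by (intro mult_left_mono add_mono) auto
  also have "\<dots> = distortion C \<theta>"
    by (simp add: distortion_def)
  finally show ?thesis
    unfolding birkhoff_sum_translate sum_subtractf[symmetric]
    using sum_abs[of "\<lambda>k. \<phi> (translate (int k) x) - \<phi> (translate (int k) y)" "{..<n}"] by linarith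
qed

subsection \<open>The pressure of a full shift\<close>

text \<open>A potential on the full \<open>\<nu>\<close>-shift is extended to all integer-indexed sequences by reducing
  the symbols modulo \<open>\<nu>\<close>, so that no carrier set is needed.\<close>

locale full_shift =
  fixes \<nu> :: nat and F :: "(int \<Rightarrow> nat) \<Rightarrow> real" and C \<theta> :: real
  assumes \<nu>_pos: "0 < \<nu>"
    and hol: "locally_holder UNIV F C \<theta>"
    and F_mod: "\<And>x. F (\<lambda>i::int. x i mod \<nu>) = F x"
begin

abbreviation "D \<equiv> distortion C \<theta>"

definition Z :: "nat \<Rightarrow> real" where
  "Z n = (\<Sum>w\<in>words \<nu> n. exp (birkhoff_sum F n (periodic w)))"

definition P :: real where
  "P = lim (\<lambda>n. ln (Z n) / real n)"

lemma C_bounds: "0 \<le> C" "0 < \<theta>" "\<theta> < 1"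
  using hol by (auto simp: locally_holder_def)

lemma words_nonempty: "words \<nu> n \<noteq> {}"
proof -
  have "replicate n 0 \<in> words \<nu> n"
    using \<nu>_pos by (auto simp: words_def)
  then show ?thesis by blast
qed

lemma Z_pos: "0 < Z n"
  unfolding Z_def by (intro sum_pos words_nonempty) auto

lemma F_distortion:
  "window x 0 n = window y 0 n \<Longrightarrow> \<bar>birkhoff_sum F n x - birkhoff_sum F n y\<bar> \<le> D"
  by (rule birkhoff_sum_distortion[OF hol]) auto

text \<open>After reduction modulo \<open>\<nu>\<close>, every point agrees at coordinate 0 with one
  of the \<open>\<nu>\<close> constant sequences.\<close>

lemma F_bounded: obtains B where "\<And>x. \<bar>F x\<bar> \<le> B"
proof
  fix x :: "int \<Rightarrow> nat"
  define a where "a = x 0 mod \<nu>"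
  have "\<bar>F (\<lambda>i. x i mod \<nu>) - F (\<lambda>_. a)\<bar> \<le> C * \<theta> ^ 1"
    by (rule locally_holderD[OF hol]) (auto simp: a_def)
  moreover have "\<bar>F (\<lambda>_. a)\<bar> \<le> (\<Sum>a<\<nu>. \<bar>F (\<lambda>_. a)\<bar>)"
    by (rule member_le_sum) (use \<nu>_pos in \<open>auto simp: a_def\<close>)
  ultimately show "\<bar>F x\<bar> \<le> (\<Sum>a<\<nu>. \<bar>F (\<lambda>_. a)\<bar>) + C * \<theta>"
    by (simp add: F_mod)
qed

lemma birkhoff_sum_append:
  assumes "u \<in> words \<nu> m" "v \<in> words \<nu> n"
  shows "\<bar>birkhoff_sum F (m + n) (periodic (u @ v))
    - (birkhoff_sum F m (periodic u) + birkhoff_sum F n (periodic v))\<bar> \<le> 2 * D"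
proof -
  have uv: "u @ v \<in> words \<nu> (m + n)"
    using assms by (auto simp: words_def)
  have "window (periodic (u @ v)) 0 m @ window (periodic (u @ v)) (0 + int m) n = u @ v"
    using window_periodic_words[OF uv] by (simp only: window_add)
  then have "window (periodic (u @ v)) 0 m = u" "window (translate (int m) (periodic (u @ v))) 0 n = v"
    using assms by (auto simp: words_def)
  then have "\<bar>birkhoff_sum F m (periodic (u @ v)) - birkhoff_sum F m (periodic u)\<bar> \<le> D"
    "\<bar>birkhoff_sum F n (translate (int m) (periodic (u @ v))) - birkhoff_sum F n (periodic v)\<bar> \<le> D"
    using assms by (auto intro!: F_distortion simp del: window_translate)
  then show ?thesis
    unfolding birkhoff_sum_add by linarith
qed

text \<open>Words of a full shift concatenate freely, so \<open>Z (m + n)\<close> differs from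
  \<open>Z m * Z n\<close> only by distortion, once for each factor.\<close>

lemma ln_Z_quasi_additive: "\<bar>ln (Z (m + n)) - ln (Z m) - ln (Z n)\<bar> \<le> 2 * D"
proof -
  let ?B = "\<lambda>n w. birkhoff_sum F n (periodic w)"
  have prod: "exp c * (Z m * Z n) = (\<Sum>u\<in>words \<nu> m. \<Sum>v\<in>words \<nu> n. exp (?B m u + ?B n v + c))" for c
  proof -
    have "Z m * Z n = (\<Sum>u\<in>words \<nu> m. \<Sum>v\<in>words \<nu> n. exp (?B m u) * exp (?B n v))"
      unfolding Z_def by (rule sum_product)
    then show ?thesis
      by (simp add: exp_add mult_ac sum_distrib_left)
  qed
  have "Z (m + n) \<le> exp (2 * D) * (Z m * Z n)"
    unfolding prod unfolding Z_def sum_words_add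
  proof (intro sum_mono, unfold exp_le_cancel_iff)
    fix u v assume "u \<in> words \<nu> m" "v \<in> words \<nu> n"
    then show "?B (m + n) (u @ v) \<le> ?B m u + ?B n v + 2 * D"
      using birkhoff_sum_append[of u m v n] by linarith
  qed
  then have "ln (Z (m + n)) \<le> ln (exp (2 * D) * (Z m * Z n))"
    using Z_pos by (subst ln_le_cancel_iff) auto
  moreover have "exp (- 2 * D) * (Z m * Z n) \<le> Z (m + n)"
    unfolding prod unfolding Z_def sum_words_add
  proof (intro sum_mono, unfold exp_le_cancel_iff)
    fix u v assume "u \<in> words \<nu> m" "v \<in> words \<nu> n"
    then show "?B m u + ?B n v + (- 2 * D) \<le> ?B (m + n) (u @ v)"
      using birkhoff_sum_append[of u m v n] by linarith
  qed
  then have "ln (exp (- 2 * D) * (Z m * Z n)) \<le> ln (Z (m + n))"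
    using Z_pos by (subst ln_le_cancel_iff) auto
  ultimately show ?thesis
    using Z_pos[of m] Z_pos[of n] by (simp add: ln_mult)
qed

lemma ln_Z_limit: "(\<lambda>n. ln (Z n) / real n) \<longlonglongrightarrow> P"
  and ln_Z_bound: "\<bar>ln (Z n) - real n * P\<bar> \<le> 2 * D"
proof -
  obtain p where p: "(\<lambda>n. ln (Z n) / real n) \<longlonglongrightarrow> p" "\<And>n. \<bar>ln (Z n) - real n * p\<bar> \<le> 2 * D"
    using quasi_additive_limit[of "\<lambda>n. ln (Z n)", OF ln_Z_quasi_additive] by blast
  then have "p = P"
    unfolding P_def by (auto dest: limI)
  with p show "(\<lambda>n. ln (Z n) / real n) \<longlonglongrightarrow> P" "\<bar>ln (Z n) - real n * P\<bar> \<le> 2 * D"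
    by auto
qed

lemma Z_le: "Z n \<le> exp (2 * D + real n * P)"
proof -
  have "exp (ln (Z n)) \<le> exp (2 * D + real n * P)"
    using ln_Z_bound[of n] by simp
  then show ?thesis
    using Z_pos by simp
qed

end

section \<open>Pressure as a common growth rate\<close>

lemma limit_of_bounded_difference:
  fixes a b :: "nat \<Rightarrow> real"
  assumes "(\<lambda>n. a n / real n) \<longlonglongrightarrow> l" and "\<And>n. \<bar>a n - b n\<bar> \<le> K"
  shows "(\<lambda>n. b n / real n) \<longlonglongrightarrow> l"
proof -
  have bound: "norm ((b n - a n) / real n) \<le> K / real n" for n
  proof -
    have "\<bar>b n - a n\<bar> \<le> K"
      using assms(2)[of n] by linarith
    then show ?thesis
      using divide_right_mono[of "\<bar>b n - a n\<bar>" K "real n"] by simp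
  qed
  have "(\<lambda>n. (b n - a n) / real n) \<longlonglongrightarrow> 0"
    by (rule Lim_null_comparison[OF always_eventually[OF allI[OF bound]] lim_const_over_n])
  from tendsto_add[OF assms(1) this] show ?thesis
    by (simp add: diff_divide_distrib)
qed

text \<open>Nonempty cylinders provide one admissible choice \<open>p\<close>; without it every
  number would satisfy the description vacuously and \<open>THE\<close> would not determine
  \<open>P\<close>.\<close>

lemma pressure_eqI:
  assumes "\<And>n w. w \<in> language X n \<Longrightarrow> cylinder X w \<noteq> {}"
    and "\<And>p. (\<And>n w. w \<in> language X n \<Longrightarrow> p w \<in> cylinder X w) \<Longrightarrow>
      (\<lambda>n. ln (partition_function X \<phi> p n) / real n) \<longlonglongrightarrow> P"
  shows "pressure X \<phi> = P"
proof -
  define p where "p w = (SOME x. x \<in> cylinder X w)" for w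
  have p: "p w \<in> cylinder X w" if "w \<in> language X n" for n w
    unfolding p_def using assms(1)[OF that] by (rule some_in_eq[THEN iffD2])
  show ?thesis
    unfolding pressure_def
  proof (rule the_equality)
    fix Q
    assume *: "\<forall>p. (\<forall>n. \<forall>w\<in>language X n. p w \<in> cylinder X w) \<longrightarrow>
        (\<lambda>n. ln (partition_function X \<phi> p n) / real n) \<longlonglongrightarrow> Q"
    have "(\<lambda>n. ln (partition_function X \<phi> p n) / real n) \<longlonglongrightarrow> Q"
      by (rule *[rule_format]) (rule p)
    moreover have "(\<lambda>n. ln (partition_function X \<phi> p n) / real n) \<longlonglongrightarrow> P"
      by (rule assms(2)) (rule p)
    ultimately show "Q = P"
      by (rule LIMSEQ_unique)
  next
    show "\<forall>p. (\<forall>n. \<forall>w\<in>language X n. p w \<in> cylinder X w) \<longrightarrow>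
        (\<lambda>n. ln (partition_function X \<phi> p n) / real n) \<longlonglongrightarrow> P"
    proof (intro allI impI)
      fix p :: "'a list \<Rightarrow> int \<Rightarrow> 'a"
      assume *: "\<forall>n. \<forall>w\<in>language X n. p w \<in> cylinder X w"
      show "(\<lambda>n. ln (partition_function X \<phi> p n) / real n) \<longlonglongrightarrow> P"
        by (rule assms(2)) (use * in blast)
    qed
  qed
qed

lemma cylinder_nonempty:
  assumes "\<And>x t. x \<in> X \<Longrightarrow> translate t x \<in> X" and "w \<in> language X n"
  shows "cylinder X w \<noteq> {}"
proof -
  obtain x k where "x \<in> X" "w = window x k n"
    using assms(2) by (auto simp: language_def)
  then have "translate k x \<in> cylinder X w"
    using assms(1) by (auto simp: cylinder_def)
  then show ?thesis by blast
qed

lemma length_language: "w \<in> language X n \<Longrightarrow> length w = n"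
  by (auto simp: language_def)

subsection \<open>Monochromatic sequences\<close>

text \<open>The coding of the full shift on \<open>{..<\<nu>}\<close> into colour \<open>j\<close>.
  It is total because of \<open>mod\<close>, and the \<open>+ 1\<close> keeps the symbol 0 for the
  gaps.\<close>

definition recolour :: "nat \<Rightarrow> nat \<Rightarrow> (int \<Rightarrow> nat) \<Rightarrow> int \<Rightarrow> nat" where
  "recolour \<nu> j x = (\<lambda>i. (j - 1) * \<nu> + 1 + x i mod \<nu>)"

lemma recolour_apply: "recolour \<nu> j x i = (j - 1) * \<nu> + 1 + x i mod \<nu>"
  by (simp add: recolour_def)

lemma translate_recolour: "translate t (recolour \<nu> j x) = recolour \<nu> j (translate t x)"
  by (simp add: fun_eq_iff recolour_apply)

lemma recolour_in_mono_shift: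
  assumes "0 < \<nu>" "1 \<le> j"
  shows "recolour \<nu> j x \<in> mono_shift \<nu> j"
proof -
  obtain k where "j = Suc k"
    using assms(2) by (cases j) auto
  moreover have "x i mod \<nu> < \<nu>" for i
    using assms(1) by simp
  ultimately show ?thesis
    by (auto simp: mono_shift_def colour_symbols_def recolour_apply Suc_le_eq)
qed

lemma mono_shift_eq_recolour:
  assumes "1 \<le> j" "y \<in> mono_shift \<nu> j"
  shows "recolour \<nu> j (\<lambda>i. y i - (j - 1) * \<nu> - 1) = y"
proof
  fix i
  obtain k where k: "j = Suc k"
    using assms(1) by (cases j) auto
  have "y i \<in> colour_symbols \<nu> j"
    using assms(2) by (auto simp: mono_shift_def)
  then have "k * \<nu> + 1 \<le> y i" "y i \<le> \<nu> + k * \<nu>"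
    by (auto simp: colour_symbols_def k)
  then have "y i - k * \<nu> - 1 < \<nu>"
    by linarith
  then show "recolour \<nu> j (\<lambda>i. y i - (j - 1) * \<nu> - 1) i = y i"
    using \<open>k * \<nu> + 1 \<le> y i\<close> by (simp add: recolour_apply k)
qed

lemma mono_shift_eq_range:
  assumes "0 < \<nu>" "1 \<le> j"
  shows "mono_shift \<nu> j = range (recolour \<nu> j)"
proof
  show "mono_shift \<nu> j \<subseteq> range (recolour \<nu> j)"
    using mono_shift_eq_recolour[OF assms(2)] by (blast intro: range_eqI sym)
qed (use recolour_in_mono_shift[OF assms] in blast)

lemma translate_mono_shift: "x \<in> mono_shift \<nu> j \<Longrightarrow> translate t x \<in> mono_shift \<nu> j"
  by (simp add: mono_shift_def)

lemma colour_symbols_unique: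
  assumes "a \<in> colour_symbols \<nu> j" "a \<in> colour_symbols \<nu> j'" "1 \<le> j" "1 \<le> j'"
  shows "j = j'"
proof -
  have "\<not> j < j'" if "a \<in> colour_symbols \<nu> j" "a \<in> colour_symbols \<nu> j'" "1 \<le> j'" for j j'
  proof
    assume "j < j'"
    then have "j * \<nu> \<le> (j' - 1) * \<nu>"
      by (intro mult_right_mono) auto
    moreover have "a \<le> j * \<nu>" "(j' - 1) * \<nu> + 1 \<le> a"
      using that by (simp_all add: colour_symbols_def)
    ultimately show False
      by linarith
  qed
  with assms show ?thesis
    by (meson linorder_neqE_nat)
qed

lemma colour_symbols_pos: "a \<in> colour_symbols \<nu> j \<Longrightarrow> 0 < a"
  by (simp add: colour_symbols_def)

lemma colour_symbols_le: "a \<in> colour_symbols \<nu> j \<Longrightarrow> j \<le> L \<Longrightarrow> a \<le> L * \<nu>"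
  by (auto simp: colour_symbols_def intro: order_trans mult_right_mono)

lemma finite_colour_symbols [simp]: "finite (colour_symbols \<nu> j)"
  by (simp add: colour_symbols_def)

lemma card_colour_symbols_le: "card (colour_symbols \<nu> j) \<le> \<nu>"
  by (cases j) (auto simp: colour_symbols_def)

lemma mono_shift_subset: "j \<in> {1..L} \<Longrightarrow> mono_shift \<nu> j \<subseteq> coloured_shift L \<nu> \<tau>"
  unfolding coloured_shift_def monochromatic_def
  by (auto simp: mono_shift_def intro: colour_symbols_le)

text \<open>The explicit form of the maximal block through \<open>i\<close>, bounded or not; it is
  empty when \<open>x i = 0\<close>.\<close>

definition block_at :: "(int \<Rightarrow> nat) \<Rightarrow> int \<Rightarrow> int set" where
  "block_at x i = {k. \<forall>m. min i k \<le> m \<and> m \<le> max i k \<longrightarrow> x m \<noteq> 0}"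

lemma max_block_block_at:
  assumes "x i \<noteq> 0"
  shows "max_block x (block_at x i)"
proof -
  have self: "i \<in> block_at x i"
    using assms by (auto simp: block_at_def)
  have "coloured_interval x (block_at x i)"
    unfolding coloured_interval_def
  proof (intro conjI ballI subsetI)
    fix a b k assume ab: "a \<in> block_at x i" "b \<in> block_at x i" and k: "k \<in> {a..b}"
    show "k \<in> block_at x i"
      unfolding block_at_def
    proof (intro CollectI allI impI)
      fix m assume "min i k \<le> m \<and> m \<le> max i k"
      with k have "min i a \<le> m \<and> m \<le> max i a \<or> min i b \<le> m \<and> m \<le> max i b"
        by (auto simp: min_def max_def split: if_splits)
      with ab show "x m \<noteq> 0"
        by (auto simp: block_at_def)
    qed
  next
    fix k assume "k \<in> block_at x i"
    then show "x k \<noteq> 0"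
      by (auto simp: block_at_def)
  qed (use self in blast)
  moreover have "J = block_at x i" if J: "coloured_interval x J" "block_at x i \<subseteq> J" for J
  proof
    show "J \<subseteq> block_at x i"
    proof
      fix k assume "k \<in> J"
      with self J have "{i..k} \<subseteq> J" "{k..i} \<subseteq> J" "\<forall>m\<in>J. x m \<noteq> 0"
        unfolding coloured_interval_def by blast+
      then show "k \<in> block_at x i"
        by (auto simp: block_at_def min_def max_def split: if_splits)
    qed
  qed fact
  ultimately show ?thesis
    by (simp add: max_block_def)
qed

lemma coloured_shift_block_colour:
  assumes "x \<in> coloured_shift L \<nu> \<tau>" "x i \<noteq> 0"
  obtains j where "j \<in> {1..L}" "x ` block_at x i \<subseteq> colour_symbols \<nu> j"
proof (cases "monochromatic L \<nu> x")
  case True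
  then show ?thesis
    by (auto simp: monochromatic_def mono_shift_def intro!: that)
next
  case False
  with assms(1) have "max_block x I \<longrightarrow> (\<exists>j\<in>{1..L}. x ` I \<subseteq> colour_symbols \<nu> j)" for I
    unfolding coloured_shift_def by blast
  with max_block_block_at[of x i, OF assms(2)] show ?thesis
    using that by blast
qed

section \<open>Translation invariance of the coloured shift\<close>

lemma coloured_interval_translate:
  "coloured_interval (translate t x) I \<longleftrightarrow> coloured_interval x ((\<lambda>i. i + t) ` I)"
proof -
  have "(\<forall>a\<in>I. \<forall>b\<in>I. {a..b} \<subseteq> I)
      \<longleftrightarrow> (\<forall>a\<in>(\<lambda>i. i + t) ` I. \<forall>b\<in>(\<lambda>i. i + t) ` I. {a..b} \<subseteq> (\<lambda>i. i + t) ` I)"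
  proof -
    have "{a + t..b + t} \<subseteq> (\<lambda>i. i + t) ` I \<longleftrightarrow> {a..b} \<subseteq> I" for a b
      by (subst image_add_atLeastAtMost'[symmetric], subst inj_image_subset_iff) (auto simp: inj_def)
    then show ?thesis by simp
  qed
  then show ?thesis
    by (simp add: coloured_interval_def)
qed

lemma translate_image_cancel: "(\<lambda>i::int. i + t) ` (\<lambda>i. i - t) ` I = I"
  by (simp add: image_image)

lemma max_block_translate:
  "max_block (translate t x) I \<longleftrightarrow> max_block x ((\<lambda>i. i + t) ` I)"
proof -
  have inj: "inj (\<lambda>i::int. i + t)"
    by (simp add: inj_def)
  have "(\<forall>J. coloured_interval x ((\<lambda>i. i + t) ` J) \<and> I \<subseteq> J \<longrightarrow> J = I)
     \<longleftrightarrow> (\<forall>J. coloured_interval x J \<and> (\<lambda>i. i + t) ` I \<subseteq> J \<longrightarrow> J = (\<lambda>i. i + t) ` I)" (is "?l \<longleftrightarrow> ?r")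
  proof
    assume l: ?l
    show ?r
    proof (intro allI impI)
      fix J assume J: "coloured_interval x J \<and> (\<lambda>i. i + t) ` I \<subseteq> J"
      then have "I \<subseteq> (\<lambda>i. i - t) ` J"
        by force
      moreover have "coloured_interval x ((\<lambda>i. i + t) ` (\<lambda>i. i - t) ` J)"
        using J by (simp only: translate_image_cancel)
      ultimately have "(\<lambda>i. i - t) ` J = I"
        using l by blast
      then show "J = (\<lambda>i. i + t) ` I"
        using translate_image_cancel by blast
    qed
  next
    assume r: ?r
    show ?l
    proof (intro allI impI)
      fix J assume J: "coloured_interval x ((\<lambda>i. i + t) ` J) \<and> I \<subseteq> J"
      then have "(\<lambda>i. i + t) ` J = (\<lambda>i. i + t) ` I"
        using r by (blast intro: image_mono)
      then show "J = I"
        by (simp only: inj_image_eq_iff[OF inj])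
    qed
  qed
  then show ?thesis
    by (simp add: max_block_def coloured_interval_translate)
qed

lemma gap_translate: "gap ((\<lambda>i. i + t) ` I) ((\<lambda>i. i + t) ` J) = (\<lambda>i. i + t) ` gap I J"
proof (intro set_eqI iffI)
  fix k assume "k \<in> gap ((\<lambda>i. i + t) ` I) ((\<lambda>i. i + t) ` J)"
  then have "k - t \<in> gap I J"
    by (force simp: gap_def)
  then show "k \<in> (\<lambda>i. i + t) ` gap I J"
    by (intro image_eqI[of _ _ "k - t"]) auto
qed (auto simp: gap_def)

lemma successive_blocks_translate:
  "successive_blocks (translate t x) I J \<longleftrightarrow> successive_blocks x ((\<lambda>i. i + t) ` I) ((\<lambda>i. i + t) ` J)"
  by (simp add: successive_blocks_def max_block_translate gap_translate)

lemma translate_coloured_shift: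
  assumes x: "x \<in> coloured_shift L \<nu> \<tau>"
  shows "translate t x \<in> coloured_shift L \<nu> \<tau>"
proof (cases "monochromatic L \<nu> x")
  case True
  then have "monochromatic L \<nu> (translate t x)"
    unfolding monochromatic_def by (blast intro: translate_mono_shift)
  with x show ?thesis
    by (simp add: coloured_shift_def)
next
  case False
  have inj: "inj_on (\<lambda>i::int. i + t) A" for A
    by (simp add: inj_on_def)
  have img: "translate t x ` I = x ` (\<lambda>i. i + t) ` I" for I
    by (simp add: image_image)
  have blocks: "max_block x I \<Longrightarrow> \<exists>j\<in>{1..L}. x ` I \<subseteq> colour_symbols \<nu> j" for I
    using x False by (simp add: coloured_shift_def)
  have succ: "finite I \<and> finite J \<and>
             (\<exists>j\<in>{1..L}. \<exists>j'\<in>{1..L}. (j' = j + 1 \<or> j = j' + 1) \<and>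
                x ` I \<subseteq> colour_symbols \<nu> j \<and> x ` J \<subseteq> colour_symbols \<nu> j') \<and>
             real (card (gap I J)) \<ge> \<tau> * real (card I + card J)" if "successive_blocks x I J" for I J
    using x False that unfolding coloured_shift_def by blast
  have "translate t x i \<le> L * \<nu>" for i
    using x by (simp add: coloured_shift_def)
  moreover have "\<exists>j\<in>{1..L}. translate t x ` I \<subseteq> colour_symbols \<nu> j" if "max_block (translate t x) I" for I
    using that blocks unfolding max_block_translate img by blast
  moreover have "finite I \<and> finite J \<and>
             (\<exists>j\<in>{1..L}. \<exists>j'\<in>{1..L}. (j' = j + 1 \<or> j = j' + 1) \<and>
                translate t x ` I \<subseteq> colour_symbols \<nu> j \<and> translate t x ` J \<subseteq> colour_symbols \<nu> j') \<and>
             real (card (gap I J)) \<ge> \<tau> * real (card I + card J)"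
    if "successive_blocks (translate t x) I J" for I J
    using succ[OF that[unfolded successive_blocks_translate]]
    unfolding img gap_translate card_image[OF inj] finite_image_iff[OF inj] by blast
  ultimately show ?thesis
    unfolding coloured_shift_def by blast
qed

lemma abs_ln_sum_exp_le:
  fixes a b :: "'a \<Rightarrow> real"
  assumes "finite S" "S \<noteq> {}" and close: "\<And>s. s \<in> S \<Longrightarrow> \<bar>a s - b s\<bar> \<le> K"
  shows "\<bar>ln (\<Sum>s\<in>S. exp (a s)) - ln (\<Sum>s\<in>S. exp (b s))\<bar> \<le> K"
proof -
  have pos: "0 < (\<Sum>s\<in>S. exp (a s))" for a :: "'a \<Rightarrow> real"
    by (intro sum_pos assms) auto
  have le: "ln (\<Sum>s\<in>S. exp (a s)) \<le> K + ln (\<Sum>s\<in>S. exp (b s))"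
    if "\<And>s. s \<in> S \<Longrightarrow> a s \<le> K + b s" for a b :: "'a \<Rightarrow> real"
  proof -
    have "(\<Sum>s\<in>S. exp (a s)) \<le> exp K * (\<Sum>s\<in>S. exp (b s))"
      unfolding sum_distrib_left exp_add[symmetric] by (intro sum_mono) (use that in auto)
    then have "ln (\<Sum>s\<in>S. exp (a s)) \<le> ln (exp K * (\<Sum>s\<in>S. exp (b s)))"
      using pos by (subst ln_le_cancel_iff) auto
    then show ?thesis
      using pos[of b] by (simp add: ln_mult)
  qed
  have "a s \<le> K + b s" "b s \<le> K + a s" if "s \<in> S" for s
    using close[OF that] by linarith+
  with le[of a b] le[of b a] show ?thesis
    by fastforce
qed

lemma sum_UN_le:
  fixes h :: "'a \<Rightarrow> real"
  assumes "finite I" "\<And>i. i \<in> I \<Longrightarrow> finite (A i)" "\<And>x. 0 \<le> h x"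
  shows "sum h (\<Union>i\<in>I. A i) \<le> (\<Sum>i\<in>I. sum h (A i))"
  using assms(1,2)
proof (induction I)
  case (insert i I)
  have "sum h (A i \<union> (\<Union>i\<in>I. A i)) \<le> sum h (A i) + sum h (\<Union>i\<in>I. A i)"
    using insert.prems insert.hyps
    by (subst sum.union_inter[symmetric]) (auto intro: sum_nonneg assms(3))
  with insert show ?case by simp
qed simp

lemma window_recolour:
  "window (recolour \<nu> j x) k n = map (\<lambda>a. (j - 1) * \<nu> + 1 + a mod \<nu>) (window x k n)"
  by (rule nth_equalityI) (auto simp: recolour_apply)

lemma birkhoff_sum_le:
  assumes "\<And>k. \<phi> (translate k x) \<le> M"
  shows "birkhoff_sum \<phi> n x \<le> real n * M"
  using sum_bounded_above[of "{..<n}" "\<lambda>k. \<phi> (translate (int k) x)" M] assms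
  by (simp add: birkhoff_sum_translate)

subsection \<open>The extended potential\<close>

locale coloured_system =
  fixes L \<nu> :: nat and \<tau> :: real and f g :: "(int \<Rightarrow> nat) \<Rightarrow> real" and C \<theta> :: real
  assumes L_pos: "1 \<le> L" and \<nu>_pos': "0 < \<nu>"
    and f_hol: "locally_holder (mono_shift \<nu> 1) f C \<theta>"
    and ext: "colour_extension L \<nu> \<tau> f g"
begin

abbreviation X where "X \<equiv> coloured_shift L \<nu> \<tau>"

definition F :: "(int \<Rightarrow> nat) \<Rightarrow> real" where
  "F x = f (recolour \<nu> 1 x)"

definition S :: real where
  "S = (SUP x\<in>mono_shift \<nu> 1. f x)"

sublocale full_shift \<nu> F C \<theta>
proof
  show "locally_holder UNIV F C \<theta>"
    unfolding locally_holder_def F_def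
  proof (intro conjI allI impI ballI)
    fix m :: nat and x y :: "int \<Rightarrow> nat"
    assume "0 < m" "\<forall>i. \<bar>i\<bar> < int m \<longrightarrow> x i = y i"
    then show "\<bar>f (recolour \<nu> 1 x) - f (recolour \<nu> 1 y)\<bar> \<le> C * \<theta> ^ m"
      by (intro locally_holderD[OF f_hol] recolour_in_mono_shift \<nu>_pos') (simp_all add: recolour_apply)
  qed (use f_hol in \<open>auto simp: locally_holder_def\<close>)
qed (use \<nu>_pos' in \<open>simp_all add: F_def recolour_def\<close>)

lemma g_recolour:
  assumes "j \<in> {1..L}"
  shows "g (recolour \<nu> j x) = F x"
proof (cases "j = 1")
  case True
  then show ?thesis
    using ext recolour_in_mono_shift[OF \<nu>_pos', of 1]
    by (simp add: colour_extension_def F_def)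
next
  case False
  have "recolour \<nu> j x \<in> mono_shift \<nu> j" "recolour \<nu> 1 x \<in> mono_shift \<nu> 1"
    using assms recolour_in_mono_shift[OF \<nu>_pos'] by auto
  moreover have "\<forall>i. recolour \<nu> j x i = recolour \<nu> 1 x i + (j - 1) * \<nu>"
    by (simp add: recolour_apply)
  moreover have "j \<in> {2..L}"
    using assms False by auto
  ultimately show ?thesis
    using ext unfolding colour_extension_def F_def by blast
qed

lemma F_le_S: "F x \<le> S"
proof -
  obtain B where "\<And>x. \<bar>F x\<bar> \<le> B"
    using F_bounded by blast
  then have "bdd_above (range F)"
    by (intro bdd_aboveI[of _ B]) (auto simp: abs_le_iff)
  moreover have "f ` mono_shift \<nu> 1 = range F"
    by (simp add: mono_shift_eq_range[OF \<nu>_pos'] F_def image_image)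
  ultimately show ?thesis
    unfolding S_def by (auto intro: cSUP_upper)
qed

lemma g_mono_le_S: "j \<in> {1..L} \<Longrightarrow> y \<in> mono_shift \<nu> j \<Longrightarrow> g y \<le> S"
  using mono_shift_eq_recolour[of j y \<nu>] g_recolour[of j] F_le_S by (metis atLeastAtMost_iff)

lemma g_zero: "x \<in> X \<Longrightarrow> x 0 = 0 \<Longrightarrow> g x = S"
  using ext by (simp add: colour_extension_def S_def)

lemma g_word_point:
  assumes "j \<in> {1..L}" "length w = 2 * n + 1" "set w \<subseteq> colour_symbols \<nu> j"
  obtains y where "y \<in> mono_shift \<nu> j" "central y n = w"
    "\<And>x. x \<in> X \<Longrightarrow> \<not> monochromatic L \<nu> x \<Longrightarrow> central x n = w \<Longrightarrow>
       \<not> set (central x (n + 1)) \<subseteq> colour_symbols \<nu> j \<Longrightarrow> g x = g y"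
  using ext assms unfolding colour_extension_def by meson

lemma not_monochromatic:
  assumes "j \<in> {1..L}" "x 0 \<in> colour_symbols \<nu> j" "x \<notin> mono_shift \<nu> j"
  shows "\<not> monochromatic L \<nu> x"
proof
  assume "monochromatic L \<nu> x"
  then obtain j' where j': "j' \<in> {1..L}" "x \<in> mono_shift \<nu> j'"
    by (auto simp: monochromatic_def)
  then have "x 0 \<in> colour_symbols \<nu> j'"
    by (simp add: mono_shift_def)
  with assms j' have "j = j'"
    using colour_symbols_unique by (metis atLeastAtMost_iff)
  with assms(3) j' show False by simp
qed

text \<open>The extension attaches a monochromatic point to the largest one-coloured central word of
  \<open>x\<close>; that point agrees with \<open>x\<close> on every smaller central window as well.
  This reduces estimates for \<open>g\<close> to the full shift.\<close>

lemma g_eq_mono: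
  assumes x: "x \<in> X" and j: "j \<in> {1..L}" and cent: "set (central x r) \<subseteq> colour_symbols \<nu> j"
  obtains y where "y \<in> mono_shift \<nu> j" "central y r = central x r" "g x = g y"
proof (cases "x \<in> mono_shift \<nu> j")
  case False
  define Q where "Q n \<longleftrightarrow> \<not> set (central x n) \<subseteq> colour_symbols \<nu> j" for n
  obtain i where i: "x i \<notin> colour_symbols \<nu> j"
    using False by (auto simp: mono_shift_def)
  have "Q (nat \<bar>i\<bar>)"
    unfolding Q_def set_central
  proof
    assume "x ` {- int (nat \<bar>i\<bar>)..int (nat \<bar>i\<bar>)} \<subseteq> colour_symbols \<nu> j"
    then have "x i \<in> colour_symbols \<nu> j"
      by (rule subsetD) (rule imageI, auto)
    with i show False ..
  qed
  then have Q: "Q (LEAST n. Q n)"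
    by (rule LeastI)
  have nQ: "\<not> Q n" if "n \<le> r" for n
    using cent that unfolding Q_def set_central by fastforce
  \<comment> \<open>The least radius that leaves colour \<open>j\<close> is one more than the
    largest radius that stays in it; the extension is formulated with the latter.\<close>
  define n where "n = (LEAST n. Q n) - 1"
  have "r < (LEAST n. Q n)"
    using nQ Q by (meson not_less)
  then have n: "(LEAST n. Q n) = n + 1" "r \<le> n"
    by (auto simp: n_def)
  have "\<not> Q n"
    by (rule not_less_Least) (simp add: n)
  then have cn: "set (central x n) \<subseteq> colour_symbols \<nu> j"
    by (simp add: Q_def)
  have "x 0 \<in> colour_symbols \<nu> j"
    using cn by (auto simp: set_central)
  then have nm: "\<not> monochromatic L \<nu> x"
    using not_monochromatic j False by blast
  have cn1: "\<not> set (central x (n + 1)) \<subseteq> colour_symbols \<nu> j"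
    using Q[unfolded n(1)] unfolding Q_def .
  obtain y where y: "y \<in> mono_shift \<nu> j" "central y n = central x n"
    and eq: "\<And>z. z \<in> X \<Longrightarrow> \<not> monochromatic L \<nu> z \<Longrightarrow> central z n = central x n \<Longrightarrow>
      \<not> set (central z (n + 1)) \<subseteq> colour_symbols \<nu> j \<Longrightarrow> g z = g y"
    using g_word_point[OF j length_central cn] by blast
  have "central y r = central x r"
    using y(2) n(2) by (auto simp: central_eq_iff)
  with y(1) show thesis
    using eq[OF x nm refl cn1] by (rule that)
qed (use that in blast)

lemma coloured_shift_symbol_colour:
  assumes "x \<in> X" "x i \<noteq> 0"
  obtains j where "j \<in> {1..L}" "x i \<in> colour_symbols \<nu> j"
proof -
  obtain j where "j \<in> {1..L}" "x ` block_at x i \<subseteq> colour_symbols \<nu> j"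
    by (rule coloured_shift_block_colour[OF assms])
  moreover have "i \<in> block_at x i"
    using assms(2) by (auto simp: block_at_def)
  ultimately show thesis
    using that by blast
qed

lemma g_le_S:
  assumes "x \<in> X"
  shows "g x \<le> S"
proof (cases "x 0 = 0")
  case False
  then obtain j where j: "j \<in> {1..L}" "x 0 \<in> colour_symbols \<nu> j"
    using coloured_shift_symbol_colour assms by blast
  then have "set (central x 0) \<subseteq> colour_symbols \<nu> j"
    by (simp add: set_central)
  then obtain y where "y \<in> mono_shift \<nu> j" "g x = g y"
    using g_eq_mono assms j by metis
  with j show ?thesis
    using g_mono_le_S by simp
qed (use g_zero assms in simp)

text \<open>If the window on which two points agree has one colour, both values are taken at
  monochromatic points that agree on it, so the constants of \<open>f\<close> survive. If it is
  centred at a coloured symbol but has more than one colour or a zero, the largest one-coloured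
  central word lies inside it, both points receive the same monochromatic point, and the values
  coincide.\<close>

lemma g_hol: "locally_holder X g C \<theta>"
  unfolding locally_holder_def
proof (intro conjI allI impI ballI)
  fix m :: nat and x x' assume m: "0 < m" and x: "x \<in> X" "x' \<in> X"
    and agree: "\<forall>i. \<bar>i\<bar> < int m \<longrightarrow> x i = x' i"
  have cent: "central x r = central x' r" if "r < m" for r
    using agree that by (auto simp: central_eq_iff)
  have same0: "x 0 = x' 0"
    using agree m by simp
  show "\<bar>g x - g x'\<bar> \<le> C * \<theta> ^ m"
  proof (cases "x 0 = 0")
    case True
    then show ?thesis
      using g_zero x same0 C_bounds by simp
  next
    case False
    then obtain j where j: "j \<in> {1..L}" "x 0 \<in> colour_symbols \<nu> j"
      using coloured_shift_symbol_colour x by blast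
    show ?thesis
    proof (cases "set (central x (m - 1)) \<subseteq> colour_symbols \<nu> j")
      case True
      obtain y where y: "y \<in> mono_shift \<nu> j" "central y (m - 1) = central x (m - 1)" "g x = g y"
        using g_eq_mono[OF x(1) j(1) True] .
      obtain y' where y': "y' \<in> mono_shift \<nu> j" "central y' (m - 1) = central x' (m - 1)" "g x' = g y'"
        using g_eq_mono[OF x(2) j(1)] True cent[of "m - 1"] m by (metis diff_less zero_less_one)
      define u u' where "u = (\<lambda>i. y i - (j - 1) * \<nu> - 1)" and "u' = (\<lambda>i. y' i - (j - 1) * \<nu> - 1)"
      have rec: "recolour \<nu> j u = y" "recolour \<nu> j u' = y'"
        unfolding u_def u'_def using j y(1) y'(1) by (intro mono_shift_eq_recolour; simp)+
      have "y i = y' i" if "\<bar>i\<bar> < int m" for i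
        using y(2) y'(2) agree that by (simp add: central_eq_iff)
      then have "\<bar>F u - F u'\<bar> \<le> C * \<theta> ^ m"
        by (intro locally_holderD[OF hol m]) (auto simp: u_def u'_def)
      then show ?thesis
        using y(3) y'(3) rec g_recolour[OF j(1)] by metis
    next
      case False
      define Q where "Q n \<longleftrightarrow> \<not> set (central x n) \<subseteq> colour_symbols \<nu> j" for n
      have "Q (m - 1)"
        using False by (simp add: Q_def)
      then have Q: "Q (LEAST n. Q n)" and le: "(LEAST n. Q n) \<le> m - 1"
        by (rule LeastI, rule Least_le)
      have "\<not> Q 0"
        using j by (simp add: Q_def set_central)
      with Q obtain n where n: "(LEAST n. Q n) = n + 1"
        by (cases "LEAST n. Q n") auto
      have "\<not> Q n"
        by (rule not_less_Least) (simp add: n)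
      then have cn: "set (central x n) \<subseteq> colour_symbols \<nu> j"
        by (simp add: Q_def)
      have cn1: "\<not> set (central x (n + 1)) \<subseteq> colour_symbols \<nu> j"
        using Q[unfolded n(1)] unfolding Q_def .
      have eq: "central x' n = central x n" "central x' (n + 1) = central x (n + 1)"
        using cent[of n] cent[of "n + 1"] le m by (simp_all add: n)
      have "x \<notin> mono_shift \<nu> j"
        using cn1 by (auto simp: set_central mono_shift_def)
      then have nm: "\<not> monochromatic L \<nu> x"
        using not_monochromatic j by blast
      have "x' \<notin> mono_shift \<nu> j"
        using cn1 unfolding eq(2)[symmetric] by (auto simp: set_central mono_shift_def)
      then have nm': "\<not> monochromatic L \<nu> x'"
        using not_monochromatic j same0 by metis
      obtain y where "\<And>z. z \<in> X \<Longrightarrow> \<not> monochromatic L \<nu> z \<Longrightarrow> central z n = central x n \<Longrightarrow>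
          \<not> set (central z (n + 1)) \<subseteq> colour_symbols \<nu> j \<Longrightarrow> g z = g y"
        using g_word_point[OF j(1) length_central cn] by blast
      then have "g x = g y" "g x' = g y"
        using x nm nm' cn1 eq by simp_all
      then show ?thesis
        using C_bounds by simp
    qed
  qed
qed (use C_bounds in auto)

lemma birkhoff_sum_recolour:
  "j \<in> {1..L} \<Longrightarrow> birkhoff_sum g n (recolour \<nu> j x) = birkhoff_sum F n x"
  by (simp add: birkhoff_sum_translate translate_recolour g_recolour)

lemma recolour_in_X: "j \<in> {1..L} \<Longrightarrow> recolour \<nu> j x \<in> X"
  using recolour_in_mono_shift[OF \<nu>_pos', of j] mono_shift_subset[of j L \<nu> \<tau>] by auto

lemma g_distortion:
  assumes "j \<in> {1..L}" "x \<in> X" "window x 0 n = map (\<lambda>a. (j - 1) * \<nu> + 1 + a) u" "u \<in> words \<nu> n"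
  shows "\<bar>birkhoff_sum g n x - birkhoff_sum F n (periodic u)\<bar> \<le> D"
proof -
  have "window (recolour \<nu> j (periodic u)) 0 n = window x 0 n"
    using assms by (auto simp: window_recolour words_def subset_iff)
  then have "\<bar>birkhoff_sum g n x - birkhoff_sum g n (recolour \<nu> j (periodic u))\<bar> \<le> D"
    using assms translate_coloured_shift recolour_in_X
    by (intro birkhoff_sum_distortion[OF g_hol]) (auto simp del: translate_translate)
  then show ?thesis
    by (simp add: birkhoff_sum_recolour[OF assms(1)])
qed

lemma language_mono_shift: "language (mono_shift \<nu> 1) n = map Suc ` words \<nu> n"
proof (intro set_eqI iffI)
  fix w assume "w \<in> language (mono_shift \<nu> 1) n"
  then obtain x k where "x \<in> mono_shift \<nu> 1" "w = window x k n"
    by (auto simp: language_def)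
  then obtain y where "w = window (recolour \<nu> 1 y) k n"
    using mono_shift_eq_range[OF \<nu>_pos', of 1] by auto
  then have "w = map Suc (map (\<lambda>a. a mod \<nu>) (window y k n))"
    by (simp add: window_recolour)
  moreover have "map (\<lambda>a. a mod \<nu>) (window y k n) \<in> words \<nu> n"
    using \<nu>_pos' by (auto simp: words_def)
  ultimately show "w \<in> map Suc ` words \<nu> n"
    by blast
next
  fix w assume "w \<in> map Suc ` words \<nu> n"
  then obtain u where u: "u \<in> words \<nu> n" "w = map Suc u"
    by blast
  then have "window (recolour \<nu> 1 (periodic u)) 0 n = w"
    by (auto simp: window_recolour words_def subset_iff)
  then show "w \<in> language (mono_shift \<nu> 1) n"
    using recolour_in_mono_shift[OF \<nu>_pos', of 1] unfolding language_def by auto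
qed

text \<open>The points \<open>p w\<close> may lie anywhere in the cylinders of \<open>X\<close>, so
  the estimate serves the pressure of \<open>f\<close> and also the lower bound for the pressure of
  \<open>g\<close>.\<close>

lemma mono_points_close:
  assumes "\<And>w. w \<in> language (mono_shift \<nu> 1) n \<Longrightarrow> p w \<in> cylinder X w"
  shows "\<bar>ln (\<Sum>w\<in>language (mono_shift \<nu> 1) n. exp (birkhoff_sum g n (p w))) - ln (Z n)\<bar> \<le> D"
proof -
  have "inj_on (map Suc) (words \<nu> n)"
    by (simp add: inj_on_def)
  then have "(\<Sum>w\<in>language (mono_shift \<nu> 1) n. exp (birkhoff_sum g n (p w)))
      = (\<Sum>u\<in>words \<nu> n. exp (birkhoff_sum g n (p (map Suc u))))"
    unfolding language_mono_shift by (simp add: sum.reindex)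
  moreover have "\<bar>birkhoff_sum g n (p (map Suc u)) - birkhoff_sum F n (periodic u)\<bar> \<le> D"
    if u: "u \<in> words \<nu> n" for u
  proof (rule g_distortion[where j = 1])
    have "p (map Suc u) \<in> cylinder X (map Suc u)" "length u = n"
      using u by (auto simp only: language_mono_shift words_def intro!: assms)
    then show "p (map Suc u) \<in> X" "window (p (map Suc u)) 0 n = map (\<lambda>a. (1 - 1) * \<nu> + 1 + a) u"
      by (auto simp: cylinder_def)
  qed (use L_pos u in auto)
  ultimately show ?thesis
    unfolding Z_def by (simp add: abs_ln_sum_exp_le[OF finite_words words_nonempty])
qed

lemma pressure_mono_shift: "pressure (mono_shift \<nu> 1) f = P"
proof (rule pressure_eqI)
  fix p
  assume p: "\<And>n w. w \<in> language (mono_shift \<nu> 1) n \<Longrightarrow> p w \<in> cylinder (mono_shift \<nu> 1) w"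
  have sub: "mono_shift \<nu> 1 \<subseteq> X"
    using L_pos by (intro mono_shift_subset) auto
  have fg: "birkhoff_sum f n x = birkhoff_sum g n x" if "x \<in> mono_shift \<nu> 1" for n x
    using ext translate_mono_shift[OF that]
    by (simp add: birkhoff_sum_translate colour_extension_def)
  show "(\<lambda>n. ln (partition_function (mono_shift \<nu> 1) f p n) / real n) \<longlonglongrightarrow> P"
  proof (rule limit_of_bounded_difference[OF ln_Z_limit])
    fix n
    have pc: "p w \<in> mono_shift \<nu> 1" if "w \<in> language (mono_shift \<nu> 1) n" for w
      using p[OF that] by (simp add: cylinder_def)
    have "partition_function (mono_shift \<nu> 1) f p n
        = (\<Sum>w\<in>language (mono_shift \<nu> 1) n. exp (birkhoff_sum g n (p w)))"
      unfolding partition_function_def by (intro sum.cong refl) (simp only: fg[OF pc])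
    moreover have "p w \<in> cylinder X w" if "w \<in> language (mono_shift \<nu> 1) n" for w
      using p[OF that] sub by (auto simp: cylinder_def)
    ultimately show "\<bar>ln (Z n) - ln (partition_function (mono_shift \<nu> 1) f p n)\<bar> \<le> D"
      using mono_points_close[of n p] by (simp add: abs_minus_commute)
  qed
qed (use cylinder_nonempty translate_mono_shift in blast)

end

subsection \<open>Counting admissible words\<close>

text \<open>\<open>gap_tail \<tau> \<nu> l j t\<close>: the word \<open>t\<close> may follow a block of length \<open>l\<close> and colour \<open>j\<close>.\<close>

inductive gap_tail :: "real \<Rightarrow> nat \<Rightarrow> nat \<Rightarrow> nat \<Rightarrow> nat list \<Rightarrow> bool" for \<tau> \<nu> where
  zeros: "gap_tail \<tau> \<nu> l j (replicate m 0)"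
| block: "gap_tail \<tau> \<nu> l j (replicate h 0 @ B @ t)"
    if "set B \<subseteq> colour_symbols \<nu> j'" "B \<noteq> []" "j' = j + 1 \<or> j = j' + 1"
      "\<tau> * (real l + real (length B)) \<le> real h" "gap_tail \<tau> \<nu> (length B) j' t"

text \<open>The all-zero continuation is left out: it means that no further block follows, and words
  with a single block are to be weighted by the partition function of the full shift rather than
  counted.\<close>

definition block_tails :: "real \<Rightarrow> nat \<Rightarrow> nat \<Rightarrow> nat \<Rightarrow> nat \<Rightarrow> nat list set" where
  "block_tails \<tau> \<nu> l j m = {t. gap_tail \<tau> \<nu> l j t \<and> length t = m \<and> t \<noteq> replicate m 0}"

definition colour_words :: "nat \<Rightarrow> nat \<Rightarrow> nat \<Rightarrow> nat list set" where
  "colour_words \<nu> l j = {B. set B \<subseteq> colour_symbols \<nu> j \<and> length B = l}"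

lemma finite_colour_words [simp]: "finite (colour_words \<nu> l j)"
  unfolding colour_words_def by (rule finite_lists_length_eq) simp

lemma card_colour_words_le: "card (colour_words \<nu> l j) \<le> \<nu> ^ l"
  unfolding colour_words_def
  by (simp add: card_lists_length_eq card_colour_symbols_le power_mono)

text \<open>The recursion behind the count, which splits off the first block. Only an upper estimate
  is wanted: colours are not limited by \<open>L\<close>, and \<open>j - 1\<close> may be 0, a
  colour without symbols.\<close>

lemma block_tails_subset:
  "block_tails \<tau> \<nu> l j m \<subseteq>
     (\<Union>(l', j', h)\<in>{(l', j', h). l' \<in> {1..m} \<and> j' \<in> {j + 1, j - 1} \<and> h \<in> {h. h + l' \<le> m \<and> \<tau> * (real l + real l') \<le> real h}}.
       (\<lambda>(B, t). replicate h 0 @ B @ t) `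
         (colour_words \<nu> l' j' \<times> insert (replicate (m - h - l') 0) (block_tails \<tau> \<nu> l' j' (m - h - l'))))"
proof
  fix t assume "t \<in> block_tails \<tau> \<nu> l j m"
  then have t: "gap_tail \<tau> \<nu> l j t" "length t = m" "t \<noteq> replicate m 0"
    by (auto simp: block_tails_def)
  from t(1) show "t \<in> (\<Union>(l', j', h)\<in>{(l', j', h). l' \<in> {1..m} \<and> j' \<in> {j + 1, j - 1} \<and> h \<in> {h. h + l' \<le> m \<and> \<tau> * (real l + real l') \<le> real h}}.
       (\<lambda>(B, t). replicate h 0 @ B @ t) `
         (colour_words \<nu> l' j' \<times> insert (replicate (m - h - l') 0) (block_tails \<tau> \<nu> l' j' (m - h - l'))))"
  proof cases
    case zeros
    with t show ?thesis by auto
  next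
    case (block B j' h s)
    have len: "length s = m - h - length B" "h + length B \<le> m"
      using block(1) t(2) by auto
    have "(length B, j', h) \<in> {(l', j', h). l' \<in> {1..m} \<and> j' \<in> {j + 1, j - 1} \<and> h \<in> {h. h + l' \<le> m \<and> \<tau> * (real l + real l') \<le> real h}}"
      using block len by (auto simp: Suc_le_eq)
    moreover have "(B, s) \<in> colour_words \<nu> (length B) j' \<times>
        insert (replicate (m - h - length B) 0) (block_tails \<tau> \<nu> (length B) j' (m - h - length B))"
      using block len by (auto simp: colour_words_def block_tails_def)
    ultimately show ?thesis
      unfolding block(1) by (intro UN_I[of "(length B, j', h)"]) force+
  qed
qed

text \<open>A geometric series with \<open>c \<le> 1 / 2\<close> is at most twice its first term.
  This is what the \<open>ln 2\<close> in the hypothesis on the pressure is for.\<close>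

lemma sum_power_ge:
  fixes c :: real
  assumes c: "0 < c" "c \<le> 1 / 2" and "0 \<le> x"
  shows "(\<Sum>h\<in>{h. h \<le> m \<and> x \<le> real h}. c ^ h) \<le> 2 * c powr x"
proof -
  define k where "k = nat \<lceil>x\<rceil>"
  have k: "x \<le> real h \<longleftrightarrow> k \<le> h" for h
    unfolding k_def by (simp add: nat_le_iff ceiling_le_iff)
  have "(\<Sum>h\<in>{h. h \<le> m \<and> x \<le> real h}. c ^ h) = (\<Sum>h=k..m. c ^ h)"
    by (rule sum.cong) (auto simp: k)
  also have "\<dots> \<le> c ^ k * 2"
  proof (cases "k \<le> m")
    case True
    have "(\<Sum>h=k..m. c ^ h) = (c ^ k - c ^ Suc m) / (1 - c)"
      using True c by (simp add: sum_gp)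
    also have "\<dots> \<le> c ^ k / (1 - c)"
      using c by (intro divide_right_mono) auto
    also have "\<dots> \<le> c ^ k * 2"
    proof -
      have "1 / (1 - c) \<le> 2"
        using c by (simp add: field_simps)
      then have "c ^ k * (1 / (1 - c)) \<le> c ^ k * 2"
        using c by (intro mult_left_mono) auto
      then show ?thesis by simp
    qed
    finally show ?thesis .
  qed (use c in simp)
  also have "c ^ k = c powr real k"
    using c by (simp add: powr_realpow)
  also have "\<dots> \<le> c powr x"
    using c k[of k] by (intro powr_mono') auto
  finally show ?thesis by (simp add: mult.commute)
qed

lemma sum_fifth_powers: "(\<Sum>l=1..m. (1 / 5 :: real) ^ l) \<le> 1 / 4"
proof -
  define q :: real where "q = 1 / 5"
  have "4 * (\<Sum>l=1..m. q ^ l) = 1 - q ^ m"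
  proof (induction m)
    case (Suc m)
    have "q ^ m = 5 * (q * q ^ m)"
      by (simp add: q_def)
    with Suc show ?case by simp
  qed simp
  moreover have "0 \<le> q ^ m"
    by (simp add: q_def)
  ultimately show ?thesis
    unfolding q_def by linarith
qed

text \<open>Each further block costs a factor \<open>2\<close> for its colour, \<open>2\<close> for the excess length of the gap
  and \<open>1/5 + 1/25 + \<dots> = 1/4\<close> for its length and content, altogether \<open>1\<close>. This is where the
  constant \<open>5\<close> of the bound on \<open>\<tau>\<close> comes from.\<close>

lemma card_block_tails:
  fixes c \<tau> :: real
  assumes c: "0 < c" "c \<le> 1 / 2" and \<tau>: "0 \<le> \<tau>" and fifth: "real \<nu> * c powr (1 + \<tau>) \<le> 1 / 5"
  shows "finite (block_tails \<tau> \<nu> l j m) \<and>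
    c ^ m * real (card (block_tails \<tau> \<nu> l j m)) \<le> c powr (\<tau> * real l) * real m"
proof (induction m arbitrary: l j rule: less_induct)
  case (less m)
  define H where "H l' = {h. h + l' \<le> m \<and> \<tau> * (real l + real l') \<le> real h}" for l'
  define I where "I = {(l', j', h). l' \<in> {1..m} \<and> j' \<in> {j + 1, j - 1} \<and> h \<in> H l'}"
  define A where "A = (\<lambda>(l', j', h). (\<lambda>(B, t). replicate h 0 @ B @ t) `
         (colour_words \<nu> l' j' \<times> insert (replicate (m - h - l') 0) (block_tails \<tau> \<nu> l' j' (m - h - l'))))"
  have I_Sigma: "I = Sigma {1..m} (\<lambda>l'. {j + 1, j - 1} \<times> H l')"
    by (auto simp: I_def)
  have finH: "finite (H l')" for l'
    by (rule finite_subset[of _ "{..m}"]) (auto simp: H_def)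
  have finI: "finite I"
    unfolding I_Sigma using finH by auto
  have sub: "block_tails \<tau> \<nu> l j m \<subseteq> (\<Union>i\<in>I. A i)"
    using block_tails_subset[of \<tau> \<nu> l j m] unfolding I_def A_def H_def .
  have IH: "finite (block_tails \<tau> \<nu> l' j' (m - h - l'))"
    "c ^ (m - h - l') * real (card (block_tails \<tau> \<nu> l' j' (m - h - l'))) \<le> c powr (\<tau> * real l') * real (m - h - l')"
    if "(l', j', h) \<in> I" for l' j' h
    using less.IH[of "m - h - l'" l' j'] that by (auto simp: I_def H_def)
  have finA: "finite (A i)" if "i \<in> I" for i
    using IH(1) that by (cases i) (auto simp: A_def)
  have one: "c ^ m * real (card (A (l', j', h))) \<le> c ^ h * (real \<nu> * c) ^ l' * real m"
    if i: "(l', j', h) \<in> I" for l' j' h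
  proof -
    define n where "n = m - h - l'"
    have m: "m = h + l' + n" "n + 1 \<le> m"
      using i by (auto simp: I_def H_def n_def)
    have "card (A (l', j', h)) \<le> card (colour_words \<nu> l' j' \<times> insert (replicate n 0) (block_tails \<tau> \<nu> l' j' n))"
      unfolding A_def prod.case n_def[symmetric]
      by (rule card_image_le) (use IH(1)[OF i] in \<open>simp add: n_def\<close>)
    also have "\<dots> \<le> \<nu> ^ l' * (1 + card (block_tails \<tau> \<nu> l' j' n))"
      unfolding card_cartesian_product
      by (intro mult_mono card_colour_words_le) (auto simp: card_insert_if IH(1)[OF i, folded n_def])
    finally have "real (card (A (l', j', h))) \<le> real (\<nu> ^ l' * (1 + card (block_tails \<tau> \<nu> l' j' n)))"
      by (simp only: of_nat_le_iff)
    then have "c ^ m * real (card (A (l', j', h)))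
        \<le> c ^ m * (real \<nu> ^ l' * (1 + real (card (block_tails \<tau> \<nu> l' j' n))))"
      using c by (intro mult_left_mono) (auto simp: algebra_simps)
    also have "\<dots> = c ^ h * (real \<nu> * c) ^ l' * (c ^ n + c ^ n * real (card (block_tails \<tau> \<nu> l' j' n)))"
      unfolding m(1) by (simp add: power_add power_mult_distrib algebra_simps)
    also have "\<dots> \<le> c ^ h * (real \<nu> * c) ^ l' * real m"
    proof (rule mult_left_mono)
      \<comment> \<open>The \<open>1\<close> pays for the all-zero ending and \<open>real n\<close>
        for further blocks; as \<open>n + 1 \<le> m\<close>, the induction closes with the same
        linear factor. The gain \<open>c powr (\<tau> * real l')\<close> from the next gap is given
        away, because the all-zero ending does not have it.\<close>
      have "c ^ n \<le> 1"
        using c by (intro power_le_one) auto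
      moreover have "c powr (\<tau> * real l') * real n \<le> 1 * real n"
        using c \<tau> by (intro mult_right_mono powr_le1) auto
      ultimately show "c ^ n + c ^ n * real (card (block_tails \<tau> \<nu> l' j' n)) \<le> real m"
        using IH(2)[OF i, folded n_def] m(2) by linarith
    qed (use c in simp)
    finally show ?thesis .
  qed
  have "card (block_tails \<tau> \<nu> l j m) \<le> card (\<Union>i\<in>I. A i)"
    using sub finI finA by (intro card_mono) auto
  also have "\<dots> \<le> (\<Sum>i\<in>I. card (A i))"
    by (rule card_UN_le[OF finI])
  finally have "c ^ m * real (card (block_tails \<tau> \<nu> l j m)) \<le> c ^ m * real (\<Sum>i\<in>I. card (A i))"
    using c by (intro mult_left_mono) (auto simp only: of_nat_le_iff zero_le_power)
  also have "\<dots> = (\<Sum>(l', j', h)\<in>I. c ^ m * real (card (A (l', j', h))))"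
    by (simp add: sum_distrib_left case_prod_unfold)
  also have "\<dots> \<le> (\<Sum>(l', j', h)\<in>I. c ^ h * (real \<nu> * c) ^ l' * real m)"
    by (rule sum_mono) (use one in auto)
  also have "\<dots> = (\<Sum>l'=1..m. \<Sum>(j', h)\<in>{j + 1, j - 1} \<times> H l'. c ^ h * (real \<nu> * c) ^ l' * real m)"
    unfolding I_Sigma using finH by (subst sum.Sigma) (auto simp: case_prod_unfold)
  also have "\<dots> = (\<Sum>l'=1..m. 2 * ((\<Sum>h\<in>H l'. c ^ h) * ((real \<nu> * c) ^ l' * real m)))"
  proof (rule sum.cong[OF refl])
    fix l'
    have "card {j + 1, j - 1} = 2"
      by (simp add: card_insert_if)
    then show "(\<Sum>(j', h)\<in>{j + 1, j - 1} \<times> H l'. c ^ h * (real \<nu> * c) ^ l' * real m)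
        = 2 * ((\<Sum>h\<in>H l'. c ^ h) * ((real \<nu> * c) ^ l' * real m))"
      by (simp add: sum.cartesian_product[symmetric] sum_distrib_right mult.assoc del: sum.insert)
  qed
  also have "\<dots> \<le> (\<Sum>l'=1..m. 2 * (2 * c powr (\<tau> * (real l + real l')) * ((real \<nu> * c) ^ l' * real m)))"
  proof (intro sum_mono mult_left_mono mult_right_mono)
    fix l'
    have "(\<Sum>h\<in>H l'. c ^ h) \<le> (\<Sum>h\<in>{h. h \<le> m \<and> \<tau> * (real l + real l') \<le> real h}. c ^ h)"
      using c by (intro sum_mono2) (auto simp: H_def)
    also have "\<dots> \<le> 2 * c powr (\<tau> * (real l + real l'))"
      using \<tau> by (intro sum_power_ge c) auto
    finally show "(\<Sum>h\<in>H l'. c ^ h) \<le> 2 * c powr (\<tau> * (real l + real l'))" .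
  qed (use c in auto)
  \<comment> \<open>The gap is long enough for both neighbours: the share
    \<open>c powr (\<tau> * real l)\<close> is handed back to the preceding block, and the share of
    the new block turns \<open>\<nu> * c\<close> into
    \<open>\<nu> * c powr (1 + \<tau>)\<close>.\<close>
  also have "\<dots> = (\<Sum>l'=1..m. 4 * real m * c powr (\<tau> * real l) * (real \<nu> * c powr (1 + \<tau>)) ^ l')"
  proof (rule sum.cong[OF refl])
    fix l'
    have "c powr (\<tau> * (real l + real l')) = c powr (\<tau> * real l) * (c powr \<tau>) ^ l'"
      using c by (simp add: distrib_left powr_add powr_powr[symmetric] powr_realpow)
    moreover have "c powr (1 + \<tau>) = c * c powr \<tau>"
      using c by (simp add: powr_add)
    ultimately show "2 * (2 * c powr (\<tau> * (real l + real l')) * ((real \<nu> * c) ^ l' * real m))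
        = 4 * real m * c powr (\<tau> * real l) * (real \<nu> * c powr (1 + \<tau>)) ^ l'"
      by (simp only:) (simp add: power_mult_distrib mult_ac)
  qed
  also have "\<dots> \<le> (\<Sum>l'=1..m. 4 * real m * c powr (\<tau> * real l) * (1 / 5) ^ l')"
    using fifth c by (intro sum_mono mult_left_mono power_mono) auto
  also have "\<dots> = 4 * real m * c powr (\<tau> * real l) * (\<Sum>l'=1..m. (1 / 5) ^ l')"
    by (simp add: sum_distrib_left)
  also have "\<dots> \<le> 4 * real m * c powr (\<tau> * real l) * (1 / 4)"
    by (intro mult_left_mono sum_fifth_powers) auto
  finally show ?case
    using finite_subset[OF sub] finI finA by (auto simp: mult.commute)
qed

section \<open>Reading words of the coloured shift block by block\<close>

lemma first_block:
  fixes x :: "int \<Rightarrow> nat"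
  assumes "window x k m \<noteq> replicate m 0"
  obtains h l where "h + l \<le> m" "1 \<le> l" "\<And>i. k \<le> i \<Longrightarrow> i < k + int h \<Longrightarrow> x i = 0"
    "\<And>i. k + int h \<le> i \<Longrightarrow> i < k + int h + int l \<Longrightarrow> x i \<noteq> 0"
    "h + l = m \<or> x (k + int h + int l) = 0"
proof -
  define Q where "Q h \<longleftrightarrow> h < m \<and> x (k + int h) \<noteq> 0" for h
  have ex: "\<exists>h. Q h"
    using assms by (auto simp: list_eq_iff_nth_eq Q_def)
  define h where "h = (LEAST h. Q h)"
  have h: "h < m" "x (k + int h) \<noteq> 0"
    using LeastI_ex[OF ex] unfolding h_def[symmetric] by (auto simp: Q_def)
  have zero: "x i = 0" if "k \<le> i" "i < k + int h" for i
  proof -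
    have "\<not> Q (nat (i - k))"
      by (rule not_less_Least) (use that in \<open>simp add: h_def[symmetric] nat_less_iff\<close>)
    with that h show ?thesis by (auto simp: Q_def)
  qed
  define R where "R l \<longleftrightarrow> h + l = m \<or> x (k + int h + int l) = 0" for l
  have R: "R (m - h)"
    using h by (simp add: R_def)
  define l where "l = (LEAST l. R l)"
  have l: "h + l = m \<or> x (k + int h + int l) = 0"
    using LeastI[of R, OF R] unfolding l_def[symmetric] by (simp add: R_def)
  have "l \<le> m - h"
    unfolding l_def by (rule Least_le) (rule R)
  moreover have "l \<noteq> 0"
    using l h by (cases "l = 0") auto
  moreover have "x i \<noteq> 0" if "k + int h \<le> i" "i < k + int h + int l" for i
  proof -
    have "\<not> R (nat (i - k - int h))"
      by (rule not_less_Least) (use that in \<open>simp add: l_def[symmetric] nat_less_iff\<close>)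
    with that show ?thesis by (auto simp: R_def)
  qed
  ultimately show thesis
    using that[of h l] zero l h by auto
qed

lemma window_first_block:
  assumes "h + l \<le> m" "\<And>i. k \<le> i \<Longrightarrow> i < k + int h \<Longrightarrow> x i = 0"
  shows "window x k m = replicate h 0 @ window x (k + int h) l @ window x (k + int h + int l) (m - h - l)"
proof -
  have "m = h + (l + (m - h - l))"
    using assms(1) by simp
  then have "window x k m = window x k h @ window x (k + int h) l @ window x (k + int h + int l) (m - h - l)"
    by (metis window_add)
  moreover have "window x k h = replicate h 0"
    using assms(2) by (auto simp: list_eq_iff_nth_eq)
  ultimately show ?thesis by simp
qed

lemma block_at_interval:
  assumes "\<And>i. a \<le> i \<Longrightarrow> i < b \<Longrightarrow> x i \<noteq> 0" "a \<le> p" "p < b"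
  shows "{a..<b} \<subseteq> block_at x p"
  using assms by (auto simp: block_at_def min_def max_def)

text \<open>The interval \<open>{a..<b}\<close> may be only the end of its maximal block, and the
  last block of the window may be cut off. Visible lengths are then shorter than the true ones, and
  as \<open>0 \<le> \<tau>\<close> the gap condition still holds for them.\<close>

lemma gap_tail_window:
  assumes x: "x \<in> coloured_shift L \<nu> \<tau>" and nm: "\<not> monochromatic L \<nu> x" and \<tau>: "0 \<le> \<tau>"
    and j: "j \<in> {1..L}" and block: "x ` {a..<b} \<subseteq> colour_symbols \<nu> j" "a < b"
    and stop: "m = 0 \<or> x b = 0"
  shows "gap_tail \<tau> \<nu> (nat (b - a)) j (window x b m)"
  using j block stop
proof (induction m arbitrary: a b j rule: less_induct)
  case (less m)
  show ?case
  proof (cases "window x b m = replicate m 0")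
    case True
    then show ?thesis
      by (simp add: gap_tail.zeros)
  next
    case False
    then obtain h l where hl: "h + l \<le> m" "1 \<le> l"
      and zero: "\<And>i. b \<le> i \<Longrightarrow> i < b + int h \<Longrightarrow> x i = 0"
      and nz: "\<And>i. b + int h \<le> i \<Longrightarrow> i < b + int h + int l \<Longrightarrow> x i \<noteq> 0"
      and stop': "h + l = m \<or> x (b + int h + int l) = 0"
      by (rule first_block) blast
    define p where "p = b + int h"
    have xb: "x b = 0"
      using less.prems(4) hl by auto
    have xp: "x p \<noteq> 0"
      using nz[of p] hl by (simp add: p_def)
    have "h \<noteq> 0"
    proof
      assume "h = 0"
      with xb xp show False by (simp add: p_def)
    qed
    then have bp: "b < p"
      by (simp add: p_def)
    have nz0: "x i \<noteq> 0" if "a \<le> i" "i < b" for i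
      using less.prems(2) colour_symbols_pos[of "x i" \<nu> j] that by (auto simp: image_subset_iff)
    \<comment> \<open>The full blocks on the two sides of the gap, which are what the definition of
      the coloured shift constrains; \<open>b - 1\<close> and \<open>p\<close> are the coloured
      positions next to the gap.\<close>
    define I J where "I = block_at x (b - 1)" and "J = block_at x p"
    have subI: "{a..<b} \<subseteq> I"
      unfolding I_def by (rule block_at_interval) (use nz0 less.prems(3) in auto)
    have subJ: "{p..<p + int l} \<subseteq> J"
      unfolding J_def by (rule block_at_interval) (use nz hl in \<open>auto simp: p_def\<close>)
    have maxI: "max_block x I"
      unfolding I_def by (rule max_block_block_at) (use nz0[of "b - 1"] less.prems(3) in simp)
    have maxJ: "max_block x J"
      unfolding J_def by (rule max_block_block_at) (rule xp)
    have I_less: "i < b" if "i \<in> I" for i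
    proof (rule ccontr)
      assume "\<not> i < b"
      then have "min (b - 1) i \<le> b \<and> b \<le> max (b - 1) i"
        by auto
      with that have "x b \<noteq> 0"
        unfolding I_def block_at_def by blast
      with xb show False by simp
    qed
    have J_ge: "p \<le> i" if "i \<in> J" for i
    proof (rule ccontr)
      assume "\<not> p \<le> i"
      then have "min p i \<le> p - 1 \<and> p - 1 \<le> max p i"
        by auto
      with that have "x (p - 1) \<noteq> 0"
        unfolding J_def block_at_def by blast
      with zero[of "p - 1"] bp show False
        by (simp add: p_def)
    qed
    have gap: "gap I J = {b..<p}"
    proof (intro set_eqI iffI)
      fix i assume "i \<in> gap I J"
      moreover have "b - 1 \<in> I" "p \<in> J"
        using subI subJ hl less.prems(3) by auto
      ultimately show "i \<in> {b..<p}"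
        by (force simp: gap_def)
    next
      fix i assume "i \<in> {b..<p}"
      then show "i \<in> gap I J"
        using I_less J_ge by (force simp: gap_def)
    qed
    have "successive_blocks x I J"
      unfolding successive_blocks_def
    proof (intro conjI maxI maxJ ballI)
      show "i < k" if "i \<in> I" "k \<in> J" for i k
        using I_less[OF that(1)] J_ge[OF that(2)] bp by simp
      show "x i = 0" if "i \<in> gap I J" for i
        using that zero unfolding gap by (simp add: p_def)
    qed
    with x nm have "finite I \<and> finite J \<and>
             (\<exists>j\<in>{1..L}. \<exists>j'\<in>{1..L}. (j' = j + 1 \<or> j = j' + 1) \<and>
                x ` I \<subseteq> colour_symbols \<nu> j \<and> x ` J \<subseteq> colour_symbols \<nu> j') \<and>
             real (card (gap I J)) \<ge> \<tau> * real (card I + card J)"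
      unfolding coloured_shift_def by blast
    then obtain j1 j' where fin: "finite I" "finite J" and j1: "j1 \<in> {1..L}" "x ` I \<subseteq> colour_symbols \<nu> j1"
      and j': "j' \<in> {1..L}" "x ` J \<subseteq> colour_symbols \<nu> j'" "j' = j1 + 1 \<or> j1 = j' + 1"
      and long: "\<tau> * real (card I + card J) \<le> real (card (gap I J))"
      by blast
    have "b - 1 \<in> {a..<b}"
      using less.prems(3) by simp
    then have "x (b - 1) \<in> colour_symbols \<nu> j1" "x (b - 1) \<in> colour_symbols \<nu> j"
      using j1(2) subI less.prems(2) by blast+
    then have jj: "j1 = j"
      using colour_symbols_unique j1(1) less.prems(1) by (metis atLeastAtMost_iff)
    have "card {a..<b} \<le> card I" "card {p..<p + int l} \<le> card J"
      by (rule card_mono[OF fin(1) subI], rule card_mono[OF fin(2) subJ])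
    then have "\<tau> * (real (nat (b - a)) + real l) \<le> \<tau> * real (card I + card J)"
      using \<tau> by (intro mult_left_mono) auto
    also have "\<dots> \<le> real h"
      using long by (simp add: gap p_def)
    finally have gaplen: "\<tau> * (real (nat (b - a)) + real l) \<le> real h" .
    have "x ` {p..<p + int l} \<subseteq> colour_symbols \<nu> j'"
      using subJ j'(2) by blast
    moreover have "m - h - l = 0 \<or> x (p + int l) = 0"
      using stop' by (auto simp: p_def)
    ultimately have "gap_tail \<tau> \<nu> (nat (p + int l - p)) j' (window x (p + int l) (m - h - l))"
      using hl j'(1) by (intro less.IH) auto
    moreover have "set (window x p l) \<subseteq> colour_symbols \<nu> j'"
      using \<open>x ` {p..<p + int l} \<subseteq> colour_symbols \<nu> j'\<close> by (simp add: set_window)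
    moreover have "window x p l \<noteq> []"
      using hl by (metis length_window list.size(3) not_one_le_zero)
    ultimately have "gap_tail \<tau> \<nu> (nat (b - a)) j
        (replicate h 0 @ window x p l @ window x (p + int l) (m - h - l))"
      using j'(3) jj gaplen by (intro gap_tail.block[where j' = j']) auto
    then show ?thesis
      using window_first_block[OF hl(1) zero] by (simp add: p_def)
  qed
qed

lemma window_decomposition:
  assumes x: "x \<in> coloured_shift L \<nu> \<tau>" and \<tau>: "0 \<le> \<tau>" and w: "window x 0 n \<noteq> replicate n 0"
  obtains a l j B t where "a + l \<le> n" "1 \<le> l" "j \<in> {1..L}" "B \<in> colour_words \<nu> l j"
    "t = replicate (n - a - l) 0 \<or> t \<in> block_tails \<tau> \<nu> l j (n - a - l)"
    "window x 0 n = replicate a 0 @ B @ t"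
proof (cases "monochromatic L \<nu> x")
  case True
  then obtain j where j: "j \<in> {1..L}" "x \<in> mono_shift \<nu> j"
    by (auto simp: monochromatic_def)
  have "n \<noteq> 0"
    using w by (cases n) auto
  \<comment> \<open>A monochromatic word is one block; its empty tail counts as
    \<open>replicate 0 0\<close>.\<close>
  with j show thesis
    by (intro that[of 0 n j "window x 0 n" "[]"]) (auto simp: colour_words_def set_window mono_shift_def)
next
  case False
  obtain h l where hl: "h + l \<le> n" "1 \<le> l"
      and zero: "\<And>i. 0 \<le> i \<Longrightarrow> i < 0 + int h \<Longrightarrow> x i = 0"
      and nz: "\<And>i. 0 + int h \<le> i \<Longrightarrow> i < 0 + int h + int l \<Longrightarrow> x i \<noteq> 0"
      and stop: "h + l = n \<or> x (0 + int h + int l) = 0"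
    by (rule first_block[OF w]) blast
  have "x (int h) \<noteq> 0"
    using nz[of "int h"] hl by simp
  then obtain j where j: "j \<in> {1..L}" "x ` block_at x (int h) \<subseteq> colour_symbols \<nu> j"
    by (rule coloured_shift_block_colour[OF x])
  have "{int h..<int h + int l} \<subseteq> block_at x (int h)"
    by (rule block_at_interval) (use nz hl in auto)
  with j have sub: "x ` {int h..<int h + int l} \<subseteq> colour_symbols \<nu> j"
    by blast
  have "gap_tail \<tau> \<nu> (nat (int h + int l - int h)) j (window x (int h + int l) (n - h - l))"
    by (rule gap_tail_window[OF x False \<tau> j(1) sub]) (use hl stop in auto)
  then show thesis
    using hl j(1) sub window_first_block[OF hl(1) zero]
    by (intro that[of h l j "window x (int h) l" "window x (int h + int l) (n - h - l)"])
       (auto simp: colour_words_def block_tails_def set_window)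
qed

subsection \<open>The pressure of the coloured shift\<close>

lemma colour_words_eq:
  assumes "1 \<le> j"
  shows "colour_words \<nu> l j = map (\<lambda>a. (j - 1) * \<nu> + 1 + a) ` words \<nu> l"
proof (intro set_eqI iffI)
  obtain k where k: "j = Suc k"
    using assms by (cases j) auto
  fix B
  show "B \<in> map (\<lambda>a. (j - 1) * \<nu> + 1 + a) ` words \<nu> l" if "B \<in> colour_words \<nu> l j"
  proof
    have B: "k * \<nu> + 1 \<le> b" "b \<le> \<nu> + k * \<nu>" if "b \<in> set B" for b
      using that \<open>B \<in> colour_words \<nu> l j\<close> by (auto simp: colour_words_def colour_symbols_def k)
    then show "B = map (\<lambda>a. (j - 1) * \<nu> + 1 + a) (map (\<lambda>b. b - (k * \<nu> + 1)) B)"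
      by (simp only: k diff_Suc_1 map_map o_def) (rule map_idI[symmetric], use B(1) in force)
    have "b - (k * \<nu> + 1) < \<nu>" if "b \<in> set B" for b
      using B[OF that] by linarith
    then show "map (\<lambda>b. b - (k * \<nu> + 1)) B \<in> words \<nu> l"
      using that by (auto simp: words_def colour_words_def)
  qed
  show "B \<in> colour_words \<nu> l j" if "B \<in> map (\<lambda>a. (j - 1) * \<nu> + 1 + a) ` words \<nu> l"
    using that by (auto simp: words_def colour_words_def colour_symbols_def k Suc_le_eq subset_iff)
qed

locale coloured_pressure = coloured_system +
  assumes \<tau>_nonneg: "0 \<le> \<tau>"
    and pressure_gap: "S + ln 2 < P"
    and \<tau>_large: "ln (5 * real \<nu>) / (P - S) - 1 \<le> \<tau>"
begin

definition c :: real where "c = exp (S - P)"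

lemma c_bounds: "0 < c" "c \<le> 1 / 2"
proof -
  have "c \<le> exp (- ln 2)"
    unfolding c_def using pressure_gap by (subst exp_le_cancel_iff) simp
  then show "c \<le> 1 / 2"
    by (simp add: exp_minus)
qed (simp add: c_def)

text \<open>The lower bound on \<open>\<tau>\<close> in exponential form: multiplied out it says
  \<open>ln (5 * \<nu>) \<le> (1 + \<tau>) * (P - S)\<close>.\<close>

lemma c_fifth: "real \<nu> * c powr (1 + \<tau>) \<le> 1 / 5"
proof -
  have gap: "0 < P - S"
    using pressure_gap ln_gt_zero[of "2::real"] by linarith
  have "ln (5 * real \<nu>) / (P - S) \<le> 1 + \<tau>"
    using \<tau>_large by simp
  then have "ln (5 * real \<nu>) \<le> (1 + \<tau>) * (P - S)"
    using gap by (simp add: pos_divide_le_eq)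
  then have "(1 + \<tau>) * (S - P) \<le> - ln (5 * real \<nu>)"
    by (simp add: algebra_simps)
  then have "exp ((1 + \<tau>) * (S - P)) \<le> exp (- ln (5 * real \<nu>))"
    by simp
  then have "c powr (1 + \<tau>) \<le> 1 / (5 * real \<nu>)"
    using \<nu>_pos by (simp add: c_def powr_def exp_minus inverse_eq_divide)
  then have "real \<nu> * c powr (1 + \<tau>) \<le> real \<nu> * (1 / (5 * real \<nu>))"
    by (intro mult_left_mono) auto
  then show ?thesis
    using \<nu>_pos by simp
qed

lemma S_le_P: "S \<le> P"
  using pressure_gap ln_gt_zero[of "2::real"] by linarith

text \<open>The first block has no preceding block and hence no gap before it to draw on, so it
  takes its share \<open>c powr (\<tau> * real l)\<close> of the gap behind it; then
  \<open>\<nu> * c powr (1 + \<tau>) \<le> 1\<close> makes its length harmless.\<close>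

lemma card_block_tails_le:
  assumes "a + l \<le> n"
  shows "exp (real n * S) * (real \<nu> ^ l * real (card (block_tails \<tau> \<nu> l j (n - a - l)))) \<le> exp (real n * P) * real n"
proof -
  define m where "m = n - a - l"
  have n: "n = a + l + m"
    using assms by (simp add: m_def)
  have cm: "c ^ m * real (card (block_tails \<tau> \<nu> l j m)) \<le> c powr (\<tau> * real l) * real m"
    using card_block_tails[OF c_bounds \<tau>_nonneg c_fifth] by blast
  have tl: "c powr (\<tau> * real l) = (c powr \<tau>) ^ l"
    using c_bounds by (simp add: powr_powr[symmetric] powr_realpow)
  have "c ^ n * (real \<nu> ^ l * real (card (block_tails \<tau> \<nu> l j m)))
      = c ^ a * ((real \<nu> * c) ^ l * (c ^ m * real (card (block_tails \<tau> \<nu> l j m))))"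
    by (simp add: n power_add power_mult_distrib mult_ac)
  also have "\<dots> \<le> 1 * ((real \<nu> * c) ^ l * (c powr (\<tau> * real l) * real m))"
  proof (rule mult_mono)
    show "(real \<nu> * c) ^ l * (c ^ m * real (card (block_tails \<tau> \<nu> l j m)))
        \<le> (real \<nu> * c) ^ l * (c powr (\<tau> * real l) * real m)"
      using c_bounds by (intro mult_left_mono cm) auto
  qed (use c_bounds in \<open>auto intro: power_le_one\<close>)
  also have "\<dots> = (real \<nu> * c powr (1 + \<tau>)) ^ l * real m"
    using c_bounds by (simp add: tl powr_add power_mult_distrib mult_ac)
  also have "\<dots> \<le> 1 * real n"
    using c_fifth c_bounds by (intro mult_mono power_le_one) (auto simp: n)
  finally have "exp (real n * P) * (c ^ n * (real \<nu> ^ l * real (card (block_tails \<tau> \<nu> l j m)))) \<le> exp (real n * P) * real n"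
    by (intro mult_left_mono) auto
  moreover have "exp (real n * S) = exp (real n * P) * c ^ n"
    by (simp add: c_def exp_add[symmetric] exp_of_nat_mult[symmetric] algebra_simps)
  ultimately show ?thesis
    by (simp add: m_def mult.assoc)
qed

text \<open>The block is compared with a periodic point of the full shift at the cost of one
  distortion constant; each remaining position contributes at most \<open>S\<close>.\<close>

lemma one_block_weight:
  assumes x: "x \<in> X" and j: "j \<in> {1..L}" and n: "a + l \<le> n" and u: "u \<in> words \<nu> l"
    and w: "window x 0 n = replicate a 0 @ map (\<lambda>s. (j - 1) * \<nu> + 1 + s) u @ replicate (n - a - l) 0"
  shows "birkhoff_sum g n x \<le> real (n - l) * S + D + birkhoff_sum F l (periodic u)"
proof -
  define m where "m = n - a - l"
  have n_eq: "n = a + (l + m)"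
    using n by (simp add: m_def)
  have X: "translate t x \<in> X" for t
    using x by (rule translate_coloured_shift)
  have le: "birkhoff_sum g k (translate t x) \<le> real k * S" for k t
    by (rule birkhoff_sum_le) (rule g_le_S[OF translate_coloured_shift[OF X]])
  have "window x 0 a @ window x (int a) l @ window x (int a + int l) m
      = replicate a 0 @ map (\<lambda>s. (j - 1) * \<nu> + 1 + s) u @ replicate m 0"
    using w unfolding m_def[symmetric] by (simp add: n_eq window_add)
  then have "window x (int a) l = map (\<lambda>s. (j - 1) * \<nu> + 1 + s) u"
    using u by (simp add: words_def)
  then have "\<bar>birkhoff_sum g l (translate (int a) x) - birkhoff_sum F l (periodic u)\<bar> \<le> D"
    by (intro g_distortion[OF j X _ u]) simp
  moreover have "birkhoff_sum g n x = birkhoff_sum g a (translate 0 x)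
      + (birkhoff_sum g l (translate (int a) x) + birkhoff_sum g m (translate (int l + int a) x))"
    by (simp add: n_eq birkhoff_sum_add)
  moreover have "real a * S + real m * S = real (n - l) * S"
    by (simp add: n_eq algebra_simps)
  ultimately show ?thesis
    using le[of a 0] le[of m "int l + int a"] by linarith
qed

text \<open>The \<open>1\<close> stands for the zero word, and
  \<open>real L * (real n + 1) ^ 2\<close> counts colour, position and length of the first block. In
  \<open>3 * D\<close>, one distortion comes from the block and two from bounding \<open>Z l\<close>
  by \<open>exp (real l * P)\<close>. The summand \<open>real n\<close> is for words with several
  blocks.\<close>

lemma partition_function_upper:
  assumes p: "\<And>w. w \<in> language X n \<Longrightarrow> p w \<in> cylinder X w"
  shows "partition_function X g p n \<le> exp (real n * P) * (1 + real L * (real n + 1) ^ 2 * (exp (3 * D) + real n))"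
proof -
  \<comment> \<open>Zero off the language, because the covering sets may contain words that do not
    occur in \<open>X\<close>.\<close>
  define H where "H w = (if w \<in> language X n then exp (birkhoff_sum g n (p w)) else 0)" for w
  define J where "J = {(a, l, j). a + l \<le> n \<and> 1 \<le> l \<and> j \<in> {1..L}}"
  define One where "One = (\<lambda>(a, l, j). (\<lambda>u. replicate a 0 @ map (\<lambda>s. (j - 1) * \<nu> + 1 + s) u @ replicate (n - a - l) 0) ` words \<nu> l)"
  define Many where "Many = (\<lambda>(a, l, j). (\<lambda>(B, t). replicate a 0 @ B @ t) ` (colour_words \<nu> l j \<times> block_tails \<tau> \<nu> l j (n - a - l)))"
  have fin_tails: "finite (block_tails \<tau> \<nu> l j m)" for l j m
    using card_block_tails[OF c_bounds \<tau>_nonneg c_fifth] by blast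
  have fin: "finite (One i)" "finite (Many i)" for i
    by (auto simp: One_def Many_def fin_tails split: prod.split)
  have H_nonneg: "0 \<le> H w" for w
    by (simp add: H_def)
  have J_sub: "J \<subseteq> {..n} \<times> {..n} \<times> {1..L}"
    by (auto simp: J_def)
  have finJ: "finite J"
    by (rule finite_subset[OF J_sub]) auto
  have "card J \<le> card ({..n} \<times> {..n} \<times> {1..L})"
    by (rule card_mono[OF _ J_sub]) auto
  then have "real (card J) \<le> real ((n + 1) * ((n + 1) * L))"
    by (simp only: of_nat_le_iff) (simp add: card_cartesian_product)
  then have cardJ: "real (card J) \<le> real L * (real n + 1) ^ 2"
    by (simp add: power2_eq_square algebra_simps)
  have pX: "p w \<in> X" "window (p w) 0 n = w" if "w \<in> language X n" for w
    using p[OF that] length_language[OF that] by (auto simp: cylinder_def)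
  have H_le: "H w \<le> exp (real n * S)" for w
    using pX translate_coloured_shift g_le_S by (auto simp: H_def intro!: birkhoff_sum_le)
  have cover: "language X n \<subseteq> insert (replicate n 0) (\<Union>i\<in>J. One i \<union> Many i)"
  proof
    fix w assume "w \<in> language X n"
    then have x: "p w \<in> X" "window (p w) 0 n = w"
      by (rule pX)+
    show "w \<in> insert (replicate n 0) (\<Union>i\<in>J. One i \<union> Many i)"
    proof (cases "w = replicate n 0")
      case False
      then obtain a l j B t where d: "a + l \<le> n" "1 \<le> l" "j \<in> {1..L}" "B \<in> colour_words \<nu> l j"
        "t = replicate (n - a - l) 0 \<or> t \<in> block_tails \<tau> \<nu> l j (n - a - l)" "w = replicate a 0 @ B @ t"
        using window_decomposition[OF x(1) \<tau>_nonneg, of n] unfolding x(2) by blast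
      then have "(a, l, j) \<in> J"
        by (simp add: J_def)
      moreover have "w \<in> One (a, l, j) \<union> Many (a, l, j)"
        using d(5)
      proof
        assume t: "t = replicate (n - a - l) 0"
        have "B \<in> map (\<lambda>s. (j - 1) * \<nu> + 1 + s) ` words \<nu> l"
          using d(3,4) colour_words_eq[of j \<nu> l] by simp
        then obtain u where u: "u \<in> words \<nu> l" "B = map (\<lambda>s. (j - 1) * \<nu> + 1 + s) u"
          by blast
        show ?thesis
          unfolding One_def d(6) t u(2) prod.case by (intro UnI1 image_eqI[OF _ u(1)] refl)
      next
        assume "t \<in> block_tails \<tau> \<nu> l j (n - a - l)"
        with d(4) have "(B, t) \<in> colour_words \<nu> l j \<times> block_tails \<tau> \<nu> l j (n - a - l)"
          by simp
        then show ?thesis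
          unfolding Many_def d(6) by force
      qed
      ultimately show ?thesis by blast
    qed simp
  qed
  have one: "sum H (One i) \<le> exp (real n * P) * exp (3 * D)" if "i \<in> J" for i
  proof -
    obtain a l j where i: "i = (a, l, j)" "a + l \<le> n" "j \<in> {1..L}"
      using \<open>i \<in> J\<close> by (auto simp: J_def)
    define W where "W u = replicate a 0 @ map (\<lambda>s. (j - 1) * \<nu> + 1 + s) u @ replicate (n - a - l) 0" for u
    have "One i = W ` words \<nu> l"
      unfolding One_def i prod.case W_def ..
    then have "sum H (One i) \<le> (\<Sum>u\<in>words \<nu> l. H (W u))"
      using sum_image_le[of "words \<nu> l" H W] H_nonneg by (simp add: o_def)
    also have "\<dots> \<le> (\<Sum>u\<in>words \<nu> l. exp (real (n - l) * S + D) * exp (birkhoff_sum F l (periodic u)))"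
    proof (rule sum_mono)
      fix u assume u: "u \<in> words \<nu> l"
      show "H (W u) \<le> exp (real (n - l) * S + D) * exp (birkhoff_sum F l (periodic u))"
      proof (cases "W u \<in> language X n")
        case True
        show ?thesis
          using one_block_weight[OF pX(1)[OF True] i(3,2) u trans[OF pX(2)[OF True] W_def]]
          by (simp add: H_def True exp_add[symmetric])
      qed (simp add: H_def)
    qed
    also have "\<dots> = exp (real (n - l) * S + D) * Z l"
      by (simp add: Z_def sum_distrib_left)
    also have "\<dots> \<le> exp (real (n - l) * P + D) * exp (2 * D + real l * P)"
      using S_le_P Z_pos[of l] by (intro mult_mono Z_le) (auto simp: mult_left_mono)
    also have "\<dots> = exp (real n * P) * exp (3 * D)"
      using i(2) by (simp add: exp_add[symmetric] of_nat_diff algebra_simps)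
    finally show ?thesis .
  qed
  have many: "sum H (Many i) \<le> exp (real n * P) * real n" if "i \<in> J" for i
  proof -
    obtain a l j where i: "i = (a, l, j)" "a + l \<le> n" "j \<in> {1..L}"
      using \<open>i \<in> J\<close> by (auto simp: J_def)
    have "card (Many i) \<le> card (colour_words \<nu> l j \<times> block_tails \<tau> \<nu> l j (n - a - l))"
      unfolding Many_def i prod.case by (rule card_image_le) (simp add: fin_tails)
    also have "\<dots> \<le> \<nu> ^ l * card (block_tails \<tau> \<nu> l j (n - a - l))"
      unfolding card_cartesian_product by (intro mult_right_mono card_colour_words_le) auto
    finally have "real (card (Many i)) \<le> real (\<nu> ^ l * card (block_tails \<tau> \<nu> l j (n - a - l)))"
      by (simp only: of_nat_le_iff)
    then have "real (card (Many i)) * exp (real n * S)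
        \<le> real (\<nu> ^ l * card (block_tails \<tau> \<nu> l j (n - a - l))) * exp (real n * S)"
      by (intro mult_right_mono) auto
    moreover have "sum H (Many i) \<le> real (card (Many i)) * exp (real n * S)"
      by (rule sum_bounded_above) (rule H_le)
    ultimately have "sum H (Many i) \<le> real (\<nu> ^ l * card (block_tails \<tau> \<nu> l j (n - a - l))) * exp (real n * S)"
      by linarith
    also have "\<dots> = exp (real n * S) * (real \<nu> ^ l * real (card (block_tails \<tau> \<nu> l j (n - a - l))))"
      by simp
    also have "\<dots> \<le> exp (real n * P) * real n"
      by (rule card_block_tails_le[OF i(2)])
    finally show ?thesis .
  qed
  have both: "sum H (One i \<union> Many i) \<le> exp (real n * P) * (exp (3 * D) + real n)" if "i \<in> J" for i
  proof -
    have "sum H (One i \<union> Many i) = sum H (One i) + sum H (Many i) - sum H (One i \<inter> Many i)"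
      by (rule sum_Un) (rule fin)+
    then show ?thesis
      using one[OF that] many[OF that] sum_nonneg[of "One i \<inter> Many i" H] H_nonneg
      by (simp add: distrib_left)
  qed
  have "partition_function X g p n = sum H (language X n)"
    by (simp add: partition_function_def H_def)
  also have "\<dots> \<le> sum H (insert (replicate n 0) (\<Union>i\<in>J. One i \<union> Many i))"
    using cover finJ fin H_nonneg by (intro sum_mono2) auto
  also have "\<dots> \<le> H (replicate n 0) + sum H (\<Union>i\<in>J. One i \<union> Many i)"
    using finJ fin H_nonneg by (simp add: sum.insert_if)
  also have "\<dots> \<le> exp (real n * P) + (\<Sum>i\<in>J. exp (real n * P) * (exp (3 * D) + real n))"
  proof (rule add_mono)
    have "exp (real n * S) \<le> exp (real n * P)"
      using S_le_P by (simp add: mult_left_mono)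
    then show "H (replicate n 0) \<le> exp (real n * P)"
      using H_le order_trans by blast
    have "sum H (\<Union>i\<in>J. One i \<union> Many i) \<le> (\<Sum>i\<in>J. sum H (One i \<union> Many i))"
      using finJ fin H_nonneg by (intro sum_UN_le) auto
    also have "\<dots> \<le> (\<Sum>i\<in>J. exp (real n * P) * (exp (3 * D) + real n))"
      by (rule sum_mono) (rule both)
    finally show "sum H (\<Union>i\<in>J. One i \<union> Many i) \<le> (\<Sum>i\<in>J. exp (real n * P) * (exp (3 * D) + real n))" .
  qed
  also have "\<dots> = exp (real n * P) * (1 + real (card J) * (exp (3 * D) + real n))"
    by (simp add: algebra_simps)
  also have "\<dots> \<le> exp (real n * P) * (1 + real L * (real n + 1) ^ 2 * (exp (3 * D) + real n))"
    using cardJ by (intro mult_left_mono add_left_mono mult_right_mono) auto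
  finally show ?thesis .
qed

lemma partition_function_lower:
  assumes p: "\<And>w. w \<in> language X n \<Longrightarrow> p w \<in> cylinder X w"
    and fin: "finite (language X n)"
  shows "ln (Z n) - D \<le> ln (partition_function X g p n)"
proof -
  have "mono_shift \<nu> 1 \<subseteq> X"
    using L_pos by (intro mono_shift_subset) auto
  then have sub: "language (mono_shift \<nu> 1) n \<subseteq> language X n"
    by (auto simp: language_def)
  have "(\<Sum>w\<in>language (mono_shift \<nu> 1) n. exp (birkhoff_sum g n (p w))) \<le> partition_function X g p n"
    unfolding partition_function_def by (rule sum_mono2[OF fin sub]) simp
  moreover have "0 < (\<Sum>w\<in>language (mono_shift \<nu> 1) n. exp (birkhoff_sum g n (p w)))"
    unfolding language_mono_shift using words_nonempty by (intro sum_pos) auto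
  ultimately have "ln (\<Sum>w\<in>language (mono_shift \<nu> 1) n. exp (birkhoff_sum g n (p w))) \<le> ln (partition_function X g p n)"
    by simp
  moreover have "\<bar>ln (\<Sum>w\<in>language (mono_shift \<nu> 1) n. exp (birkhoff_sum g n (p w))) - ln (Z n)\<bar> \<le> D"
    by (rule mono_points_close) (use p sub in blast)
  ultimately show ?thesis
    by linarith
qed

lemma finite_language: "finite (language X n)"
proof (rule finite_subset)
  show "language X n \<subseteq> {w. set w \<subseteq> {..L * \<nu>} \<and> length w = n}"
    by (auto simp: language_def set_window coloured_shift_def)
qed (rule finite_lists_length_eq, simp)

lemma pressure_coloured_shift: "pressure X g = P"
proof (rule pressure_eqI)
  fix p
  assume p: "\<And>n w. w \<in> language X n \<Longrightarrow> p w \<in> cylinder X w"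
  \<comment> \<open>Chosen so that the polynomial factor is at most \<open>K * (n + 1) ^ 3\<close>,
    hence at most \<open>K * (2 * n) ^ 3\<close> for \<open>n \<ge> 1\<close>; its logarithm is
    negligible against \<open>n\<close>.\<close>
  define K where "K = 1 + real L * (exp (3 * D) + 1)"
  have K: "1 \<le> K"
    by (simp add: K_def)
  show "(\<lambda>n. ln (partition_function X g p n) / real n) \<longlonglongrightarrow> P"
  proof (rule tendsto_sandwich)
    show "(\<lambda>n. (ln (Z n) - D) / real n) \<longlonglongrightarrow> P"
      using tendsto_diff[OF ln_Z_limit lim_const_over_n[of D]] by (simp add: diff_divide_distrib)
    show "\<forall>\<^sub>F n in sequentially. (ln (Z n) - D) / real n \<le> ln (partition_function X g p n) / real n"
      using partition_function_lower[OF p finite_language] by (intro always_eventually allI divide_right_mono) auto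
    show "(\<lambda>n. P + (ln K + 3 * ln 2) / real n + 3 * (ln (real n) / real n)) \<longlonglongrightarrow> P"
      using tendsto_add[OF tendsto_add[OF tendsto_const[of P] lim_const_over_n[of "ln K + 3 * ln 2"]]
          tendsto_mult_left[OF lim_ln_over_n, of 3]] by simp
    show "\<forall>\<^sub>F n in sequentially. ln (partition_function X g p n) / real n
        \<le> P + (ln K + 3 * ln 2) / real n + 3 * (ln (real n) / real n)"
      using eventually_ge_at_top[of 1]
    proof eventually_elim
      case (elim n)
      have "0 < partition_function X g p n"
      proof -
        have "language (mono_shift \<nu> 1) n \<noteq> {}"
          unfolding language_mono_shift using words_nonempty by simp
        moreover have "mono_shift \<nu> 1 \<subseteq> X"
          using L_pos by (intro mono_shift_subset) auto
        ultimately have "language X n \<noteq> {}"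
          by (auto simp: language_def)
        then show ?thesis
          unfolding partition_function_def by (intro sum_pos finite_language) auto
      qed
      moreover have "partition_function X g p n \<le> exp (real n * P) * (K * (2 * real n) ^ 3)"
      proof -
        have "1 + real L * (real n + 1) ^ 2 * (exp (3 * D) + real n)
            \<le> (real n + 1) ^ 3 + real L * (real n + 1) ^ 2 * ((exp (3 * D) + 1) * (real n + 1))"
          by (intro add_mono mult_left_mono) (auto simp: algebra_simps add_increasing)
        also have "\<dots> = K * (real n + 1) ^ 3"
          by (simp add: K_def algebra_simps power2_eq_square power3_eq_cube)
        also have "\<dots> \<le> K * (2 * real n) ^ 3"
          using K elim by (intro mult_left_mono power_mono) auto
        finally show ?thesis
          using partition_function_upper[OF p, where n = n] by (meson exp_ge_zero mult_left_mono order_trans)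
      qed
      ultimately have "ln (partition_function X g p n) \<le> ln (exp (real n * P) * (K * (2 * real n) ^ 3))"
        by (simp only: ln_le_cancel_iff)
      also have "\<dots> = real n * P + (ln K + 3 * ln 2) + 3 * ln (real n)"
      proof -
        have "ln ((2 * real n) ^ 3) = 3 * ln (2 * real n)"
          using elim by (subst ln_realpow) auto
        also have "ln (2 * real n) = ln 2 + ln (real n)"
          using elim by (intro ln_mult_pos) auto
        finally have "ln ((2 * real n) ^ 3) = 3 * ln 2 + 3 * ln (real n)"
          by simp
        moreover have "ln (exp (real n * P) * (K * q)) = real n * P + (ln K + ln q)" if "0 < q" for q
          using K that by (simp add: ln_mult_pos)
        then have "ln (exp (real n * P) * (K * (2 * real n) ^ 3)) = real n * P + (ln K + ln ((2 * real n) ^ 3))"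
          using elim by (simp only: zero_less_power)
        ultimately show ?thesis
          by linarith
      qed
      finally show ?case
        using elim by (simp add: field_simps)
    qed
  qed
next
  fix n w assume "w \<in> language X n"
  then show "cylinder X w \<noteq> {}"
    by (rule cylinder_nonempty[rotated]) (rule translate_coloured_shift)
qed

end

subsection \<open>Entropy of random variables with finitely many values\<close>

text \<open>The mean of the information function. No set of values occurs in it, so only the level
  sets of \<open>Y\<close> matter, and entropies can be compared pointwise under the
  integral.\<close>

definition rv_entropy :: "'a measure \<Rightarrow> ('a \<Rightarrow> 'b) \<Rightarrow> real" where
  "rv_entropy M Y = (\<integral>x. - ln (measure M {y \<in> space M. Y y = Y x}) \<partial>M)"

context prob_space
begin

lemma prob_event_meas [measurable]:
  "Y \<in> M \<rightarrow>\<^sub>M count_space S \<Longrightarrow> {x \<in> space M. Y x = s} \<in> sets M"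
proof (cases "s \<in> S")
  assume "Y \<in> M \<rightarrow>\<^sub>M count_space S" "s \<in> S"
  then have "Y -` {s} \<inter> space M \<in> sets M"
    by (auto intro: measurable_sets)
  then show ?thesis
    by (simp add: vimage_def Int_def conj_commute)
next
  assume "Y \<in> M \<rightarrow>\<^sub>M count_space S" "s \<notin> S"
  then have "{x \<in> space M. Y x = s} = {}"
    by (auto dest: measurable_space)
  then show ?thesis by (simp only: sets.empty_sets)
qed

lemma finite_rv_integral:
  fixes h :: "'b \<Rightarrow> real"
  assumes Y: "Y \<in> M \<rightarrow>\<^sub>M count_space S" and S: "finite S"
  shows "integrable M (\<lambda>x. h (Y x))" (is ?int)
    and "(\<integral>x. h (Y x) \<partial>M) = (\<Sum>s\<in>S. prob {x \<in> space M. Y x = s} * h s)"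
proof -
  have eq: "h (Y x) = (\<Sum>s\<in>S. h s * indicator {x \<in> space M. Y x = s} x)" if "x \<in> space M" for x
  proof -
    have "Y x \<in> S"
      using measurable_space[OF Y that] by simp
    then show ?thesis
      using S that by (simp add: indicator_def if_distrib[of "(*) _"] cong: if_cong)
  qed
  have int: "integrable M (\<lambda>x. h s * indicator {x \<in> space M. Y x = s} x)" for s
    using prob_event_meas[OF Y] by (intro integrable_mult_right) (simp add: integrable_indicator_iff less_top[symmetric])
  have "integrable M (\<lambda>x. \<Sum>s\<in>S. h s * indicator {x \<in> space M. Y x = s} x)"
    by (intro Bochner_Integration.integrable_sum int)
  then show ?int
    by (rule Bochner_Integration.integrable_cong[THEN iffD2, rotated 2]) (auto simp: eq)
  have "(\<integral>x. h (Y x) \<partial>M) = (\<integral>x. (\<Sum>s\<in>S. h s * indicator {x \<in> space M. Y x = s} x) \<partial>M)"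
    by (rule Bochner_Integration.integral_cong) (auto simp: eq)
  also have "\<dots> = (\<Sum>s\<in>S. \<integral>x. h s * indicator {x \<in> space M. Y x = s} x \<partial>M)"
    by (rule Bochner_Integration.integral_sum) (rule int)
  also have "\<dots> = (\<Sum>s\<in>S. prob {x \<in> space M. Y x = s} * h s)"
  proof (intro sum.cong refl)
    fix s
    have "{x \<in> space M. Y x = s} \<inter> space M = {x \<in> space M. Y x = s}"
      by auto
    then show "(\<integral>x. h s * indicator {x \<in> space M. Y x = s} x \<partial>M) = prob {x \<in> space M. Y x = s} * h s"
      by simp
  qed
  finally show "(\<integral>x. h (Y x) \<partial>M) = (\<Sum>s\<in>S. prob {x \<in> space M. Y x = s} * h s)" .
qed

lemma rv_entropy_eq_sum:
  assumes Y: "Y \<in> M \<rightarrow>\<^sub>M count_space S" and S: "finite S"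
  shows "rv_entropy M Y = - (\<Sum>s\<in>S. prob {x \<in> space M. Y x = s} * ln (prob {x \<in> space M. Y x = s}))"
  unfolding rv_entropy_def
  using finite_rv_integral(2)[OF assms, of "\<lambda>s. - ln (prob {x \<in> space M. Y x = s})"]
  by (simp add: sum_negf)

lemma sum_prob_rv:
  assumes Y: "Y \<in> M \<rightarrow>\<^sub>M count_space S" and S: "finite S"
  shows "(\<Sum>s\<in>S. prob {x \<in> space M. Y x = s}) = 1"
  using finite_rv_integral(2)[OF assms, of "\<lambda>_. 1"] prob_space by simp

lemma rv_entropy_le_gibbs:
  assumes Y: "Y \<in> M \<rightarrow>\<^sub>M count_space S" and S: "finite S"
    and q: "\<And>s. s \<in> S \<Longrightarrow> 0 \<le> q s" "sum q S \<le> 1"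
    and pos: "\<And>s. s \<in> S \<Longrightarrow> 0 < prob {x \<in> space M. Y x = s} \<Longrightarrow> 0 < q s"
  shows "rv_entropy M Y \<le> (\<integral>x. - ln (q (Y x)) \<partial>M)"
  unfolding rv_entropy_eq_sum[OF Y S] finite_rv_integral(2)[OF Y S, of "\<lambda>s. - ln (q s)"]
  by (rule gibbs_inequality[OF S]) (use q pos sum_prob_rv[OF Y S] in auto)

lemma AE_prob_rv_pos:
  assumes Y: "Y \<in> M \<rightarrow>\<^sub>M count_space S" and S: "finite S"
  shows "AE x in M. 0 < prob {y \<in> space M. Y y = Y x}"
proof (rule AE_I')
  define N where "N = (\<Union>s\<in>{s\<in>S. prob {y \<in> space M. Y y = s} = 0}. {y \<in> space M. Y y = s})"
  show "N \<in> null_sets M"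
    unfolding N_def
  proof (rule null_sets_UN')
    show "countable {s\<in>S. prob {y \<in> space M. Y y = s} = 0}"
      using S by (simp add: countable_finite)
    show "{y \<in> space M. Y y = s} \<in> null_sets M" if "s \<in> {s\<in>S. prob {y \<in> space M. Y y = s} = 0}" for s
      using that prob_event_meas[OF Y, of s] by (auto simp: null_sets_def emeasure_eq_measure)
  qed
  show "{x \<in> space M. \<not> 0 < prob {y \<in> space M. Y y = Y x}} \<subseteq> N"
    using measurable_space[OF Y] by (auto simp: N_def zero_less_measure_iff)
qed

lemma rv_entropy_integrable:
  assumes Y: "Y \<in> M \<rightarrow>\<^sub>M count_space S" and S: "finite S"
  shows "integrable M (\<lambda>x. - ln (prob {y \<in> space M. Y y = Y x}))"
  using finite_rv_integral(1)[OF assms, of "\<lambda>s. - ln (prob {x \<in> space M. Y x = s})"] .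

text \<open>Smaller level sets carry more information at each point. The comparison is made almost
  everywhere, since on level sets of measure 0 the convention \<open>ln 0 = 0\<close> could reverse
  it.\<close>

lemma rv_entropy_mono:
  assumes Y: "Y \<in> M \<rightarrow>\<^sub>M count_space S" and S: "finite S"
    and W: "W \<in> M \<rightarrow>\<^sub>M count_space S'" and S': "finite S'"
    and fine: "\<And>x y. x \<in> space M \<Longrightarrow> y \<in> space M \<Longrightarrow> Y y = Y x \<Longrightarrow> W y = W x"
  shows "rv_entropy M W \<le> rv_entropy M Y"
  unfolding rv_entropy_def
proof (rule integral_mono_AE[OF rv_entropy_integrable[OF W S'] rv_entropy_integrable[OF Y S]])
  show "AE x in M. - ln (prob {y \<in> space M. W y = W x}) \<le> - ln (prob {y \<in> space M. Y y = Y x})"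
    using AE_prob_rv_pos[OF Y S] AE_space
  proof eventually_elim
    case (elim x)
    have "prob {y \<in> space M. Y y = Y x} \<le> prob {y \<in> space M. W y = W x}"
      by (rule finite_measure_mono[OF _ prob_event_meas[OF W]]) (use fine elim(2) in blast)
    then show ?case
      using ln_mono[of "prob {y \<in> space M. Y y = Y x}" "prob {y \<in> space M. W y = W x}"] elim(1)
      by linarith
  qed
qed

lemma rv_entropy_cong:
  assumes "\<And>x y. x \<in> space M \<Longrightarrow> y \<in> space M \<Longrightarrow> Y y = Y x \<longleftrightarrow> W y = W x"
  shows "rv_entropy M Y = rv_entropy M W"
proof -
  have "{y \<in> space M. Y y = Y x} = {y \<in> space M. W y = W x}" if "x \<in> space M" for x
    using assms[OF that] by auto
  then show ?thesis
    unfolding rv_entropy_def by (intro Bochner_Integration.integral_cong) auto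
qed

lemma rv_entropy_nonneg: "0 \<le> rv_entropy M Y"
  unfolding rv_entropy_def
proof (intro integral_nonneg_AE AE_I2)
  show "0 \<le> - ln (prob A)" for A
    using prob_le_1[of A] ln_mono[of "prob A" 1] by (cases "prob A = 0") (auto simp: zero_less_measure_iff)
qed

lemma measurable_pair_count_space:
  assumes "Y \<in> M \<rightarrow>\<^sub>M count_space S" "finite S" "W \<in> M \<rightarrow>\<^sub>M count_space S'" "finite S'"
  shows "(\<lambda>x. (Y x, W x)) \<in> M \<rightarrow>\<^sub>M count_space (S \<times> S')"
proof -
  have "(\<lambda>x. (Y x, W x)) \<in> M \<rightarrow>\<^sub>M count_space S \<Otimes>\<^sub>M count_space S'"
    by (rule measurable_Pair) fact+
  then show ?thesis
    by (simp add: pair_measure_countable assms countable_finite)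
qed

text \<open>The Gibbs inequality against the product of the two marginal distributions.\<close>

lemma rv_entropy_pair_le:
  assumes Y: "Y \<in> M \<rightarrow>\<^sub>M count_space S" and S: "finite S"
    and W: "W \<in> M \<rightarrow>\<^sub>M count_space S'" and S': "finite S'"
  shows "rv_entropy M (\<lambda>x. (Y x, W x)) \<le> rv_entropy M Y + rv_entropy M W"
proof -
  define p r where "p s = prob {x \<in> space M. Y x = s}" and "r t = prob {x \<in> space M. W x = t}" for s t
  note YW = measurable_pair_count_space[OF Y S W S']
  have "rv_entropy M (\<lambda>x. (Y x, W x)) \<le> (\<integral>x. - ln ((\<lambda>(s, t). p s * r t) (Y x, W x)) \<partial>M)"
  proof (rule rv_entropy_le_gibbs[OF YW])
    have "(\<Sum>(s, t)\<in>S \<times> S'. p s * r t) = (\<Sum>s\<in>S. p s) * (\<Sum>t\<in>S'. r t)"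
      by (simp add: sum_product sum.cartesian_product)
    then show "(\<Sum>(s, t)\<in>S \<times> S'. p s * r t) \<le> 1"
      using sum_prob_rv[OF Y S] sum_prob_rv[OF W S'] by (simp add: p_def r_def)
    fix st assume st: "st \<in> S \<times> S'" and pos: "0 < prob {x \<in> space M. (Y x, W x) = st}"
    obtain s t where [simp]: "st = (s, t)"
      by fastforce
    have "prob {x \<in> space M. (Y x, W x) = st} \<le> p s" "prob {x \<in> space M. (Y x, W x) = st} \<le> r t"
      unfolding p_def r_def using prob_event_meas[OF Y] prob_event_meas[OF W]
      by (auto intro!: finite_measure_mono)
    with pos show "0 < (case st of (s, t) \<Rightarrow> p s * r t)"
      by simp
  qed (use S S' in \<open>auto simp: p_def r_def\<close>)
  also have "\<dots> = (\<integral>x. - ln (p (Y x)) + - ln (r (W x)) \<partial>M)"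
  proof (rule integral_cong_AE)
    show "(\<lambda>x. - ln ((\<lambda>(s, t). p s * r t) (Y x, W x))) \<in> borel_measurable M"
      by (rule borel_measurable_integrable[OF finite_rv_integral(1)[OF YW]]) (use S S' in simp)
    show "(\<lambda>x. - ln (p (Y x)) + - ln (r (W x))) \<in> borel_measurable M"
      using borel_measurable_integrable[OF finite_rv_integral(1)[OF Y S]]
        borel_measurable_integrable[OF finite_rv_integral(1)[OF W S']] by (intro borel_measurable_add)
    show "AE x in M. - ln ((\<lambda>(s, t). p s * r t) (Y x, W x)) = - ln (p (Y x)) + - ln (r (W x))"
      using AE_prob_rv_pos[OF Y S] AE_prob_rv_pos[OF W S']
      by eventually_elim (simp add: p_def r_def ln_mult_pos)
  qed
  also have "\<dots> = rv_entropy M Y + rv_entropy M W"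
    unfolding rv_entropy_def p_def r_def
    by (rule Bochner_Integration.integral_add) (rule rv_entropy_integrable, fact+)+
  finally show ?thesis .
qed

lemma rv_entropy_invariant:
  assumes Y: "Y \<in> M \<rightarrow>\<^sub>M count_space S" and S: "finite S"
    and T: "T \<in> M \<rightarrow>\<^sub>M M" "distr M M T = M"
  shows "rv_entropy M (\<lambda>x. Y (T x)) = rv_entropy M Y"
proof -
  have p: "prob {y \<in> space M. Y (T y) = s} = prob {y \<in> space M. Y y = s}" for s
  proof -
    have "measure (distr M M T) {y \<in> space M. Y y = s} = prob (T -` {y \<in> space M. Y y = s} \<inter> space M)"
      by (rule measure_distr[OF T(1) prob_event_meas[OF Y]])
    also have "T -` {y \<in> space M. Y y = s} \<inter> space M = {y \<in> space M. Y (T y) = s}"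
      using measurable_space[OF T(1)] by auto
    finally show ?thesis
      by (simp add: T(2))
  qed
  have "(\<integral>x. - ln (prob {y \<in> space M. Y y = Y x}) \<partial>distr M M T)
      = (\<integral>x. - ln (prob {y \<in> space M. Y y = Y (T x)}) \<partial>M)"
    by (rule integral_distr[OF T(1) borel_measurable_integrable[OF rv_entropy_integrable[OF Y S]]])
  then show ?thesis
    by (simp add: rv_entropy_def p T(2))
qed

end

subsection \<open>Names and the entropy of a partition\<close>

text \<open>The itinerary of length \<open>n\<close>. The restriction to \<open>{..<n}\<close> makes
  it an element of the finite set \<open>PiE {..<n} (\<lambda>_. S)\<close> when
  \<open>\<phi>\<close> takes its values in a finite \<open>S\<close>.\<close>

definition names :: "('a \<Rightarrow> 'a) \<Rightarrow> ('a \<Rightarrow> 'b) \<Rightarrow> nat \<Rightarrow> 'a \<Rightarrow> nat \<Rightarrow> 'b" where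
  "names T \<phi> n x = (\<lambda>i\<in>{..<n}. \<phi> ((T ^^ i) x))"

lemma names_eq_iff: "names T \<phi> n x = names T \<phi> n y \<longleftrightarrow> (\<forall>i<n. \<phi> ((T ^^ i) x) = \<phi> ((T ^^ i) y))"
  by (auto simp: names_def fun_eq_iff restrict_def)

lemma funpow_measurable: "T \<in> M \<rightarrow>\<^sub>M M \<Longrightarrow> T ^^ i \<in> M \<rightarrow>\<^sub>M M"
  by (induction i) (auto intro: measurable_comp simp: id_def)

lemma names_measurable:
  assumes \<phi>: "\<phi> \<in> M \<rightarrow>\<^sub>M count_space S" and S: "finite S" and T: "T \<in> M \<rightarrow>\<^sub>M M"
  shows "names T \<phi> n \<in> M \<rightarrow>\<^sub>M count_space (PiE {..<n} (\<lambda>_. S))"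
proof -
  have "(\<lambda>x. \<lambda>i\<in>{..<n}. \<phi> ((T ^^ i) x)) \<in> M \<rightarrow>\<^sub>M PiM {..<n} (\<lambda>_. count_space S)"
    using measurable_compose[OF funpow_measurable[OF T] \<phi>] by (intro measurable_restrict)
  moreover have "PiM {..<n} (\<lambda>_. count_space S) = count_space (PiE {..<n} (\<lambda>_. S))"
    by (rule count_space_PiM_finite) (use S in \<open>auto simp: countable_finite\<close>)
  ultimately show ?thesis
    by (simp add: names_def[abs_def])
qed

lemma finite_PiE_const: "finite S \<Longrightarrow> finite (PiE {..<n::nat} (\<lambda>_. S))"
  by (simp add: finite_PiE)

context prob_space
begin

text \<open>Convergence has to be proved because \<open>metric_entropy\<close> uses
  \<open>lim\<close>, which says nothing about a divergent sequence. A name of length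
  \<open>m + n\<close> is a pair of names, the second read after \<open>m\<close> steps, so
  invariance and \<open>rv_entropy_pair_le\<close> give subadditivity.\<close>

lemma rv_entropy_names_limit:
  assumes \<phi>: "\<phi> \<in> M \<rightarrow>\<^sub>M count_space S" and S: "finite S" and T: "T \<in> M \<rightarrow>\<^sub>M M" "distr M M T = M"
  obtains l where "(\<lambda>n. rv_entropy M (names T \<phi> n) / real n) \<longlonglongrightarrow> l"
proof -
  note N = names_measurable[OF \<phi> S T(1)]
  have inv: "rv_entropy M (\<lambda>x. names T \<phi> n ((T ^^ m) x)) = rv_entropy M (names T \<phi> n)" for m n
  proof (induction m)
    case (Suc m)
    have "(\<lambda>x. names T \<phi> n ((T ^^ m) x)) \<in> M \<rightarrow>\<^sub>M count_space (PiE {..<n} (\<lambda>_. S))"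
      by (rule measurable_compose[OF funpow_measurable[OF T(1)] N])
    from rv_entropy_invariant[OF this finite_PiE_const[OF S] T] Suc show ?case
      by (simp add: funpow_swap1)
  qed simp
  have "rv_entropy M (names T \<phi> (m + n)) \<le> rv_entropy M (names T \<phi> m) + rv_entropy M (names T \<phi> n)" for m n
  proof -
    have "rv_entropy M (names T \<phi> (m + n)) = rv_entropy M (\<lambda>x. (names T \<phi> m x, names T \<phi> n ((T ^^ m) x)))"
    proof (rule rv_entropy_cong)
      fix x y
      have "(\<forall>i<m + n. \<phi> ((T ^^ i) y) = \<phi> ((T ^^ i) x)) \<longleftrightarrow>
          (\<forall>i<m. \<phi> ((T ^^ i) y) = \<phi> ((T ^^ i) x)) \<and> (\<forall>i<n. \<phi> ((T ^^ (i + m)) y) = \<phi> ((T ^^ (i + m)) x))"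
        (is "?l \<longleftrightarrow> ?r")
      proof
        assume r: ?r
        show ?l
        proof (intro allI impI)
          fix i assume "i < m + n"
          with r show "\<phi> ((T ^^ i) y) = \<phi> ((T ^^ i) x)"
            by (cases "i < m") (auto dest: spec[of _ "i - m"])
        qed
      qed auto
      then show "names T \<phi> (m + n) y = names T \<phi> (m + n) x \<longleftrightarrow>
          (names T \<phi> m y, names T \<phi> n ((T ^^ m) y)) = (names T \<phi> m x, names T \<phi> n ((T ^^ m) x))"
        by (simp add: names_eq_iff funpow_add)
    qed
    also have "\<dots> \<le> rv_entropy M (names T \<phi> m) + rv_entropy M (\<lambda>x. names T \<phi> n ((T ^^ m) x))"
      by (rule rv_entropy_pair_le[OF N finite_PiE_const[OF S]
            measurable_compose[OF funpow_measurable[OF T(1)] N] finite_PiE_const[OF S]])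
    finally show ?thesis
      by (simp add: inv)
  qed
  moreover have "0 * real n \<le> rv_entropy M (names T \<phi> n)" for n
    by (simp add: rv_entropy_nonneg)
  ultimately obtain l where "(\<lambda>n. rv_entropy M (names T \<phi> n) / real n) \<longlonglongrightarrow> l"
    using fekete[of "\<lambda>n. rv_entropy M (names T \<phi> n)" 0] by blast
  then show thesis
    by (rule that)
qed

end

definition part_of :: "'a set set \<Rightarrow> 'a \<Rightarrow> 'a set" where
  "part_of \<P> x = (THE A. A \<in> \<P> \<and> x \<in> A)"

lemma part_of:
  assumes "partition_on \<Omega> \<P>" "x \<in> \<Omega>"
  shows "part_of \<P> x \<in> \<P>" "x \<in> part_of \<P> x" "A \<in> \<P> \<Longrightarrow> x \<in> A \<longleftrightarrow> part_of \<P> x = A"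
proof -
  have ex1: "\<exists>!A. A \<in> \<P> \<and> x \<in> A"
    using assms by (auto simp: partition_on_def disjoint_def)
  show 1: "part_of \<P> x \<in> \<P>" "x \<in> part_of \<P> x"
    using theI'[OF ex1] by (auto simp: part_of_def)
  show "A \<in> \<P> \<Longrightarrow> x \<in> A \<longleftrightarrow> part_of \<P> x = A"
    using 1 ex1 by blast
qed

lemma part_of_measurable:
  assumes "finite_partition M \<P>"
  shows "part_of \<P> \<in> M \<rightarrow>\<^sub>M count_space \<P>"
proof (rule measurable_count_space_eq2[THEN iffD2])
  have p: "finite \<P>" "\<P> \<subseteq> sets M" "partition_on (space M) \<P>"
    using assms by (auto simp: finite_partition_def)
  then show "finite \<P>" by simp
  have "part_of \<P> -` {A} \<inter> space M = A" if "A \<in> \<P>" for A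
  proof -
    have "A \<subseteq> space M"
      using that p(2) sets.sets_into_space by blast
    then show ?thesis
      using part_of(3)[OF p(3) _ that] by auto
  qed
  then show "part_of \<P> \<in> space M \<rightarrow> \<P> \<and> (\<forall>A\<in>\<P>. part_of \<P> -` {A} \<inter> space M \<in> sets M)"
    using p part_of(1)[OF p(3)] by auto
qed

lemma (in prob_space) partition_entropy_iterated_join:
  assumes \<P>: "finite_partition M \<P>" and T: "T \<in> M \<rightarrow>\<^sub>M M"
  shows "partition_entropy M (iterated_join M T \<P> n) = rv_entropy M (names T (part_of \<P>) n)"
proof -
  have p: "finite \<P>" "\<P> \<subseteq> sets M" "partition_on (space M) \<P>"
    using \<P> by (auto simp: finite_partition_def)
  have Tx: "(T ^^ i) x \<in> space M" if "x \<in> space M" for i x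
    using measurable_space[OF funpow_measurable[OF T] that] .
  define B where "B A = {x \<in> space M. names T (part_of \<P>) n x = A}" for A
  have B_eq: "{x \<in> space M. \<forall>i<n. (T ^^ i) x \<in> A i} = B (restrict A {..<n})" if "\<forall>i<n. A i \<in> \<P>" for A
  proof -
    have "(\<forall>i<n. (T ^^ i) x \<in> A i) \<longleftrightarrow> names T (part_of \<P>) n x = restrict A {..<n}" if x: "x \<in> space M" for x
      using part_of(3)[OF p(3) Tx[OF x]] \<open>\<forall>i<n. A i \<in> \<P>\<close>
      by (auto simp: names_def fun_eq_iff restrict_def)
    then show ?thesis
      by (auto simp: B_def)
  qed
  have join: "iterated_join M T \<P> n = B ` (PiE {..<n} (\<lambda>_. \<P>))"
  proof (intro set_eqI iffI)
    fix J assume "J \<in> iterated_join M T \<P> n"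
    then obtain A where A: "J = {x \<in> space M. \<forall>i<n. (T ^^ i) x \<in> A i}" "\<forall>i<n. A i \<in> \<P>"
      by (auto simp: iterated_join_def)
    then have "J = B (restrict A {..<n})" "restrict A {..<n} \<in> PiE {..<n} (\<lambda>_. \<P>)"
      using B_eq by auto
    then show "J \<in> B ` (PiE {..<n} (\<lambda>_. \<P>))"
      by blast
  next
    fix J assume "J \<in> B ` (PiE {..<n} (\<lambda>_. \<P>))"
    then obtain A where A: "A \<in> PiE {..<n} (\<lambda>_. \<P>)" "J = B A"
      by blast
    then have "\<forall>i<n. A i \<in> \<P>" "restrict A {..<n} = A"
      by (auto simp: PiE_mem)
    moreover from this have "J = {x \<in> space M. \<forall>i<n. (T ^^ i) x \<in> A i}"
      using B_eq[of A] A(2) by argo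
    ultimately show "J \<in> iterated_join M T \<P> n"
      unfolding iterated_join_def by blast
  qed
  have "(\<Sum>A\<in>iterated_join M T \<P> n. prob A * ln (prob A))
      = (\<Sum>A\<in>PiE {..<n} (\<lambda>_. \<P>). prob (B A) * ln (prob (B A)))"
    unfolding join
  \<comment> \<open>Different itineraries have disjoint cells, so two of them can be the same member
    of the join only if it is empty, with contribution 0.\<close>
  proof (subst sum.reindex_nontrivial)
    fix A A' assume "A \<noteq> A'" "B A = B A'"
    then have "B A = {}"
      by (auto simp: B_def)
    then show "prob (B A) * ln (prob (B A)) = 0" by simp
  qed (use p in \<open>auto intro: finite_PiE_const\<close>)
  then show ?thesis
    using rv_entropy_eq_sum[OF names_measurable[OF part_of_measurable[OF \<P>] p(1) T] finite_PiE_const[OF p(1)]]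
    by (simp add: partition_entropy_def B_def)
qed

subsection \<open>Measurability on sequence space\<close>

lemma open_agree:
  fixes y :: "int \<Rightarrow> nat"
  assumes "finite I"
  shows "open {x. \<forall>i\<in>I. x i = y i}"
proof -
  have "open ((\<lambda>x::int \<Rightarrow> nat. x i) -` {y i})" for i
    by (intro open_vimage continuous_on_product_coordinates) (rule discrete_topology_class.open_discrete)
  then have "open (\<Inter>i\<in>I. (\<lambda>x::int \<Rightarrow> nat. x i) -` {y i})"
    using assms by (intro open_INT) auto
  also have "(\<Inter>i\<in>I. (\<lambda>x::int \<Rightarrow> nat. x i) -` {y i}) = {x. \<forall>i\<in>I. x i = y i}"
    by auto
  finally show ?thesis .
qed

lemma locally_holder_continuous:
  fixes \<phi> :: "(int \<Rightarrow> nat) \<Rightarrow> real"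
  assumes hol: "locally_holder X \<phi> C \<theta>"
  shows "continuous_on X \<phi>"
  unfolding continuous_on_topological
proof (intro ballI allI impI)
  fix x B assume x: "x \<in> X" and B: "open B" "\<phi> x \<in> B"
  have C: "0 \<le> C" "0 < \<theta>" "\<theta> < 1"
    using hol by (auto simp: locally_holder_def)
  obtain e where e: "e > 0" "\<And>z. \<bar>z - \<phi> x\<bar> < e \<Longrightarrow> z \<in> B"
    using B by (auto simp: open_real)
  have "(\<lambda>m. C * \<theta> ^ m) \<longlonglongrightarrow> C * 0"
    using C by (intro tendsto_mult_left LIMSEQ_power_zero) auto
  then have "\<forall>\<^sub>F m in sequentially. C * \<theta> ^ m < e"
    using e by (intro order_tendstoD) auto
  then have "\<forall>\<^sub>F m in sequentially. C * \<theta> ^ m < e \<and> 0 < m"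
    using eventually_gt_at_top[of 0] by (rule eventually_conj)
  then obtain m where m: "C * \<theta> ^ m < e" "0 < m"
    by (auto dest: eventually_happens'[OF sequentially_bot])
  define A where "A = {y. \<forall>i\<in>{- int m..int m}. y i = x i}"
  have "\<phi> y \<in> B" if "y \<in> X" "y \<in> A" for y
  proof (rule e(2))
    have "y i = x i" if "\<bar>i\<bar> < int m" for i
    proof -
      have "i \<in> {- int m..int m}"
        using that by auto
      with \<open>y \<in> A\<close> show ?thesis
        unfolding A_def by blast
    qed
    then have "\<bar>\<phi> y - \<phi> x\<bar> \<le> C * \<theta> ^ m"
      by (rule locally_holderD[OF hol m(2) that(1) x])
    with m show "\<bar>\<phi> y - \<phi> x\<bar> < e" by simp
  qed
  moreover have "open A"
    unfolding A_def by (rule open_agree) simp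
  moreover have "x \<in> A"
    by (simp add: A_def)
  ultimately show "\<exists>A. open A \<and> x \<in> A \<and> (\<forall>y\<in>X. y \<in> A \<longrightarrow> \<phi> y \<in> B)"
    by blast
qed

lemma window_measurable [measurable]:
  "(\<lambda>x::int \<Rightarrow> nat. window x k n) \<in> borel \<rightarrow>\<^sub>M count_space UNIV"
proof (rule measurable_count_space_eq_countable[THEN iffD2])
  have "(\<lambda>x::int \<Rightarrow> nat. window x k n) -` {w} \<inter> space borel \<in> sets borel" for w
  proof (cases "\<exists>y::int \<Rightarrow> nat. window y k n = w")
    case True
    then obtain y :: "int \<Rightarrow> nat" where y: "window y k n = w" by blast
    have "(\<lambda>x::int \<Rightarrow> nat. window x k n) -` {w} \<inter> space borel = {x. \<forall>i\<in>{k..<k + int n}. x i = y i}"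
      unfolding y[symmetric] by (auto simp: window_eq_iff')
    then show ?thesis
      using open_agree[of "{k..<k + int n}" y] by simp
  next
    case False
    then have "(\<lambda>x::int \<Rightarrow> nat. window x k n) -` {w} \<inter> space borel = {}"
      by auto
    then show ?thesis by (simp only: sets.empty_sets)
  qed
  then show "(\<lambda>x::int \<Rightarrow> nat. window x k n) \<in> space borel \<rightarrow> UNIV \<and>
      (\<forall>w\<in>UNIV. (\<lambda>x::int \<Rightarrow> nat. window x k n) -` {w} \<inter> space borel \<in> sets borel)"
    by blast
qed simp

lemma measurable_sequence:
  fixes h :: "'a \<Rightarrow> int \<Rightarrow> nat"
  assumes "\<And>i. (\<lambda>x. h x i) \<in> M \<rightarrow>\<^sub>M count_space UNIV"
  shows "h \<in> M \<rightarrow>\<^sub>M borel"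
proof (rule measurable_coordinatewise_then_product)
  fix i
  have "(\<lambda>n::nat. n) \<in> count_space UNIV \<rightarrow>\<^sub>M borel"
    by simp
  from measurable_compose[OF assms this] show "(\<lambda>x. h x i) \<in> borel_measurable M" .
qed

lemma coordinate_measurable [measurable]: "(\<lambda>x::int \<Rightarrow> nat. x i) \<in> borel \<rightarrow>\<^sub>M count_space UNIV"
  using measurable_compose[OF window_measurable[of i 1], of hd "count_space UNIV"]
  by (simp add: window_def)

lemma translate_measurable [measurable]: "translate t \<in> (borel :: (int \<Rightarrow> nat) measure) \<rightarrow>\<^sub>M borel"
  by (rule measurable_sequence) simp

section \<open>Approximation by cylinder sets\<close>

definition determined :: "nat \<Rightarrow> (int \<Rightarrow> nat) set \<Rightarrow> bool" where
  "determined N A \<longleftrightarrow> (\<forall>x y. central x N = central y N \<longrightarrow> x \<in> A \<longrightarrow> y \<in> A)"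

lemma determined_mono:
  assumes "determined N A" "N \<le> M"
  shows "determined M A"
  unfolding determined_def
proof (intro allI impI)
  fix x y assume xy: "central x M = central y M" "x \<in> A"
  have "x i = y i" if "\<bar>i\<bar> \<le> int N" for i
  proof -
    have "\<bar>i\<bar> \<le> int M"
      using that assms(2) by linarith
    with xy(1) show ?thesis
      unfolding central_eq_iff by blast
  qed
  then have "central x N = central y N"
    unfolding central_eq_iff by blast
  with assms(1) xy(2) show "y \<in> A"
    unfolding determined_def by blast
qed

lemma determined_Compl: "determined N A \<Longrightarrow> determined N (- A)"
  unfolding determined_def by (metis ComplD ComplI)

lemma determined_UN: "(\<And>i. i \<in> I \<Longrightarrow> determined N (A i)) \<Longrightarrow> determined N (\<Union>i\<in>I. A i)"
  unfolding determined_def by blast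

text \<open>There are only countably many central words, so any set of them has a Borel
  preimage.\<close>

lemma determined_measurable: "determined N A \<Longrightarrow> A \<in> sets borel"
proof -
  assume A: "determined N A"
  have "(\<lambda>x. central x N) -` ((\<lambda>x. central x N) ` A) = A"
  proof
    show "(\<lambda>x. central x N) -` ((\<lambda>x. central x N) ` A) \<subseteq> A"
    proof
      fix x assume "x \<in> (\<lambda>x. central x N) -` ((\<lambda>x. central x N) ` A)"
      then obtain a where "a \<in> A" "central a N = central x N"
        by auto
      with A show "x \<in> A"
        unfolding determined_def by blast
    qed
  qed blast
  moreover have "(\<lambda>x::int \<Rightarrow> nat. central x N) \<in> borel \<rightarrow>\<^sub>M count_space UNIV"
    unfolding central_def by (rule window_measurable)
  from measurable_sets[OF this, of "(\<lambda>x. central x N) ` A"]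
  have "(\<lambda>x. central x N) -` ((\<lambda>x. central x N) ` A) \<in> sets borel"
    by simp
  ultimately show ?thesis by metis
qed

lemma sets_borel_determined:
  "sets (borel :: (int \<Rightarrow> nat) measure) = sigma_sets UNIV {A. \<exists>N. determined N A}"
proof
  have "sets (borel :: (int \<Rightarrow> nat) measure) = sets (PiM UNIV (\<lambda>_. borel))"
    by (rule sets_PiM_equal_borel[symmetric])
  also have "\<dots> = sigma_sets UNIV {{f. f i \<in> A} | i A. A \<in> sets (borel :: nat measure)}"
    by (subst sets_PiM_single) simp
  also have "\<dots> \<subseteq> sigma_sets UNIV {A. \<exists>N. determined N A}"
  proof (rule sigma_sets_mono, rule subsetI)
    fix B assume "B \<in> {{f::int \<Rightarrow> nat. f i \<in> A} | i A. A \<in> sets (borel :: nat measure)}"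
    then obtain i and A :: "nat set" where B: "B = {f. f i \<in> A}"
      by blast
    have "determined (nat \<bar>i\<bar>) B"
      unfolding determined_def central_eq_iff B by simp
    then show "B \<in> sigma_sets UNIV {A. \<exists>N. determined N A}"
      by (intro sigma_sets.Basic) blast
  qed
  finally show "sets (borel :: (int \<Rightarrow> nat) measure) \<subseteq> sigma_sets UNIV {A. \<exists>N. determined N A}" .
  show "sigma_sets UNIV {A. \<exists>N. determined N A} \<subseteq> sets (borel :: (int \<Rightarrow> nat) measure)"
    using sets.sigma_sets_subset[of "{A. \<exists>N. determined N A}" "borel :: (int \<Rightarrow> nat) measure"]
      determined_measurable by auto
qed

locale sequence_measure = prob_space \<mu> for \<mu> :: "(int \<Rightarrow> nat) measure" +
  assumes sets_\<mu> [measurable_cong]: "sets \<mu> = sets borel"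
begin

lemma space_\<mu> [simp]: "space \<mu> = UNIV"
  using sets_eq_imp_space_eq[OF sets_\<mu>] by simp

text \<open>The sets that can be approximated form a sigma-algebra containing the cylinder sets. For
  a countable union, finitely many members already exhaust the measure up to
  \<open>e / 2\<close>.\<close>

lemma approximate_set:
  assumes "A \<in> sets borel" "0 < e"
  shows "\<exists>N B. determined N B \<and> prob (sym_diff A B) < e"
proof -
  have "A \<in> sigma_sets UNIV {A. \<exists>N. determined N A}"
    using assms(1) sets_borel_determined by simp
  then show ?thesis
    using assms(2)
  proof (induction A arbitrary: e rule: sigma_sets.induct)
    case (Basic A)
    then obtain N where "determined N A"
      by blast
    moreover have "prob (sym_diff A A) < e"
      using Basic.prems by simp
    ultimately show ?case by blast
  next
    case Empty
    have "determined 0 {}"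
      by (simp add: determined_def)
    moreover have "prob (sym_diff {} {}) < e"
      using Empty by simp
    ultimately show ?case by blast
  next
    case (Compl A)
    then obtain N B where B: "determined N B" "prob (sym_diff A B) < e"
      by blast
    have "sym_diff (UNIV - A) (- B) = sym_diff A B"
      by auto
    with B determined_Compl show ?case
      by metis
  next
    case (Union A)
    have A: "A i \<in> sets \<mu>" for i
      using Union.hyps sets_borel_determined sets_\<mu> by blast
    define U where "U n = (\<Union>i<n. A i)" for n
    have U: "U n \<in> sets \<mu>" for n
      using A by (auto simp: U_def)
    have "(\<lambda>n. prob (U n)) \<longlonglongrightarrow> prob (\<Union>n. U n)"
    proof (rule finite_Lim_measure_incseq)
      show "range U \<subseteq> sets \<mu>"
        using U by blast
      show "incseq U"
        unfolding incseq_def U_def by (intro allI impI UN_mono) auto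
    qed
    moreover have "(\<Union>n. U n) = (\<Union>i. A i)"
      by (auto simp: U_def)
    ultimately have "\<forall>\<^sub>F n in sequentially. prob (\<Union>i. A i) - e / 2 < prob (U n)"
      using Union.prems by (intro order_tendstoD) auto
    then obtain n where n: "prob (\<Union>i. A i) - e / 2 < prob (U n)"
      by (auto dest: eventually_happens'[OF sequentially_bot])
    \<comment> \<open>The \<open>n + 1\<close> avoids division by zero when \<open>n = 0\<close>;
      the \<open>n\<close> errors together amount to at most \<open>e / 2\<close>.\<close>
    define d where "d = e / (2 * real (n + 1))"
    have d: "0 < d"
      using Union.prems by (simp add: d_def)
    have "\<exists>N B. determined N B \<and> prob (sym_diff (A i) B) < d" for i
      by (rule Union.IH[OF d])
    then obtain N B where B: "\<And>i. determined (N i) (B i)" "\<And>i. prob (sym_diff (A i) (B i)) < d"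
      by metis
    define M where "M = (\<Sum>i<n. N i)"
    have "determined M (\<Union>i\<in>{..<n}. B i)"
    proof (rule determined_UN)
      fix i assume i: "i \<in> {..<n}"
      then have "N i \<le> M"
        unfolding M_def by (intro member_le_sum) auto
      with B(1) show "determined M (B i)"
        by (rule determined_mono)
    qed
    moreover have "prob (sym_diff (\<Union>i. A i) (\<Union>i\<in>{..<n}. B i)) < e"
    proof -
      have Bm: "B i \<in> sets \<mu>" for i
        using determined_measurable[OF B(1)] sets_\<mu> by simp
      have "prob (sym_diff (\<Union>i. A i) (\<Union>i\<in>{..<n}. B i))
          \<le> prob (((\<Union>i. A i) - U n) \<union> (\<Union>i\<in>{..<n}. sym_diff (A i) (B i)))"
        using A Bm U by (intro finite_measure_mono) (auto simp: U_def)
      also have "\<dots> \<le> prob ((\<Union>i. A i) - U n) + prob (\<Union>i\<in>{..<n}. sym_diff (A i) (B i))"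
        using A Bm U by (intro measure_Un_le) auto
      also have "\<dots> \<le> (prob (\<Union>i. A i) - prob (U n)) + (\<Sum>i<n. prob (sym_diff (A i) (B i)))"
      proof (rule add_mono)
        show "prob ((\<Union>i. A i) - U n) \<le> prob (\<Union>i. A i) - prob (U n)"
          using A U by (subst finite_measure_Diff) (auto simp: U_def)
        show "prob (\<Union>i\<in>{..<n}. sym_diff (A i) (B i)) \<le> (\<Sum>i<n. prob (sym_diff (A i) (B i)))"
          using A Bm by (intro finite_measure_subadditive_finite) auto
      qed
      also have "(\<Sum>i<n. prob (sym_diff (A i) (B i))) \<le> (\<Sum>i<n. d)"
        using B(2) by (intro sum_mono less_imp_le)
      also have "(\<Sum>i<n. d) \<le> e / 2"
        using Union.prems by (simp add: d_def field_simps)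
      finally show ?thesis
        using n by simp
    qed
    ultimately show ?case by blast
  qed
qed

text \<open>Each level set of \<open>\<phi>\<close> is approximated by a cylinder set, and
  \<open>\<psi>\<close> picks some value whose cylinder set contains the point. Where
  \<open>\<psi>\<close> errs, the point lies in the symmetric difference belonging to the right
  value or in that of the wrong one.\<close>

lemma approximate_function:
  assumes \<phi>: "\<phi> \<in> \<mu> \<rightarrow>\<^sub>M count_space S" and S: "finite S" and e: "0 < e"
  obtains N \<psi> where "\<forall>x. \<psi> x \<in> S" "\<forall>x y. central x N = central y N \<longrightarrow> \<psi> x = \<psi> y"
    "{x. \<phi> x \<noteq> \<psi> x} \<in> sets \<mu>" "prob {x. \<phi> x \<noteq> \<psi> x} \<le> e"
proof -
  have \<phi>S: "\<phi> x \<in> S" for x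
    using measurable_space[OF \<phi>, of x] by simp
  define d where "d = e / real (card S)"
  have cS: "0 < card S"
    using S \<phi>S by (auto simp: card_gt_0_iff)
  then have d: "0 < d"
    using e by (simp add: d_def)
  define A where "A s = {x. \<phi> x = s}" for s
  have A: "A s \<in> sets borel" for s
    using prob_event_meas[OF \<phi>, of s] by (simp add: A_def sets_\<mu>)
  have "\<exists>N B. determined N B \<and> prob (sym_diff (A s) B) < d" for s
    by (rule approximate_set[OF A d])
  then obtain N B where B: "\<And>s. determined (N s) (B s)" "\<And>s. prob (sym_diff (A s) (B s)) < d"
    by metis
  have Bm: "B s \<in> sets \<mu>" for s
    using determined_measurable[OF B(1)] sets_\<mu> by simp
  define M where "M = (\<Sum>s\<in>S. N s)"
  define R where "R x = {s\<in>S. x \<in> B s}" for x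
  obtain s0 where s0: "s0 \<in> S"
    using \<phi>S by blast
  define \<psi> where "\<psi> x = (if R x = {} then s0 else (SOME s. s \<in> R x))" for x
  have \<psi>R: "\<psi> x \<in> R x" if "R x \<noteq> {}" for x
    using that some_in_eq[of "R x"] by (simp add: \<psi>_def)
  have \<psi>S: "\<psi> x \<in> S" for x
    using \<psi>R[of x] s0 by (cases "R x = {}") (auto simp: \<psi>_def R_def)
  have det: "determined M (B s)" if "s \<in> S" for s
  proof (rule determined_mono[OF B(1)])
    show "N s \<le> M"
      unfolding M_def using that S by (intro member_le_sum) auto
  qed
  have R_eq: "R x = R y" if "central x M = central y M" for x y
  proof -
    have "x \<in> B s \<longleftrightarrow> y \<in> B s" if "s \<in> S" for s
      using det[OF that] \<open>central x M = central y M\<close> unfolding determined_def by metis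
    then show ?thesis
      by (auto simp: R_def)
  qed
  have \<psi>_eq: "\<psi> x = \<psi> y" if "central x M = central y M" for x y
    using R_eq[OF that] by (simp add: \<psi>_def)
  have "determined M {x. \<psi> x = s}" for s
    unfolding determined_def using \<psi>_eq by (metis mem_Collect_eq)
  then have \<psi>m: "{x. \<psi> x = s} \<in> sets \<mu>" for s
    using determined_measurable sets_\<mu> by metis
  have "{x. \<phi> x \<noteq> \<psi> x} = (\<Union>s\<in>S. A s - {x. \<psi> x = s})"
    using \<phi>S by (auto simp: A_def)
  moreover have "(\<Union>s\<in>S. A s - {x. \<psi> x = s}) \<in> sets \<mu>"
    using S A \<psi>m sets_\<mu> by (intro sets.finite_UN sets.Diff) auto
  ultimately have m: "{x. \<phi> x \<noteq> \<psi> x} \<in> sets \<mu>"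
    by simp
  have "{x. \<phi> x \<noteq> \<psi> x} \<subseteq> (\<Union>s\<in>S. sym_diff (A s) (B s))"
  proof
    fix x assume x: "x \<in> {x. \<phi> x \<noteq> \<psi> x}"
    show "x \<in> (\<Union>s\<in>S. sym_diff (A s) (B s))"
    proof (cases "x \<in> B (\<phi> x)")
      case True
      then have "\<psi> x \<in> R x"
        using \<phi>S[of x] by (intro \<psi>R) (auto simp: R_def)
      then have "x \<in> B (\<psi> x) - A (\<psi> x)"
        using x by (auto simp: R_def A_def)
      then show ?thesis
        using \<psi>S by blast
    next
      case False
      then have "x \<in> A (\<phi> x) - B (\<phi> x)"
        by (simp add: A_def)
      then show ?thesis
        using \<phi>S by blast
    qed
  qed
  then have "prob {x. \<phi> x \<noteq> \<psi> x} \<le> prob (\<Union>s\<in>S. sym_diff (A s) (B s))"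
    using S A Bm sets_\<mu> by (intro finite_measure_mono) auto
  also have "\<dots> \<le> (\<Sum>s\<in>S. prob (sym_diff (A s) (B s)))"
    using S A Bm sets_\<mu> by (intro finite_measure_subadditive_finite) auto
  also have "\<dots> \<le> (\<Sum>s\<in>S. d)"
    using B(2) by (intro sum_mono less_imp_le)
  also have "\<dots> = e"
    using cS by (simp add: d_def)
  finally show thesis
    using that[of \<psi> M] \<psi>S \<psi>_eq m by blast
qed

end

subsection \<open>The variational inequality\<close>

locale invariant_sequence_measure = full_shift \<nu> F C \<theta> + sequence_measure \<mu>
  for \<nu> :: nat and F :: "(int \<Rightarrow> nat) \<Rightarrow> real" and C \<theta> :: real and \<mu> :: "(int \<Rightarrow> nat) measure" +
  assumes invariant: "distr \<mu> \<mu> (translate t) = \<mu>"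
    and symbols: "AE x in \<mu>. \<forall>i. x i < \<nu>"
begin

lemma prob_UNIV [simp]: "prob UNIV = 1"
  using prob_space by simp

lemma translate_measurable_\<mu> [measurable]: "translate t \<in> \<mu> \<rightarrow>\<^sub>M \<mu>"
  using translate_measurable[of t] measurable_cong_sets[OF sets_\<mu> sets_\<mu>] by simp

lemma shift_measurable_\<mu>: "shift \<in> \<mu> \<rightarrow>\<^sub>M \<mu>"
  using translate_measurable_\<mu>[of 1] by (simp add: shift_eq_translate[abs_def])

lemma shift_invariant: "distr \<mu> \<mu> shift = \<mu>"
  using invariant[of 1] by (simp add: shift_eq_translate[abs_def])

lemma F_measurable: "F \<in> borel_measurable \<mu>"
proof -
  have "F \<in> borel_measurable borel"
    by (rule borel_measurable_continuous_onI[OF locally_holder_continuous[OF hol]])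
  then show ?thesis
    using measurable_cong_sets[OF sets_\<mu> refl] by simp
qed

lemma F_integrable: "integrable \<mu> F"
proof -
  obtain B where "\<And>x. \<bar>F x\<bar> \<le> B"
    using F_bounded by blast
  then show ?thesis
    by (intro integrable_const_bound[of _ B] F_measurable) auto
qed

lemma integral_translate:
  fixes h :: "(int \<Rightarrow> nat) \<Rightarrow> real"
  assumes "integrable \<mu> h"
  shows "integrable \<mu> (\<lambda>x. h (translate t x))" "(\<integral>x. h (translate t x) \<partial>\<mu>) = (\<integral>x. h x \<partial>\<mu>)"
proof -
  have h: "h \<in> borel_measurable \<mu>"
    using assms by (rule borel_measurable_integrable)
  have "integrable (distr \<mu> \<mu> (translate t)) h"
    using assms by (simp add: invariant)
  then show "integrable \<mu> (\<lambda>x. h (translate t x))"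
    by (simp add: integrable_distr_eq[OF translate_measurable_\<mu> h])
  have "(\<integral>x. h x \<partial>distr \<mu> \<mu> (translate t)) = (\<integral>x. h (translate t x) \<partial>\<mu>)"
    by (rule integral_distr[OF translate_measurable_\<mu> h])
  then show "(\<integral>x. h (translate t x) \<partial>\<mu>) = (\<integral>x. h x \<partial>\<mu>)"
    by (simp add: invariant)
qed

lemma integral_birkhoff_sum:
  "integrable \<mu> (\<lambda>x. birkhoff_sum F n (translate t x))"
  "(\<integral>x. birkhoff_sum F n (translate t x) \<partial>\<mu>) = real n * (\<integral>x. F x \<partial>\<mu>)"
proof -
  have eq: "(\<lambda>x. birkhoff_sum F n (translate t x)) = (\<lambda>x. \<Sum>k<n. F (translate (int k + t) x))"
    by (simp add: birkhoff_sum_translate fun_eq_iff)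
  show "integrable \<mu> (\<lambda>x. birkhoff_sum F n (translate t x))"
    unfolding eq by (intro Bochner_Integration.integrable_sum integral_translate F_integrable)
  have "(\<integral>x. (\<Sum>k<n. F (translate (int k + t) x)) \<partial>\<mu>) = (\<Sum>k<n. \<integral>x. F (translate (int k + t) x) \<partial>\<mu>)"
    by (intro Bochner_Integration.integral_sum integral_translate F_integrable)
  then show "(\<integral>x. birkhoff_sum F n (translate t x) \<partial>\<mu>) = real n * (\<integral>x. F x \<partial>\<mu>)"
    unfolding eq by (simp add: integral_translate(2)[OF F_integrable])
qed

text \<open>The symbols are below \<open>\<nu>\<close> only almost everywhere; reduced words lie in
  \<open>words \<nu> n\<close> at every point, as a random variable with values in that set
  must.\<close>

abbreviation reduce :: "(int \<Rightarrow> nat) \<Rightarrow> int \<Rightarrow> nat" where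
  "reduce x \<equiv> (\<lambda>i. x i mod \<nu>)"

lemma window_reduce_measurable:
  "(\<lambda>x. window (reduce x) k n) \<in> \<mu> \<rightarrow>\<^sub>M count_space (words \<nu> n)"
proof (rule measurable_count_space_eq_countable[THEN iffD2])
  have w: "(\<lambda>x::int \<Rightarrow> nat. window x k n) \<in> \<mu> \<rightarrow>\<^sub>M count_space UNIV"
    using window_measurable measurable_cong_sets[OF sets_\<mu> refl] by blast
  have eq: "window (reduce x) k n = map (\<lambda>a. a mod \<nu>) (window x k n)" for x
    by (rule nth_equalityI) auto
  have "(\<lambda>x. window (reduce x) k n) \<in> \<mu> \<rightarrow>\<^sub>M count_space UNIV"
    unfolding eq by (rule measurable_compose[OF w]) simp
  from measurable_sets[OF this] have "(\<lambda>x. window (reduce x) k n) -` {w} \<inter> space \<mu> \<in> sets \<mu>" for w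
    by simp
  moreover have "window (reduce x) k n \<in> words \<nu> n" for x
    using \<nu>_pos by (auto simp: words_def set_window)
  ultimately show "(\<lambda>x. window (reduce x) k n) \<in> space \<mu> \<rightarrow> words \<nu> n \<and>
      (\<forall>w\<in>words \<nu> n. (\<lambda>x. window (reduce x) k n) -` {w} \<inter> space \<mu> \<in> sets \<mu>)"
    by blast
qed (simp add: countable_finite)

text \<open>The names of \<open>\<phi>\<close> are compared, by the Gibbs inequality, with the following weights: a word
  is drawn with the weight given by \<open>F\<close>, it determines the name of the approximation \<open>\<psi>\<close>, and each
  symbol of the latter is then altered independently with probability \<open>e\<close>.\<close>

lemma rv_entropy_names_le:
  fixes \<phi> \<psi> :: "(int \<Rightarrow> nat) \<Rightarrow> 'b"
  assumes \<phi>: "\<phi> \<in> \<mu> \<rightarrow>\<^sub>M count_space S" and S: "finite S"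
    and \<psi>: "\<And>x. \<psi> x \<in> S" "\<And>x y. central x N = central y N \<Longrightarrow> \<psi> x = \<psi> y"
    and A: "{x. \<phi> x \<noteq> \<psi> x} \<in> sets \<mu>" "prob {x. \<phi> x \<noteq> \<psi> x} \<le> d"
    and e: "0 < e" "e < 1"
  shows "rv_entropy \<mu> (names shift \<phi> n)
    \<le> real (n + 2 * N) * (P - (\<integral>x. F x \<partial>\<mu>)) + 3 * D + real n * (- ln (1 - e) + d * ln (real (card S) / e))"
proof -
  \<comment> \<open>The words of radius \<open>N\<close> about the positions
    \<open>0, ..., n - 1\<close> together cover the coordinates from \<open>- N\<close> to
    \<open>n - 1 + N\<close>.\<close>
  define m where "m = n + 2 * N"
  define G where "G w = \<psi> (SOME x. central x N = w)" for w
  have G: "G (central x N) = \<psi> x" for x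
    unfolding G_def by (rule \<psi>(2)) (rule someI[of "\<lambda>y. central y N = central x N"], rule refl)
  have GS: "G w \<in> S" for w
    by (simp add: G_def \<psi>(1))
  have cS: "0 < card S"
    using S \<psi>(1) by (auto simp: card_gt_0_iff)
  \<comment> \<open>The error kernel: keep the symbol with weight \<open>1 - e\<close>, otherwise
    give each other symbol an equal part of \<open>e\<close>. Its rows sum to at most 1, and it is
    positive everywhere, as the Gibbs inequality requires where \<open>\<phi>\<close> and
    \<open>\<psi>\<close> differ.\<close>
  define K where "K b a = (if a = b then 1 - e else e / real (card S))" for b a :: 'b
  have K: "0 < K b a" for a b
    using e cS by (simp add: K_def)
  define W where "W x = window (reduce x) (- int N) m" for x
  have Wm: "W \<in> \<mu> \<rightarrow>\<^sub>M count_space (words \<nu> m)"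
    unfolding W_def by (rule window_reduce_measurable)
  have W: "W x \<in> words \<nu> m" for x
    using measurable_space[OF Wm, of x] by simp
  note Nm = names_measurable[OF \<phi> S shift_measurable_\<mu>, of n]
  note YW = measurable_pair_count_space[OF Wm finite_words Nm finite_PiE_const[OF S]]
  define p where "p w = exp (birkhoff_sum F m (periodic w)) / Z m" for w
  have p: "0 < p w" for w
    using Z_pos by (simp add: p_def)
  define q where "q = (\<lambda>(w, a). p w * (\<Prod>i<n. K (G (take (2 * N + 1) (drop i w))) (a i)))"
  have q: "0 < q s" for s
    using p K by (auto simp: q_def split: prod.split intro!: mult_pos_pos prod_pos)
  have "sum q (words \<nu> m \<times> PiE {..<n} (\<lambda>_. S))
      = (\<Sum>w\<in>words \<nu> m. p w * (\<Sum>a\<in>PiE {..<n} (\<lambda>_. S). \<Prod>i<n. K (G (take (2 * N + 1) (drop i w))) (a i)))"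
    by (simp add: q_def sum.cartesian_product sum_distrib_left)
  also have "\<dots> \<le> (\<Sum>w\<in>words \<nu> m. p w * 1)"
  proof (intro sum_mono mult_left_mono less_imp_le[OF p])
    fix w
    have "(\<Sum>a\<in>S. K b a) \<le> 1" for b
    proof -
      have "(\<Sum>a\<in>S. K b a) \<le> (\<Sum>a\<in>S. (if a = b then 1 - e else 0) + e / real (card S))"
        using e by (intro sum_mono) (simp add: K_def)
      also have "\<dots> \<le> 1"
        using S cS e by (simp add: sum.distrib)
      finally show ?thesis .
    qed
    then have "(\<Prod>i<n. \<Sum>a\<in>S. K (G (take (2 * N + 1) (drop i w))) a) \<le> 1"
      by (intro prod_le_1) (auto intro!: sum_nonneg less_imp_le[OF K])
    then show "(\<Sum>a\<in>PiE {..<n} (\<lambda>_. S). \<Prod>i<n. K (G (take (2 * N + 1) (drop i w))) (a i)) \<le> 1"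
      by (subst prod_sum_PiE[symmetric]) (use S in auto)
  qed
  also have "\<dots> = 1"
    using Z_pos[of m] by (simp add: p_def sum_divide_distrib[symmetric] Z_def)
  finally have sum_q: "sum q (words \<nu> m \<times> PiE {..<n} (\<lambda>_. S)) \<le> 1" .
  define \<kappa> where "\<kappa> x = - ln (K (\<psi> x) (\<phi> x))" for x
  have \<kappa>_eq: "\<kappa> = (\<lambda>x. - ln (1 - e) + (ln (real (card S) / e) + ln (1 - e)) * indicator {x. \<phi> x \<noteq> \<psi> x} x)"
    using e cS by (auto simp: \<kappa>_def K_def ln_div fun_eq_iff)
  have ind: "integrable \<mu> (\<lambda>x. (ln (real (card S) / e) + ln (1 - e)) * indicator {x. \<phi> x \<noteq> \<psi> x} x)"
    using A(1) by (intro integrable_mult_right) (simp add: integrable_indicator_iff less_top[symmetric])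
  have \<kappa>_int: "integrable \<mu> \<kappa>"
    unfolding \<kappa>_eq by (intro Bochner_Integration.integrable_add ind) simp
  have "(\<integral>x. \<kappa> x \<partial>\<mu>) = - ln (1 - e) + (ln (real (card S) / e) + ln (1 - e)) * prob {x. \<phi> x \<noteq> \<psi> x}"
    unfolding \<kappa>_eq using ind by (subst Bochner_Integration.integral_add) (simp_all add: prob_space)
  also have "\<dots> \<le> - ln (1 - e) + ln (real (card S) / e) * prob {x. \<phi> x \<noteq> \<psi> x}"
    using e by (intro add_left_mono mult_right_mono) auto
  also have "\<dots> \<le> - ln (1 - e) + d * ln (real (card S) / e)"
  proof -
    have "1 \<le> real (card S)"
      using cS by simp
    then have "1 \<le> real (card S) / e"
      using e by (simp add: field_simps)
    then show ?thesis
      using mult_left_mono[OF A(2), of "ln (real (card S) / e)"] ln_ge_zero[of "real (card S) / e"]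
      by (simp add: mult.commute)
  qed
  finally have \<kappa>_le: "(\<integral>x. \<kappa> x \<partial>\<mu>) \<le> - ln (1 - e) + d * ln (real (card S) / e)" .
  have int1: "integrable \<mu> (\<lambda>x. ln (Z m) + D - birkhoff_sum F m (translate (- int N) x))"
    by (intro Bochner_Integration.integrable_diff integral_birkhoff_sum) simp
  have int2: "integrable \<mu> (\<lambda>x. \<Sum>i<n. \<kappa> (translate (int i) x))"
    by (intro Bochner_Integration.integrable_sum integral_translate \<kappa>_int)
  \<comment> \<open>The word is joined to the name, which can only increase the entropy, because the
    comparison weights live on such pairs.\<close>
  have "rv_entropy \<mu> (names shift \<phi> n) \<le> rv_entropy \<mu> (\<lambda>x. (W x, names shift \<phi> n x))"
    by (rule rv_entropy_mono[OF YW _ Nm finite_PiE_const[OF S]]) (use S in \<open>auto intro: finite_PiE_const\<close>)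
  also have "\<dots> \<le> (\<integral>x. - ln (q (W x, names shift \<phi> n x)) \<partial>\<mu>)"
    by (rule rv_entropy_le_gibbs[OF YW _ less_imp_le[OF q] sum_q q]) (use S in \<open>auto intro: finite_PiE_const\<close>)
  also have "\<dots> \<le> (\<integral>x. (ln (Z m) + D - birkhoff_sum F m (translate (- int N) x))
      + (\<Sum>i<n. \<kappa> (translate (int i) x)) \<partial>\<mu>)"
  proof (rule integral_mono_AE)
    show "integrable \<mu> (\<lambda>x. - ln (q (W x, names shift \<phi> n x)))"
      by (rule finite_rv_integral(1)[OF YW]) (use S in \<open>auto intro: finite_PiE_const\<close>)
    show "integrable \<mu> (\<lambda>x. (ln (Z m) + D - birkhoff_sum F m (translate (- int N) x))
      + (\<Sum>i<n. \<kappa> (translate (int i) x)))"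
      by (rule Bochner_Integration.integrable_add[OF int1 int2])
    show "AE x in \<mu>. - ln (q (W x, names shift \<phi> n x))
        \<le> (ln (Z m) + D - birkhoff_sum F m (translate (- int N) x)) + (\<Sum>i<n. \<kappa> (translate (int i) x))"
      using symbols
    proof eventually_elim
      case (elim x)
      have W_eq: "W x = window x (- int N) m"
        using elim by (simp add: W_def)
      have "\<bar>birkhoff_sum F m (periodic (W x)) - birkhoff_sum F m (translate (- int N) x)\<bar> \<le> D"
      proof (rule F_distortion)
        show "window (periodic (W x)) 0 m = window (translate (- int N) x) 0 m"
          unfolding window_periodic_words[OF W] by (simp add: W_eq)
      qed
      then have 1: "- ln (p (W x)) \<le> ln (Z m) + D - birkhoff_sum F m (translate (- int N) x)"
        using Z_pos[of m] by (simp add: p_def ln_div)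
      have "- ln (K (G (take (2 * N + 1) (drop i (W x)))) (names shift \<phi> n x i)) = \<kappa> (translate (int i) x)"
        if "i < n" for i
      proof -
        have "take (2 * N + 1) (drop i (W x)) = central (translate (int i) x) N"
          unfolding W_eq by (subst take_drop_window) (use that in \<open>auto simp: m_def central_def add.commute\<close>)
        then show ?thesis
          using that by (simp only: G \<kappa>_def) (simp add: names_def shift_funpow)
      qed
      then have 2: "(\<Sum>i<n. - ln (K (G (take (2 * N + 1) (drop i (W x)))) (names shift \<phi> n x i)))
          = (\<Sum>i<n. \<kappa> (translate (int i) x))"
        by (intro sum.cong refl) simp
      have "ln (q (W x, names shift \<phi> n x)) = ln (p (W x))
          + (\<Sum>i<n. ln (K (G (take (2 * N + 1) (drop i (W x)))) (names shift \<phi> n x i)))"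
        unfolding q_def prod.case
        by (subst ln_mult_pos[OF p prod_pos[OF K]], subst ln_prod)
           (use K in \<open>auto simp: less_imp_neq[THEN not_sym]\<close>)
      then show ?case
        using 1 2 by (simp add: sum_negf)
    qed
  qed
  also have "\<dots> = (\<integral>x. ln (Z m) + D - birkhoff_sum F m (translate (- int N) x) \<partial>\<mu>)
      + (\<integral>x. (\<Sum>i<n. \<kappa> (translate (int i) x)) \<partial>\<mu>)"
    by (rule Bochner_Integration.integral_add[OF int1 int2])
  also have "(\<integral>x. ln (Z m) + D - birkhoff_sum F m (translate (- int N) x) \<partial>\<mu>)
      = ln (Z m) + D - real m * (\<integral>x. F x \<partial>\<mu>)"
    by (subst Bochner_Integration.integral_diff) (simp_all add: integral_birkhoff_sum prob_space)
  also have "(\<integral>x. (\<Sum>i<n. \<kappa> (translate (int i) x)) \<partial>\<mu>) = real n * (\<integral>x. \<kappa> x \<partial>\<mu>)"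
    by (subst Bochner_Integration.integral_sum) (simp_all add: integral_translate[OF \<kappa>_int])
  also have "ln (Z m) + D - real m * (\<integral>x. F x \<partial>\<mu>) + real n * (\<integral>x. \<kappa> x \<partial>\<mu>)
      \<le> (real m * P + 2 * D) + D - real m * (\<integral>x. F x \<partial>\<mu>) + real n * (- ln (1 - e) + d * ln (real (card S) / e))"
    using ln_Z_bound[of m] \<kappa>_le by (intro add_mono diff_mono mult_left_mono) auto
  also have "\<dots> = real (n + 2 * N) * (P - (\<integral>x. F x \<partial>\<mu>)) + 3 * D + real n * (- ln (1 - e) + d * ln (real (card S) / e))"
    by (simp add: m_def algebra_simps)
  finally show ?thesis .
qed

text \<open>As \<open>n\<close> grows, the constants that depend on \<open>N\<close> disappear. Then
  \<open>d\<close> tends to 0 for fixed \<open>e\<close>, which removes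
  \<open>d * ln (real (card S) / e)\<close>, and last \<open>e\<close> tends to 0.\<close>

lemma entropy_le:
  assumes \<phi>: "\<phi> \<in> \<mu> \<rightarrow>\<^sub>M count_space S" and S: "finite S"
    and lim: "(\<lambda>n. rv_entropy \<mu> (names shift \<phi> n) / real n) \<longlonglongrightarrow> l"
  shows "l \<le> P - (\<integral>x. F x \<partial>\<mu>)"
proof -
  define r where "r = P - (\<integral>x. F x \<partial>\<mu>)"
  have step: "l \<le> r + (- ln (1 - e) + d * ln (real (card S) / e))" if e: "0 < e" "e < 1" and d: "0 < d" for e d
  proof -
    obtain N \<psi> where \<psi>: "\<forall>x. \<psi> x \<in> S" "\<forall>x y. central x N = central y N \<longrightarrow> \<psi> x = \<psi> y"
      "{x. \<phi> x \<noteq> \<psi> x} \<in> sets \<mu>" "prob {x. \<phi> x \<noteq> \<psi> x} \<le> d"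
      by (rule approximate_function[OF \<phi> S d])
    define R where "R = - ln (1 - e) + d * ln (real (card S) / e)"
    have "\<forall>\<^sub>F n in sequentially. rv_entropy \<mu> (names shift \<phi> n) / real n
        \<le> (r + R) + (2 * real N * r + 3 * D) / real n"
      using eventually_ge_at_top[of 1]
    proof eventually_elim
      case (elim n)
      have "rv_entropy \<mu> (names shift \<phi> n) \<le> real (n + 2 * N) * r + 3 * D + real n * R"
        unfolding r_def R_def by (rule rv_entropy_names_le[OF \<phi> S \<psi>(1,2)[rule_format] \<psi>(3,4) e])
      also have "\<dots> = real n * ((r + R) + (2 * real N * r + 3 * D) / real n)"
        using elim by (simp add: field_simps)
      finally show ?case
        using elim by (simp add: pos_divide_le_eq mult.commute)
    qed
    moreover have "(\<lambda>n. (r + R) + (2 * real N * r + 3 * D) / real n) \<longlonglongrightarrow> r + R"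
      using tendsto_add[OF tendsto_const lim_const_over_n] by force
    ultimately show ?thesis
      unfolding R_def[symmetric] by (intro tendsto_le[OF sequentially_bot _ lim]) auto
  qed
  have "l \<le> r - ln (1 - e)" if e: "0 < e" "e < 1" for e
  proof (rule tendsto_lowerbound[where F = "at_right (0::real)"])
    have "((\<lambda>d. r + (- ln (1 - e) + d * ln (real (card S) / e))) \<longlongrightarrow> r + (- ln (1 - e) + 0 * ln (real (card S) / e))) (at_right 0)"
      by (intro tendsto_intros)
    then show "((\<lambda>d. r + (- ln (1 - e) + d * ln (real (card S) / e))) \<longlongrightarrow> r - ln (1 - e)) (at_right 0)"
      by simp
    show "\<forall>\<^sub>F d in at_right 0. l \<le> r + (- ln (1 - e) + d * ln (real (card S) / e))"
      using eventually_at_right_less[of "0::real"] by eventually_elim (rule step[OF e])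
  qed simp
  note step' = this
  show ?thesis
    unfolding r_def[symmetric]
  proof (rule tendsto_lowerbound[where F = "at_right (0::real)"])
    have "((\<lambda>e. r - ln (1 - e)) \<longlongrightarrow> r - ln (1 - 0)) (at_right 0)"
      by (intro tendsto_intros) auto
    then show "((\<lambda>e. r - ln (1 - e)) \<longlongrightarrow> r) (at_right 0)"
      by simp
    show "\<forall>\<^sub>F e in at_right 0. l \<le> r - ln (1 - e)"
      unfolding eventually_at_right_field using step' by (intro exI[of _ 1]) auto
  qed simp
qed

end

subsection \<open>Equidistributed periodic points\<close>

text \<open>Sum out the last letter. The transition weights \<open>\<kappa>\<close> may depend on
  the whole past, so a chain of any memory is covered together with its initial letters.\<close>

lemma sum_markov_le:
  fixes \<kappa> :: "nat list \<Rightarrow> nat \<Rightarrow> real"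
  assumes "\<And>v a. 0 \<le> \<kappa> v a" "\<And>v. (\<Sum>a<\<nu>. \<kappa> v a) \<le> 1"
  shows "(\<Sum>w\<in>words \<nu> n. \<Prod>i<n. \<kappa> (take i w) (w ! i)) \<le> 1"
proof (induction n)
  case (Suc n)
  have "(\<Sum>w\<in>words \<nu> (Suc n). \<Prod>i<Suc n. \<kappa> (take i w) (w ! i))
      = (\<Sum>u\<in>words \<nu> n. \<Sum>a<\<nu>. (\<Prod>i<n. \<kappa> (take i u) (u ! i)) * \<kappa> u a)"
    unfolding sum_words_snoc
  proof (intro sum.cong refl)
    fix u a assume "u \<in> words \<nu> n"
    then have u: "length u = n"
      by (simp add: words_def)
    have "(\<Prod>i<n. \<kappa> (take i (u @ [a])) ((u @ [a]) ! i)) = (\<Prod>i<n. \<kappa> (take i u) (u ! i))"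
      by (intro prod.cong refl) (simp add: u nth_append)
    then show "(\<Prod>i<Suc n. \<kappa> (take i (u @ [a])) ((u @ [a]) ! i)) = (\<Prod>i<n. \<kappa> (take i u) (u ! i)) * \<kappa> u a"
      by (simp add: u nth_append)
  qed
  also have "\<dots> = (\<Sum>u\<in>words \<nu> n. (\<Prod>i<n. \<kappa> (take i u) (u ! i)) * (\<Sum>a<\<nu>. \<kappa> u a))"
    by (simp add: sum_distrib_left)
  also have "\<dots> \<le> (\<Sum>u\<in>words \<nu> n. (\<Prod>i<n. \<kappa> (take i u) (u ! i)) * 1)"
    by (intro sum_mono mult_left_mono assms prod_nonneg)
  finally show ?case
    using Suc by simp
qed simp

definition word_entropy :: "nat \<Rightarrow> (nat list \<Rightarrow> real) \<Rightarrow> nat \<Rightarrow> real" where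
  "word_entropy \<nu> m q = - (\<Sum>u\<in>words \<nu> q. m u * ln (m u))"

text \<open>Only the limit 0 is delicate: there \<open>ln\<close> is not continuous, and the bound
  \<open>2 * sqrt t\<close> on \<open>\<bar>t * ln t\<bar>\<close> takes over. It comes from
  \<open>ln (1 / sqrt t) \<le> 1 / sqrt t\<close>.\<close>

lemma tendsto_xlnx:
  fixes a :: "nat \<Rightarrow> real"
  assumes a: "a \<longlonglongrightarrow> l" and bounds: "\<And>n. 0 \<le> a n" "\<And>n. a n \<le> 1"
  shows "(\<lambda>n. a n * ln (a n)) \<longlonglongrightarrow> l * ln l"
proof (cases "l = 0")
  case False
  then show ?thesis
    using a by (intro tendsto_intros)
next
  case True
  have bound: "norm (t * ln t) \<le> 2 * sqrt t" if t: "0 \<le> t" "t \<le> 1" for t :: real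
  proof (cases "t = 0")
    case False
    then have pos: "0 < t" "0 < sqrt t"
      using t by auto
    have "ln (1 / sqrt t) \<le> 1 / sqrt t"
      using ln_le_minus_one[of "1 / sqrt t"] pos by simp
    then have "- ln t \<le> 2 / sqrt t"
      using pos by (simp add: ln_div ln_sqrt)
    then have "t * - ln t \<le> t * (2 / sqrt t)"
      using pos by (intro mult_left_mono) auto
    also have "t * (2 / sqrt t) = 2 * (t / sqrt t)"
      by simp
    also have "t / sqrt t = sqrt t"
      using t by (intro real_div_sqrt)
    finally have "t * - ln t \<le> 2 * sqrt t" .
    moreover have "ln t \<le> 0"
      using pos t by simp
    ultimately show ?thesis
      using pos by (simp add: abs_mult)
  qed simp
  have "(\<lambda>n. 2 * sqrt (a n)) \<longlonglongrightarrow> 2 * sqrt 0"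
    using a True by (intro tendsto_intros) auto
  then have "(\<lambda>n. a n * ln (a n)) \<longlonglongrightarrow> 0"
    by (intro Lim_null_comparison[OF always_eventually[OF allI[OF bound[OF bounds]]]]) simp
  then show ?thesis
    by (simp add: True)
qed

lemma tendsto_word_entropy:
  assumes "\<And>u. (\<lambda>n. m n u) \<longlonglongrightarrow> l u" and "\<And>n u. 0 \<le> m n u" "\<And>n u. m n u \<le> 1"
  shows "(\<lambda>n. word_entropy \<nu> (m n) q) \<longlonglongrightarrow> word_entropy \<nu> l q"
  unfolding word_entropy_def by (intro tendsto_minus tendsto_sum tendsto_xlnx assms)

context full_shift
begin

definition weight :: "nat \<Rightarrow> nat list \<Rightarrow> real" where
  "weight n w = exp (birkhoff_sum F n (periodic w)) / Z n"

text \<open>Because the points are periodic, the mean over their first \<open>n\<close> translates is exactly invariant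
  under the shift, so that no error terms arise.\<close>

definition orbit_mean :: "nat \<Rightarrow> ((int \<Rightarrow> nat) \<Rightarrow> real) \<Rightarrow> real" where
  "orbit_mean n h = (\<Sum>w\<in>words \<nu> n. weight n w * (\<Sum>k<n. h (translate (int k) (periodic w)))) / real n"

text \<open>The cylinder probabilities of the weighted periodic orbits, written down before any
  measure is constructed; their limits become the cylinder probabilities of the equilibrium
  state.\<close>

definition freq :: "nat \<Rightarrow> nat list \<Rightarrow> real" where
  "freq n u = orbit_mean n (\<lambda>x. if window x 0 (length u) = u then 1 else 0)"

lemma weight_pos: "0 < weight n w"
  using Z_pos by (simp add: weight_def)

lemma sum_weight: "(\<Sum>w\<in>words \<nu> n. weight n w) = 1"
  using Z_pos[of n] by (simp add: weight_def sum_divide_distrib[symmetric] Z_def)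

lemma orbit_mean_mono:
  assumes "\<And>w k. w \<in> words \<nu> n \<Longrightarrow> k < n \<Longrightarrow>
    h (translate (int k) (periodic w)) \<le> h' (translate (int k) (periodic w))"
  shows "orbit_mean n h \<le> orbit_mean n h'"
  unfolding orbit_mean_def
  by (intro divide_right_mono sum_mono mult_left_mono less_imp_le[OF weight_pos] assms) auto

lemma orbit_mean_cong:
  assumes "\<And>w k. w \<in> words \<nu> n \<Longrightarrow> k < n \<Longrightarrow>
    h (translate (int k) (periodic w)) = h' (translate (int k) (periodic w))"
  shows "orbit_mean n h = orbit_mean n h'"
  using assms by (intro antisym orbit_mean_mono) auto

lemma orbit_mean_sum: "orbit_mean n (\<lambda>x. \<Sum>i\<in>I. h i x) = (\<Sum>i\<in>I. orbit_mean n (h i))"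
proof -
  have "(\<Sum>w\<in>words \<nu> n. weight n w * (\<Sum>k<n. \<Sum>i\<in>I. h i (translate (int k) (periodic w))))
      = (\<Sum>w\<in>words \<nu> n. \<Sum>i\<in>I. weight n w * (\<Sum>k<n. h i (translate (int k) (periodic w))))"
    by (intro sum.cong refl) (subst sum.swap, simp add: sum_distrib_left)
  also have "\<dots> = (\<Sum>i\<in>I. \<Sum>w\<in>words \<nu> n. weight n w * (\<Sum>k<n. h i (translate (int k) (periodic w))))"
    by (rule sum.swap)
  finally show ?thesis
    by (simp add: orbit_mean_def sum_divide_distrib)
qed

lemma orbit_mean_add: "orbit_mean n (\<lambda>x. h x + h' x) = orbit_mean n h + orbit_mean n h'"
  by (simp add: orbit_mean_def sum.distrib distrib_left add_divide_distrib)

lemma orbit_mean_cmult: "orbit_mean n (\<lambda>x. h x * c) = orbit_mean n h * c"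
  by (simp add: orbit_mean_def sum_distrib_right sum_distrib_left mult_ac)

lemma orbit_mean_const: "0 < n \<Longrightarrow> orbit_mean n (\<lambda>_. c) = c"
  using sum_weight[of n] by (simp add: orbit_mean_def sum_distrib_right[symmetric])

lemma orbit_mean_translate: "orbit_mean n (\<lambda>x. h (translate (int t) x)) = orbit_mean n h"
proof (induction t)
  case (Suc t)
  have step: "orbit_mean n (\<lambda>x. h (translate 1 x)) = orbit_mean n h" for h
  proof -
    have "(\<Sum>k<n. h (translate 1 (translate (int k) (periodic w)))) = (\<Sum>k<n. h (translate (int k) (periodic w)))"
      if w: "w \<in> words \<nu> n" for w
    proof -
      define a where "a k = h (translate (int k) (periodic w))" for k
      have "a n = a 0"
        using w translate_periodic[of w] by (simp add: a_def words_def)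
      moreover have "a 0 + (\<Sum>k<n. a (Suc k)) = (\<Sum>k<n. a k) + a n"
        using sum.lessThan_Suc_shift[of a n] by simp
      ultimately show ?thesis
        by (simp add: a_def)
    qed
    then show ?thesis
      unfolding orbit_mean_def by simp
  qed
  have "orbit_mean n (\<lambda>x. h (translate (int (Suc t)) x)) = orbit_mean n (\<lambda>x. h (translate (int t) (translate 1 x)))"
    by (simp add: add.commute)
  also have "\<dots> = orbit_mean n h"
    using step[of "\<lambda>x. h (translate (int t) x)"] Suc by simp
  finally show ?case .
qed simp

lemma orbit_symbol: "w \<in> words \<nu> n \<Longrightarrow> k < n \<Longrightarrow> translate (int k) (periodic w) i < \<nu>"
  using periodic_less[of w \<nu> n] by simp

lemma orbit_window: "w \<in> words \<nu> n \<Longrightarrow> k < n \<Longrightarrow> window (translate (int k) (periodic w)) j q \<in> words \<nu> q"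
  using periodic_less[of w \<nu> n] by (auto simp: words_def set_window)

lemma orbit_mean_window:
  "orbit_mean n (\<lambda>x. h (window x 0 q)) = (\<Sum>u\<in>words \<nu> q. freq n u * h u)"
proof -
  have "orbit_mean n (\<lambda>x. h (window x 0 q))
      = orbit_mean n (\<lambda>x. \<Sum>u\<in>words \<nu> q. (if window x 0 (length u) = u then 1 else 0) * h u)"
  proof (rule orbit_mean_cong)
    fix w k assume wk: "w \<in> words \<nu> n" "k < n"
    let ?x = "translate (int k) (periodic w)"
    have "(\<Sum>u\<in>words \<nu> q. (if window ?x 0 (length u) = u then 1 else 0) * h u)
        = (\<Sum>u\<in>words \<nu> q. if u = window ?x 0 q then h u else 0)"
      by (intro sum.cong refl) (auto simp: words_def)
    then show "h (window ?x 0 q) = (\<Sum>u\<in>words \<nu> q. (if window ?x 0 (length u) = u then 1 else 0) * h u)"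
      using orbit_window[OF wk, of 0 q] by (simp add: sum.delta')
  qed
  then show ?thesis
    by (simp add: orbit_mean_sum orbit_mean_cmult freq_def)
qed

lemma freq_nonneg: "0 \<le> freq n u"
  unfolding freq_def orbit_mean_def
  by (intro divide_nonneg_nonneg sum_nonneg mult_nonneg_nonneg less_imp_le[OF weight_pos]) auto

lemma freq_le_1: "0 < n \<Longrightarrow> freq n u \<le> 1"
  unfolding freq_def using orbit_mean_mono[of n _ "\<lambda>_. 1"] orbit_mean_const[of n 1] by fastforce

lemma freq_Nil: "0 < n \<Longrightarrow> freq n [] = 1"
  by (simp add: freq_def orbit_mean_const)

lemma freq_outside:
  assumes "\<not> set u \<subseteq> {..<\<nu>}"
  shows "freq n u = 0"
proof -
  have "freq n u = orbit_mean n (\<lambda>_. 0)"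
    unfolding freq_def
  proof (rule orbit_mean_cong)
    fix w k assume "w \<in> words \<nu> n" "k < n"
    then have "window (translate (int k) (periodic w)) 0 (length u) \<in> words \<nu> (length u)"
      by (rule orbit_window)
    with assms show "(if window (translate (int k) (periodic w)) 0 (length u) = u then 1 else 0) = (0::real)"
      by (auto simp only: words_def split: if_splits)
  qed
  then show ?thesis
    by (simp add: orbit_mean_def)
qed

lemma freq_snoc: "(\<Sum>a<\<nu>. freq n (u @ [a])) = freq n u"
  unfolding freq_def orbit_mean_sum[symmetric]
proof (rule orbit_mean_cong)
  fix w k assume wk: "w \<in> words \<nu> n" "k < n"
  let ?x = "translate (int k) (periodic w)"
  have "(\<Sum>a<\<nu>. if window ?x 0 (length (u @ [a])) = u @ [a] then 1 else 0)
      = (\<Sum>a<\<nu>. if a = ?x (int (length u)) then (if window ?x 0 (length u) = u then 1 else 0) else (0::real))"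
    by (intro sum.cong refl) (auto simp: window_Suc simp del: window_translate translate_apply)
  then show "(\<Sum>a<\<nu>. if window ?x 0 (length (u @ [a])) = u @ [a] then 1 else 0)
      = (if window ?x 0 (length u) = u then 1 else (0::real))"
    using orbit_symbol[OF wk, of "int (length u)"] by (simp add: sum.delta' del: window_translate translate_apply)
qed

text \<open>Extending a word to the left moves the remaining window by one place; invariance of the
  mean moves it back.\<close>

lemma freq_Cons: "(\<Sum>a<\<nu>. freq n (a # u)) = freq n u"
proof -
  have "(\<Sum>a<\<nu>. freq n (a # u)) = orbit_mean n (\<lambda>x. if window (translate (int 1) x) 0 (length u) = u then 1 else 0)"
    unfolding freq_def orbit_mean_sum[symmetric]
  proof (rule orbit_mean_cong)
    fix w k assume wk: "w \<in> words \<nu> n" "k < n"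
    let ?x = "translate (int k) (periodic w)"
    have win: "window ?x 0 (Suc q) = ?x 0 # window (translate (int 1) ?x) 0 q" for q
      using window_add[of ?x 0 1 q] by (simp add: window_Suc[of _ _ 0])
    have "(\<Sum>a<\<nu>. if window ?x 0 (length (a # u)) = a # u then 1 else 0)
        = (\<Sum>a<\<nu>. if a = ?x 0 then (if window (translate (int 1) ?x) 0 (length u) = u then 1 else 0) else (0::real))"
      by (intro sum.cong refl) (auto simp: win simp del: window_translate translate_apply translate_translate)
    then show "(\<Sum>a<\<nu>. if window ?x 0 (length (a # u)) = a # u then 1 else 0)
        = (if window (translate (int 1) ?x) 0 (length u) = u then 1 else (0::real))"
      using orbit_symbol[OF wk, of 0]
      by (simp add: sum.delta' del: window_translate translate_apply translate_translate)
  qed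
  also have "\<dots> = freq n u"
    unfolding freq_def by (rule orbit_mean_translate)
  finally show ?thesis .
qed

text \<open>A word seen along one orbit already receives a part of the positive weight of that
  orbit. This makes the logarithms and quotients of frequencies below meaningful.\<close>

lemma freq_orbit_pos:
  assumes w: "w \<in> words \<nu> n" and k: "k < n"
  shows "0 < freq n (window (translate (int k) (periodic w)) 0 q)"
proof -
  let ?u = "window (translate (int k) (periodic w)) 0 q"
  let ?h = "\<lambda>x. if window x 0 (length ?u) = ?u then 1 else (0::real)"
  let ?g = "\<lambda>w. weight n w * (\<Sum>k<n. ?h (translate (int k) (periodic w)))"
  have "?h (translate (int k) (periodic w)) \<le> (\<Sum>k<n. ?h (translate (int k) (periodic w)))"
    by (rule member_le_sum) (use k in auto)
  then have "0 < ?g w"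
    using weight_pos by (intro mult_pos_pos) (auto split: if_splits)
  also have "?g w \<le> (\<Sum>w\<in>words \<nu> n. ?g w)"
    by (rule member_le_sum[OF w]) (auto intro!: mult_nonneg_nonneg sum_nonneg less_imp_le[OF weight_pos])
  finally show ?thesis
    unfolding freq_def orbit_mean_def using k by (intro divide_pos_pos) auto
qed

lemma orbit_mean_F: "0 < n \<Longrightarrow> real n * orbit_mean n F = (\<Sum>w\<in>words \<nu> n. weight n w * birkhoff_sum F n (periodic w))"
  by (simp add: orbit_mean_def birkhoff_sum_translate)

text \<open>The weights are compared with the Markov measure of memory \<open>q\<close> given by the frequencies. This
  replaces the subadditivity and concavity of entropy in the usual proof of the variational principle.\<close>

lemma ln_Z_le_frequencies:
  assumes n: "0 < n"
  shows "ln (Z n) \<le> real n * (word_entropy \<nu> (freq n) (Suc q) - word_entropy \<nu> (freq n) q)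
    + real q * ln (real \<nu>) + real n * orbit_mean n F"
proof -
  \<comment> \<open>The first \<open>q\<close> letters are drawn uniformly, every later one from its
    conditional frequency given the \<open>q\<close> letters before it. A context of frequency 0
    produces a row of zeros, which still sums to at most 1.\<close>
  define \<kappa> where "\<kappa> v a = (if length v < q then 1 / real \<nu>
    else freq n (drop (length v - q) v @ [a]) / freq n (drop (length v - q) v))" for v a
  define Q where "Q w = (\<Prod>i<n. \<kappa> (take i w) (w ! i))" for w
  \<comment> \<open>The conditional information of a letter given the \<open>q\<close> letters
    before it; its orbit mean will be a difference of two word entropies.\<close>
  define cost where "cost x = - ln (freq n (window x 0 (Suc q))) + ln (freq n (window x 0 q))" for x
  have \<kappa>_nonneg: "0 \<le> \<kappa> v a" for v a
    by (simp add: \<kappa>_def freq_nonneg)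
  have \<kappa>_sum: "(\<Sum>a<\<nu>. \<kappa> v a) \<le> 1" for v
  proof (cases "length v < q")
    case True
    then show ?thesis
      using \<nu>_pos by (simp add: \<kappa>_def)
  next
    case False
    then have "(\<Sum>a<\<nu>. \<kappa> v a) = freq n (drop (length v - q) v) / freq n (drop (length v - q) v)"
      by (simp add: \<kappa>_def sum_divide_distrib[symmetric] freq_snoc)
    then show ?thesis by simp
  qed
  have sum_Q: "sum Q (words \<nu> n) \<le> 1"
    unfolding Q_def using \<kappa>_nonneg \<kappa>_sum by (rule sum_markov_le)
  \<comment> \<open>The context of position \<open>i\<close> begins at position
    \<open>i - q\<close>, so the letter is charged to that orbit time.\<close>
  have \<kappa>_at: "\<kappa> (take i w) (w ! i) = freq n (window (translate (int (i - q)) (periodic w)) 0 (Suc q))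
      / freq n (window (translate (int (i - q)) (periodic w)) 0 q)"
    if w: "w \<in> words \<nu> n" and i: "i < n" "q \<le> i" for w i
  proof -
    let ?x = "translate (int (i - q)) (periodic w)"
    have len: "length w = n"
      using w by (simp add: words_def)
    have "drop (i - q) (take i w) = take q (drop (i - q) w)"
      using i by (simp add: take_drop)
    also have "\<dots> = take q (drop (i - q) (window (periodic w) 0 n))"
      using w by simp
    also have "\<dots> = window ?x 0 q"
      by (subst take_drop_window) (use i in auto)
    finally have 1: "drop (i - q) (take i w) = window ?x 0 q" .
    have "w ! i = periodic w (int i)"
      using i len by (simp add: periodic_def)
    then have "window ?x 0 (Suc q) = window ?x 0 q @ [w ! i]"
      using i by (simp add: window_Suc of_nat_diff)
    with 1 i len show ?thesis
      by (simp add: \<kappa>_def)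
  qed
  have Q_pos: "0 < Q w" if w: "w \<in> words \<nu> n" for w
    unfolding Q_def
  proof (rule prod_pos)
    fix i assume i: "i \<in> {..<n}"
    show "0 < \<kappa> (take i w) (w ! i)"
    proof (cases "i < q")
      case True
      then show ?thesis
        using \<nu>_pos by (simp add: \<kappa>_def)
    next
      case False
      then have "i - q < n"
        using i by auto
      from freq_orbit_pos[OF w this] False i show ?thesis
        by (subst \<kappa>_at[OF w]) auto
    qed
  qed
  \<comment> \<open>Letters in the first \<open>q\<close> places have no full context, while the
    orbit mean sums over all \<open>n\<close> times; nonnegativity allows the sum to be extended to
    them.\<close>
  have cost_nonneg: "0 \<le> cost (translate (int k) (periodic w))" if wk: "w \<in> words \<nu> n" "k < n" for w k
  proof -
    let ?x = "translate (int k) (periodic w)"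
    let ?u = "window ?x 0 q"
    have "freq n (?u @ [?x (int q)]) \<le> (\<Sum>a<\<nu>. freq n (?u @ [a]))"
      by (rule member_le_sum) (use orbit_symbol[OF wk, of "int q"] freq_nonneg in auto)
    then have "freq n (window ?x 0 (Suc q)) \<le> freq n ?u"
      unfolding freq_snoc by (simp add: window_Suc)
    then have "ln (freq n (window ?x 0 (Suc q))) \<le> ln (freq n ?u)"
      by (intro ln_mono freq_orbit_pos[OF wk])
    then show ?thesis
      by (simp add: cost_def)
  qed
  have ln_Q: "- ln (Q w) \<le> real q * ln (real \<nu>) + (\<Sum>k<n. cost (translate (int k) (periodic w)))"
    if w: "w \<in> words \<nu> n" for w
  proof -
    define b where "b k = cost (translate (int k) (periodic w))" for k
    have b: "0 \<le> b k" if "k < n" for k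
      using cost_nonneg[OF w that] by (simp add: b_def)
    have \<kappa>_pos: "0 < \<kappa> (take i w) (w ! i)" if "i < n" for i
      using Q_pos[OF w] that \<kappa>_nonneg[of "take i w" "w ! i"] unfolding Q_def
      by (metis (no_types, lifting) finite_lessThan lessThan_iff less_eq_real_def less_irrefl prod_zero_iff)
    have ln_nu: "0 \<le> ln (real \<nu>)"
      using \<nu>_pos by simp
    have "ln (Q w) = (\<Sum>i<n. ln (\<kappa> (take i w) (w ! i)))"
      unfolding Q_def by (rule ln_prod) (use \<kappa>_pos in \<open>auto simp: less_imp_neq[THEN not_sym]\<close>)
    then have "- ln (Q w) = (\<Sum>i<n. - ln (\<kappa> (take i w) (w ! i)))"
      by (simp add: sum_negf)
    also have "\<dots> \<le> (\<Sum>i<n. (if i < q then ln (real \<nu>) else 0) + (if q \<le> i then b (i - q) else 0))"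
    proof (rule sum_mono)
      fix i assume "i \<in> {..<n}"
      then have i: "i < n" by simp
      show "- ln (\<kappa> (take i w) (w ! i)) \<le> (if i < q then ln (real \<nu>) else 0) + (if q \<le> i then b (i - q) else 0)"
      proof (cases "i < q")
        case True
        then show ?thesis
          using i w \<nu>_pos by (simp add: \<kappa>_def words_def ln_div)
      next
        case False
        then have k: "i - q < n" "q \<le> i"
          using i by auto
        have "ln (\<kappa> (take i w) (w ! i)) = - b (i - q)"
          using freq_orbit_pos[OF w k(1), of q] freq_orbit_pos[OF w k(1), of "Suc q"]
          unfolding \<kappa>_at[OF w i k(2)] b_def cost_def by (simp add: ln_div)
        with False show ?thesis by simp
      qed
    qed
    also have "\<dots> = (\<Sum>i<n. if i < q then ln (real \<nu>) else 0) + (\<Sum>i<n. if q \<le> i then b (i - q) else 0)"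
      by (rule sum.distrib)
    also have "\<dots> \<le> real q * ln (real \<nu>) + (\<Sum>k<n. b k)"
    proof (rule add_mono)
      have "(\<Sum>i<n. if i < q then ln (real \<nu>) else 0) = (\<Sum>i\<in>{..<n} \<inter> {..<q}. ln (real \<nu>))"
        by (rule sum.mono_neutral_cong_right) auto
      also have "\<dots> \<le> real q * ln (real \<nu>)"
      proof -
        have "card ({..<n} \<inter> {..<q}) \<le> card {..<q}"
          by (rule card_mono) auto
        then show ?thesis
          using ln_nu by (simp add: mult_right_mono)
      qed
      finally show "(\<Sum>i<n. if i < q then ln (real \<nu>) else 0) \<le> real q * ln (real \<nu>)" .
      have "(\<Sum>i<n. if q \<le> i then b (i - q) else 0) = (\<Sum>i=q..<n. b (i - q))"
        by (rule sum.mono_neutral_cong_right) auto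
      also have "\<dots> = (\<Sum>k<n - q. b k)"
        by (rule sum.reindex_bij_witness[of _ "\<lambda>k. k + q" "\<lambda>i. i - q"]) auto
      also have "\<dots> \<le> (\<Sum>k<n. b k)"
        by (rule sum_mono2) (use b in auto)
      finally show "(\<Sum>i<n. if q \<le> i then b (i - q) else 0) \<le> (\<Sum>k<n. b k)" .
    qed
    finally show ?thesis
      by (simp add: b_def)
  qed
  have "- (\<Sum>w\<in>words \<nu> n. weight n w * ln (weight n w)) \<le> (\<Sum>w\<in>words \<nu> n. weight n w * - ln (Q w))"
    by (rule gibbs_inequality) (use weight_pos less_imp_le[OF weight_pos] sum_weight less_imp_le[OF Q_pos] sum_Q Q_pos in auto)
  also have "\<dots> \<le> (\<Sum>w\<in>words \<nu> n. weight n w * (real q * ln (real \<nu>) + (\<Sum>k<n. cost (translate (int k) (periodic w)))))"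
    by (intro sum_mono mult_left_mono ln_Q less_imp_le[OF weight_pos])
  also have "\<dots> = real q * ln (real \<nu>) + real n * orbit_mean n cost"
    using n sum_weight[of n] by (simp add: orbit_mean_def distrib_left sum.distrib sum_distrib_right[symmetric])
  also have "orbit_mean n cost = word_entropy \<nu> (freq n) (Suc q) - word_entropy \<nu> (freq n) q"
    unfolding cost_def orbit_mean_add
    using orbit_mean_window[of n "\<lambda>u. - ln (freq n u)" "Suc q"] orbit_mean_window[of n "\<lambda>u. ln (freq n u)" q]
    by (simp add: word_entropy_def sum_negf)
  finally have "- (\<Sum>w\<in>words \<nu> n. weight n w * ln (weight n w))
      \<le> real q * ln (real \<nu>) + real n * (word_entropy \<nu> (freq n) (Suc q) - word_entropy \<nu> (freq n) q)" .
  \<comment> \<open>The logarithm of a weight is a Birkhoff sum minus \<open>ln (Z n)\<close>, so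
    the entropy of the weights brings in the quantity to be bounded.\<close>
  moreover have "(\<Sum>w\<in>words \<nu> n. weight n w * ln (weight n w)) = real n * orbit_mean n F - ln (Z n)"
  proof -
    have "ln (weight n w) = birkhoff_sum F n (periodic w) - ln (Z n)" for w
      using Z_pos[of n] by (simp add: weight_def ln_div)
    then show ?thesis
      using sum_weight[of n] by (simp add: orbit_mean_F[OF n] right_diff_distrib sum_subtractf sum_distrib_right[symmetric])
  qed
  ultimately show ?thesis
    by linarith
qed

text \<open>The word \<open>u\<close> is meant to have length \<open>2r + 1\<close>; it is then the central word of the point.\<close>

definition F_word :: "nat \<Rightarrow> nat list \<Rightarrow> real" where
  "F_word r u = F (translate (int r) (periodic u))"

lemma F_word_close: "\<bar>F x - F_word r (central x r)\<bar> \<le> C * \<theta> ^ Suc r"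
  unfolding F_word_def
proof (rule locally_holderD[OF hol])
  let ?y = "translate (int r) (periodic (central x r))"
  have "central ?y r = window (periodic (central x r)) 0 (length (central x r))"
    by (simp add: central_def)
  also have "\<dots> = central x r"
    by (rule window_periodic)
  finally show "x i = ?y i" if "\<bar>i\<bar> < int (Suc r)" for i
    using that by (simp add: central_eq_iff)
qed auto

lemma orbit_mean_F_le:
  assumes n: "0 < n"
  shows "orbit_mean n F \<le> (\<Sum>u\<in>words \<nu> (2 * r + 1). freq n u * F_word r u) + C * \<theta> ^ Suc r"
proof -
  have "orbit_mean n F \<le> orbit_mean n (\<lambda>x. F_word r (central x r) + C * \<theta> ^ Suc r)"
    using F_word_close by (intro orbit_mean_mono) (smt (verit))
  also have "\<dots> = orbit_mean n (\<lambda>x. F_word r (central x r)) + C * \<theta> ^ Suc r"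
    using n by (simp add: orbit_mean_add orbit_mean_const)
  \<comment> \<open>Frequencies read words that start at coordinate 0; invariance moves the central
    word there.\<close>
  also have "orbit_mean n (\<lambda>x. F_word r (central x r)) = orbit_mean n (\<lambda>x. F_word r (central (translate (int r) x) r))"
    by (rule orbit_mean_translate[symmetric])
  also have "\<dots> = (\<Sum>u\<in>words \<nu> (2 * r + 1). freq n u * F_word r u)"
    unfolding central_def using orbit_mean_window[of n "F_word r" "2 * r + 1"] by simp
  finally show ?thesis .
qed

text \<open>Frequency functions are points of the compact product of unit intervals over all words.
  For fixed \<open>q\<close> and \<open>r\<close> each conclusion involves finitely many words, so
  it passes to a pointwise limit; the boundary term \<open>real q * ln (real \<nu>)\<close>
  disappears after division by the length of the orbits.\<close>

lemma limit_frequencies: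
  obtains m where "\<And>u. 0 \<le> m u" "m [] = 1" "\<And>u. \<not> set u \<subseteq> {..<\<nu>} \<Longrightarrow> m u = 0"
    "\<And>u. (\<Sum>a<\<nu>. m (u @ [a])) = m u" "\<And>u. (\<Sum>a<\<nu>. m (a # u)) = m u"
    "\<And>q r. P \<le> word_entropy \<nu> m (Suc q) - word_entropy \<nu> m q
        + (\<Sum>u\<in>words \<nu> (2 * r + 1). m u * F_word r u) + C * \<theta> ^ Suc r"
proof -
  have "compactin (product_topology (\<lambda>_. euclidean) UNIV) (PiE UNIV (\<lambda>_::nat list. {0..1::real}))"
    by (simp add: compactin_PiE)
  then have "compact (PiE UNIV (\<lambda>_::nat list. {0..1::real}))"
    by (simp add: euclidean_product_topology)
  then have "seq_compact (PiE UNIV (\<lambda>_::nat list. {0..1::real}))"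
    by (rule compact_imp_seq_compact)
  \<comment> \<open>The index \<open>Suc n\<close> excludes \<open>n = 0\<close>, where division by
    zero makes every orbit mean 0, even the frequency of the empty word.\<close>
  moreover have "\<forall>n. freq (Suc n) \<in> PiE UNIV (\<lambda>_::nat list. {0..1::real})"
    by (simp add: PiE_UNIV_domain freq_nonneg freq_le_1)
  ultimately obtain m \<sigma> where "strict_mono (\<sigma> :: nat \<Rightarrow> nat)" and lim: "((\<lambda>n. freq (Suc n)) \<circ> \<sigma>) \<longlonglongrightarrow> m"
    unfolding seq_compact_def by metis
  define N where "N k = Suc (\<sigma> k)" for k
  have N: "strict_mono N"
    using \<open>strict_mono \<sigma>\<close> by (simp add: strict_mono_def N_def)
  have N_pos: "0 < N k" for k
    by (simp add: N_def)
  have m: "(\<lambda>k. freq (N k) u) \<longlonglongrightarrow> m u" for u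
  proof -
    have "isCont (\<lambda>f. f u) m"
      using continuous_on_product_coordinates[of u] continuous_on_eq_continuous_at[OF open_UNIV] by blast
    from isCont_tendsto_compose[OF this lim] show ?thesis
      by (simp add: N_def o_def)
  qed
  show thesis
  proof (rule that[of m])
    show "0 \<le> m u" for u
      by (rule LIMSEQ_le_const[OF m]) (auto intro: freq_nonneg)
    show "m [] = 1"
      using m[of "[]"] by (simp add: freq_Nil N_pos LIMSEQ_const_iff)
    show "m u = 0" if "\<not> set u \<subseteq> {..<\<nu>}" for u
      using m[of u] by (simp add: freq_outside[OF that] LIMSEQ_const_iff)
    show "(\<Sum>a<\<nu>. m (u @ [a])) = m u" for u
    proof (rule LIMSEQ_unique[OF _ m])
      have "(\<lambda>k. \<Sum>a<\<nu>. freq (N k) (u @ [a])) \<longlonglongrightarrow> (\<Sum>a<\<nu>. m (u @ [a]))"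
        by (intro tendsto_sum m)
      then show "(\<lambda>k. freq (N k) u) \<longlonglongrightarrow> (\<Sum>a<\<nu>. m (u @ [a]))"
        by (simp add: freq_snoc)
    qed
    show "(\<Sum>a<\<nu>. m (a # u)) = m u" for u
    proof (rule LIMSEQ_unique[OF _ m])
      have "(\<lambda>k. \<Sum>a<\<nu>. freq (N k) (a # u)) \<longlonglongrightarrow> (\<Sum>a<\<nu>. m (a # u))"
        by (intro tendsto_sum m)
      then show "(\<lambda>k. freq (N k) u) \<longlonglongrightarrow> (\<Sum>a<\<nu>. m (a # u))"
        by (simp add: freq_Cons)
    qed
    fix q r
    define h where "h m = word_entropy \<nu> m (Suc q) - word_entropy \<nu> m q
        + (\<Sum>u\<in>words \<nu> (2 * r + 1). m u * F_word r u) + C * \<theta> ^ Suc r" for m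
    have "(\<lambda>k. h (freq (N k)) + real q * ln (real \<nu>) / real (N k)) \<longlonglongrightarrow> h m + 0"
    proof (rule tendsto_add)
      show "(\<lambda>k. h (freq (N k))) \<longlonglongrightarrow> h m"
        unfolding h_def
        by (intro tendsto_intros tendsto_word_entropy m freq_nonneg freq_le_1 N_pos)
      show "(\<lambda>k. real q * ln (real \<nu>) / real (N k)) \<longlonglongrightarrow> 0"
        using LIMSEQ_subseq_LIMSEQ[OF lim_const_over_n N] by (simp add: o_def)
    qed
    moreover have "(\<lambda>k. ln (Z (N k)) / real (N k)) \<longlonglongrightarrow> P"
      using LIMSEQ_subseq_LIMSEQ[OF ln_Z_limit N] by (simp add: o_def)
    moreover have "ln (Z (N k)) / real (N k) \<le> h (freq (N k)) + real q * ln (real \<nu>) / real (N k)" for k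
    proof -
      let ?n = "real (N k)"
      have "ln (Z (N k)) \<le> ?n * (word_entropy \<nu> (freq (N k)) (Suc q) - word_entropy \<nu> (freq (N k)) q)
          + real q * ln (real \<nu>) + ?n * ((\<Sum>u\<in>words \<nu> (2 * r + 1). freq (N k) u * F_word r u) + C * \<theta> ^ Suc r)"
        using ln_Z_le_frequencies[OF N_pos, of k q] mult_left_mono[OF orbit_mean_F_le[OF N_pos, of k r], of ?n] by simp
      also have "\<dots> = ?n * h (freq (N k)) + real q * ln (real \<nu>)"
        by (simp add: h_def algebra_simps)
      finally show ?thesis
        using N_pos[of k] by (simp add: field_simps)
    qed
    ultimately have "P \<le> h m + 0"
      by (intro LIMSEQ_le[of "\<lambda>k. ln (Z (N k)) / real (N k)" P]) auto
    then show "P \<le> word_entropy \<nu> m (Suc q) - word_entropy \<nu> m q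
        + (\<Sum>u\<in>words \<nu> (2 * r + 1). m u * F_word r u) + C * \<theta> ^ Suc r"
      by (simp add: h_def)
  qed
qed

end

subsection \<open>Measures with prescribed frequencies\<close>

locale consistent_frequencies =
  fixes \<nu> :: nat and m :: "nat list \<Rightarrow> real"
  assumes m_nonneg: "0 \<le> m u" and m_Nil: "m [] = 1"
    and m_outside: "\<not> set u \<subseteq> {..<\<nu>} \<Longrightarrow> m u = 0"
    and m_snoc: "(\<Sum>a<\<nu>. m (u @ [a])) = m u"
    and m_Cons: "(\<Sum>a<\<nu>. m (a # u)) = m u"
begin

lemma m_not_word: "u \<notin> words \<nu> n \<Longrightarrow> length u = n \<Longrightarrow> m u = 0"
  by (rule m_outside) (simp add: words_def)

lemma length_word: "u \<in> words \<nu> n \<Longrightarrow> length u = n"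
  by (simp add: words_def)

lemma sum_m: "(\<Sum>u\<in>words \<nu> n. m u) = 1"
  by (induction n) (simp_all add: m_Nil sum_words_snoc m_snoc)

definition R :: "nat \<Rightarrow> nat list pmf" where
  "R n = embed_pmf (\<lambda>u. if length u = n then m u else 0)"

lemma pmf_R: "pmf (R n) u = (if length u = n then m u else 0)"
  unfolding R_def
proof (rule pmf_embed_pmf)
  have "(\<integral>\<^sup>+u. ennreal (if length u = n then m u else 0) \<partial>count_space UNIV)
      = (\<Sum>u\<in>words \<nu> n. ennreal (if length u = n then m u else 0))"
    by (rule nn_integral_count_space') (auto simp: m_not_word)
  also have "\<dots> = (\<Sum>u\<in>words \<nu> n. ennreal (m u))"
    by (intro sum.cong refl) (simp add: words_def)
  also have "\<dots> = ennreal 1"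
    by (simp add: m_nonneg sum_m)
  finally show "(\<integral>\<^sup>+u. ennreal (if length u = n then m u else 0) \<partial>count_space UNIV) = 1"
    by simp
qed (simp add: m_nonneg)

lemma set_R: "set_pmf (R n) \<subseteq> words \<nu> n"
  using m_outside by (force simp: set_pmf_eq pmf_R words_def split: if_splits)

lemma length_R: "w \<in> set_pmf (R n) \<Longrightarrow> length w = n"
  using set_R[of n] by (auto simp: words_def)

lemma measure_R: "measure (measure_pmf (R n)) A = (\<Sum>w\<in>words \<nu> n. if w \<in> A then m w else 0)"
proof -
  have "measure (measure_pmf (R n)) A = measure (measure_pmf (R n)) (A \<inter> words \<nu> n)"
    by (rule measure_eq_AE) (use set_R[of n] in \<open>auto simp: AE_measure_pmf_iff\<close>)
  also have "\<dots> = (\<Sum>w\<in>A \<inter> words \<nu> n. pmf (R n) w)"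
    by (rule measure_measure_pmf_finite) simp
  also have "\<dots> = (\<Sum>w\<in>words \<nu> n. if w \<in> A then m w else 0)"
    by (rule sum.mono_neutral_cong_left) (auto simp: pmf_R length_word)
  finally show ?thesis .
qed

lemma map_R_butlast: "map_pmf butlast (R (Suc n)) = R n"
proof (rule pmf_eqI)
  fix u
  have "pmf (map_pmf butlast (R (Suc n))) u = (\<Sum>v\<in>words \<nu> n. \<Sum>a<\<nu>. if v = u then m (v @ [a]) else 0)"
    by (simp add: pmf_map measure_R sum_words_snoc)
  also have "\<dots> = (\<Sum>v\<in>words \<nu> n. if v = u then m u else 0)"
    by (intro sum.cong refl) (auto simp: m_snoc)
  also have "\<dots> = (if u \<in> words \<nu> n then m u else 0)"
    by simp
  also have "\<dots> = pmf (R n) u"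
    by (simp add: pmf_R length_word m_not_word)
  finally show "pmf (map_pmf butlast (R (Suc n))) u = pmf (R n) u" .
qed

lemma map_R_tl: "map_pmf tl (R (Suc n)) = R n"
proof (rule pmf_eqI)
  fix u
  have "pmf (map_pmf tl (R (Suc n))) u = (\<Sum>v\<in>words \<nu> n. \<Sum>a<\<nu>. if v = u then m (a # v) else 0)"
    by (simp add: pmf_map measure_R sum_words_Cons)
  also have "\<dots> = (\<Sum>v\<in>words \<nu> n. if v = u then m u else 0)"
    by (intro sum.cong refl) (auto simp: m_Cons)
  also have "\<dots> = (if u \<in> words \<nu> n then m u else 0)"
    by simp
  also have "\<dots> = pmf (R n) u"
    by (simp add: pmf_R length_word m_not_word)
  finally show "pmf (map_pmf tl (R (Suc n))) u = pmf (R n) u" .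
qed

lemma map_R_take: "map_pmf (take n) (R (n + l)) = R n"
proof (induction l)
  case 0
  have "map_pmf (take n) (R n) = map_pmf (\<lambda>w. w) (R n)"
    by (rule map_pmf_cong[OF refl]) (auto dest: length_R)
  then show ?case by simp
next
  case (Suc l)
  have "map_pmf (take n) (R (n + Suc l)) = map_pmf (\<lambda>w. take n (butlast w)) (R (n + Suc l))"
    by (rule map_pmf_cong[OF refl]) (auto dest: length_R simp: take_butlast)
  also have "\<dots> = map_pmf (take n) (map_pmf butlast (R (Suc (n + l))))"
    by (simp add: map_pmf_comp)
  finally show ?case
    by (simp add: map_R_butlast Suc)
qed

lemma map_R_drop: "map_pmf (drop k) (R (k + n)) = R n"
proof (induction k)
  case (Suc k)
  have "map_pmf (drop (Suc k)) (R (Suc k + n)) = map_pmf (drop k) (map_pmf tl (R (Suc (k + n))))"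
    unfolding map_pmf_comp by (intro map_pmf_cong) (simp_all add: drop_Suc)
  then show ?case
    by (simp add: map_R_tl Suc)
qed (simp add: map_pmf_ident)

text \<open>Consistency at both ends makes the law of a factor independent of its position. This
  yields the projective family below as well as the stationarity of the measure built from
  it.\<close>

lemma map_R_take_drop:
  assumes "k + n \<le> N"
  shows "map_pmf (\<lambda>w. take n (drop k w)) (R N) = R n"
proof -
  obtain l where N: "N = k + (n + l)"
    using assms by (metis add.assoc le_iff_add)
  have "map_pmf (\<lambda>w. take n (drop k w)) (R N) = map_pmf (take n) (map_pmf (drop k) (R (k + (n + l))))"
    by (simp add: map_pmf_comp N)
  then show ?thesis
    by (simp only: map_R_drop map_R_take)
qed

text \<open>The distributions are placed on real sequences because Kolmogorov's theorem is available for
  Polish spaces only and \<^typ>\<open>nat\<close> is not an instance of that class.\<close>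

definition bound :: "int set \<Rightarrow> nat" where
  "bound J = (\<Sum>i\<in>J. nat \<bar>i\<bar>)"

text \<open>A word of length \<open>2 * M + 1\<close> is read as occupying the coordinates
  \<open>- M, ..., M\<close>, hence the offset \<open>M\<close>.\<close>

definition point :: "nat \<Rightarrow> int set \<Rightarrow> nat list \<Rightarrow> int \<Rightarrow> real" where
  "point M J w = (\<lambda>i\<in>J. real (w ! nat (i + int M)))"

definition marginal :: "int set \<Rightarrow> (int \<Rightarrow> real) measure" where
  "marginal J = distr (measure_pmf (R (2 * bound J + 1))) (PiM J (\<lambda>_. borel)) (point (bound J) J)"

lemma bound: "finite J \<Longrightarrow> i \<in> J \<Longrightarrow> \<bar>i\<bar> \<le> int (bound J)"
proof -
  assume "finite J" "i \<in> J"
  then have "nat \<bar>i\<bar> \<le> bound J"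
    unfolding bound_def by (intro member_le_sum) auto
  then show ?thesis by simp
qed

lemma bound_mono: "finite H \<Longrightarrow> J \<subseteq> H \<Longrightarrow> bound J \<le> bound H"
  unfolding bound_def by (intro sum_mono2) auto

lemma point_measurable: "point M J \<in> measure_pmf p \<rightarrow>\<^sub>M PiM J (\<lambda>_. borel)"
  by (simp add: measurable_pmf_measure1 space_PiM point_def)

text \<open>The central part of a word of law \<open>R (2 * M + 1)\<close> has law
  \<open>R (2 * bound J + 1)\<close>. The freedom in \<open>M\<close> lets the marginals of nested
  sets be computed from one and the same word.\<close>

lemma marginal_eq:
  assumes J: "finite J" and M: "bound J \<le> M"
  shows "distr (measure_pmf (R (2 * M + 1))) (PiM J (\<lambda>_. borel)) (point M J) = marginal J"
proof -
  let ?b = "bound J"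
  let ?f = "\<lambda>w. take (2 * ?b + 1) (drop (M - ?b) w)"
  have "marginal J = distr (measure_pmf (map_pmf ?f (R (2 * M + 1)))) (PiM J (\<lambda>_. borel)) (point ?b J)"
    unfolding marginal_def using M by (subst map_R_take_drop) auto
  also have "\<dots> = distr (measure_pmf (R (2 * M + 1))) (PiM J (\<lambda>_. borel)) (point ?b J \<circ> ?f)"
    unfolding map_pmf_rep_eq by (rule distr_distr) (auto simp: space_PiM point_def)
  also have "\<dots> = distr (measure_pmf (R (2 * M + 1))) (PiM J (\<lambda>_. borel)) (point M J)"
  proof (rule distr_cong_AE[OF refl refl])
    show "AE w in measure_pmf (R (2 * M + 1)). (point ?b J \<circ> ?f) w = point M J w"
      unfolding AE_measure_pmf_iff
    proof
      fix w assume "w \<in> set_pmf (R (2 * M + 1))"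
      then have w: "length w = 2 * M + 1"
        by (rule length_R)
      have "?f w ! nat (i + int ?b) = w ! nat (i + int M)" if "i \<in> J" for i
      proof -
        have i: "\<bar>i\<bar> \<le> int ?b"
          by (rule bound[OF J that])
        then have "nat (i + int ?b) < 2 * ?b + 1" "M - ?b + nat (i + int ?b) = nat (i + int M)"
          using M by auto
        then show ?thesis
          using w M by simp
      qed
      then show "(point ?b J \<circ> ?f) w = point M J w"
        by (auto simp: point_def fun_eq_iff restrict_def)
    qed
  qed (auto simp: measurable_pmf_measure1 space_PiM point_def)
  finally show ?thesis ..
qed

lemma projective_marginal: "polish_projective UNIV marginal"
proof (unfold polish_projective_def, rule projective_family.intro)
  fix J H :: "int set" assume JH: "J \<subseteq> H" "finite H" "H \<subseteq> UNIV"
  have J: "finite J"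
    using JH finite_subset by blast
  have "distr (marginal H) (PiM J (\<lambda>_. borel)) (\<lambda>f. restrict f J)
      = distr (measure_pmf (R (2 * bound H + 1))) (PiM J (\<lambda>_. borel)) ((\<lambda>f. restrict f J) \<circ> point (bound H) H)"
    unfolding marginal_def
    by (rule distr_distr[OF measurable_restrict_subset[OF JH(1)] point_measurable])
  also have "(\<lambda>f. restrict f J) \<circ> point (bound H) H = point (bound H) J"
    by (rule ext) (use JH in \<open>simp add: point_def restrict_restrict Int_absorb1\<close>)
  finally have "distr (marginal H) (PiM J (\<lambda>_. borel)) (\<lambda>f. restrict f J) = marginal J"
    unfolding marginal_eq[OF J bound_mono[OF JH(2,1)]] .
  then show "marginal J = distr (marginal H) (PiM J (\<lambda>_. borel)) (\<lambda>f. restrict f J)"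
    by (rule sym)
next
  fix J :: "int set" assume "finite J"
  then show "prob_space (marginal J)"
    unfolding marginal_def by (intro prob_space.prob_space_distr measure_pmf.prob_space_axioms point_measurable)
qed

lemma measure_exists:
  obtains \<mu> where "prob_space \<mu>" "sets \<mu> = sets borel"
    "\<And>k u. measure \<mu> {x. window x k (length u) = u} = m u"
proof -
  interpret polish_projective UNIV marginal
    by (rule projective_marginal)
  \<comment> \<open>Undoes the embedding of the symbols into the reals; on the values produced by
    \<open>point\<close> the floor is exact.\<close>
  define e :: "(int \<Rightarrow> real) \<Rightarrow> int \<Rightarrow> nat" where "e x = (\<lambda>i. nat \<lfloor>x i\<rfloor>)" for x
  define \<mu> where "\<mu> = distr lim borel e"
  have fl: "(\<lambda>t::real. nat \<lfloor>t\<rfloor>) \<in> borel \<rightarrow>\<^sub>M count_space UNIV"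
    by (rule measurable_compose[OF measurable_real_floor]) simp
  have e: "e \<in> lim \<rightarrow>\<^sub>M borel"
  proof (rule measurable_sequence)
    fix i
    have "(\<lambda>x. x i) \<in> lim \<rightarrow>\<^sub>M borel"
      by (simp add: measurable_cong_sets[OF sets_lim refl])
    from measurable_compose[OF this fl] show "(\<lambda>x. e x i) \<in> lim \<rightarrow>\<^sub>M count_space UNIV"
      by (simp add: e_def)
  qed
  have prob: "prob_space \<mu>"
    unfolding \<mu>_def by (rule P.prob_space_distr[OF e])
  have sets: "sets \<mu> = sets borel"
    by (simp add: \<mu>_def)
  have "measure \<mu> {x. window x k (length u) = u} = m u" for k u
  \<comment> \<open>The empty word is separate because its set of coordinates is empty and gives no
    bound on \<open>k\<close>.\<close>
  proof (cases "u = []")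
    case True
    interpret prob_space \<mu> by (rule prob)
    have "space \<mu> = UNIV"
      by (simp add: \<mu>_def)
    with True show ?thesis
      using prob_space by (simp add: m_Nil)
  next
    case False
    define n where "n = length u"
    have n: "0 < n"
      using False by (simp add: n_def)
    define J where "J = {k..<k + int n}"
    have J: "finite J"
      by (simp add: J_def)
    define b where "b = bound J"
    have "k \<in> J" "k + int n - 1 \<in> J"
      using n by (auto simp: J_def)
    then have "\<bar>k\<bar> \<le> int b" "\<bar>k + int n - 1\<bar> \<le> int b"
      unfolding b_def using bound[OF J] by blast+
    then have kb: "0 \<le> k + int b" "nat (k + int b) + n \<le> 2 * b + 1"
      by auto
    define B where "B = {f \<in> space (PiM J (\<lambda>_. borel :: real measure)). \<forall>i\<in>J. nat \<lfloor>f i\<rfloor> = u ! nat (i - k)}"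
    have B: "B \<in> sets (PiM J (\<lambda>_. borel))"
      unfolding B_def
    proof (rule sets.sets_Collect_finite_All[OF _ J])
      fix i assume "i \<in> J"
      have "(\<lambda>f. nat \<lfloor>f i\<rfloor>) \<in> PiM J (\<lambda>_. borel :: real measure) \<rightarrow>\<^sub>M count_space UNIV"
        by (rule measurable_compose[OF measurable_component_singleton[OF \<open>i \<in> J\<close>, of "\<lambda>_. borel"] fl])
      from measurable_sets[OF this, of "{u ! nat (i - k)}"]
      show "{f \<in> space (PiM J (\<lambda>_. borel :: real measure)). nat \<lfloor>f i\<rfloor> = u ! nat (i - k)} \<in> sets (PiM J (\<lambda>_. borel))"
        by (simp add: vimage_def Int_def conj_commute)
    qed
    have win: "window y k n = u \<longleftrightarrow> (\<forall>i\<in>J. y i = u ! nat (i - k))" for y :: "int \<Rightarrow> nat"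
    proof -
      have "window y k n = u \<longleftrightarrow> (\<forall>i<n. y (k + int i) = u ! i)"
        by (auto simp: list_eq_iff_nth_eq n_def)
      also have "\<dots> \<longleftrightarrow> (\<forall>i\<in>J. y i = u ! nat (i - k))"
      proof
        assume *: "\<forall>i<n. y (k + int i) = u ! i"
        show "\<forall>i\<in>J. y i = u ! nat (i - k)"
        proof
          fix i assume "i \<in> J"
          then have "nat (i - k) < n" "k + int (nat (i - k)) = i"
            by (auto simp: J_def)
          with * show "y i = u ! nat (i - k)"
            by metis
        qed
      next
        assume *: "\<forall>i\<in>J. y i = u ! nat (i - k)"
        show "\<forall>i<n. y (k + int i) = u ! i"
          using * by (auto simp: J_def dest: bspec[of _ _ "k + int _"])
      qed
      finally show ?thesis .
    qed
    have meas: "{x. window x k n = u} \<in> sets (borel :: (int \<Rightarrow> nat) measure)"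
    proof -
      have "{x. window x k n = u} = (\<lambda>x. window x k n) -` {u} \<inter> space (borel :: (int \<Rightarrow> nat) measure)"
        by auto
      also have "\<dots> \<in> sets (borel :: (int \<Rightarrow> nat) measure)"
        by (rule measurable_sets[OF window_measurable]) simp
      finally show ?thesis .
    qed
    have "measure \<mu> {x. window x k n = u} = measure lim (e -` {x. window x k n = u} \<inter> space lim)"
      unfolding \<mu>_def by (rule measure_distr[OF e meas])
    also have "e -` {x. window x k n = u} \<inter> space lim = emb UNIV J B"
      by (auto simp: win e_def B_def prod_emb_def space_PiM)
    also have "measure lim (emb UNIV J B) = measure (marginal J) B"
      by (rule measure_lim_emb) (use J B in auto)
    also have "\<dots> = measure (measure_pmf (R (2 * b + 1))) (point b J -` B \<inter> space (measure_pmf (R (2 * b + 1))))"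
      unfolding marginal_def b_def by (rule measure_distr[OF point_measurable B])
    also have "\<dots> = measure (measure_pmf (R (2 * b + 1))) ((\<lambda>w. take n (drop (nat (k + int b)) w)) -` {u})"
    proof (rule measure_eq_AE)
      show "AE w in measure_pmf (R (2 * b + 1)). w \<in> point b J -` B \<inter> space (measure_pmf (R (2 * b + 1)))
          \<longleftrightarrow> w \<in> (\<lambda>w. take n (drop (nat (k + int b)) w)) -` {u}"
        unfolding AE_measure_pmf_iff
      proof
        fix w assume "w \<in> set_pmf (R (2 * b + 1))"
        then have w: "length w = 2 * b + 1"
          by (rule length_R)
        define y where "y i = w ! nat (i + int b)" for i
        have "take n (drop (nat (k + int b)) w) = window y k n"
        proof (rule nth_equalityI)
          fix i assume "i < length (take n (drop (nat (k + int b)) w))"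
          then have i: "i < n"
            by simp
          have "nat (k + int i + int b) = nat (k + int b) + i"
            using kb(1) by linarith
          with i w kb show "take n (drop (nat (k + int b)) w) ! i = window y k n ! i"
            by (simp add: y_def)
        qed (use w kb in simp)
        moreover have "point b J w \<in> B \<longleftrightarrow> (\<forall>i\<in>J. y i = u ! nat (i - k))"
          by (auto simp: B_def point_def y_def space_PiM)
        ultimately show "w \<in> point b J -` B \<inter> space (measure_pmf (R (2 * b + 1)))
          \<longleftrightarrow> w \<in> (\<lambda>w. take n (drop (nat (k + int b)) w)) -` {u}"
          by (simp add: win)
      qed
    qed auto
    also have "\<dots> = pmf (map_pmf (\<lambda>w. take n (drop (nat (k + int b)) w)) (R (2 * b + 1))) u"
      by (simp add: pmf_map)
    also have "\<dots> = m u"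
      using kb by (subst map_R_take_drop) (auto simp: pmf_R n_def)
    finally show ?thesis
      by (simp add: n_def)
  qed
  then show thesis
    using that prob sets by blast
qed

end

subsection \<open>Existence of an equilibrium state on the full shift\<close>

locale measure_with_frequencies = consistent_frequencies \<nu> m + sequence_measure \<mu>
  for \<nu> :: nat and m :: "nat list \<Rightarrow> real" and \<mu> :: "(int \<Rightarrow> nat) measure" +
  assumes frequencies: "prob {x. window x k (length u) = u} = m u"
begin

lemma window_set_measurable: "{x. window x k n \<in> V} \<in> sets \<mu>"
proof -
  have "{x. window x k n \<in> V} = (\<lambda>x. window x k n) -` V \<inter> space (borel :: (int \<Rightarrow> nat) measure)"
    by auto
  also have "\<dots> \<in> sets (borel :: (int \<Rightarrow> nat) measure)"
    by (rule measurable_sets[OF window_measurable]) simp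
  finally show ?thesis
    by (simp add: sets_\<mu>)
qed

lemma prob_window_finite:
  assumes "V \<subseteq> words \<nu> n"
  shows "prob {x. window x k n \<in> V} = (\<Sum>u\<in>V. m u)"
proof -
  have "{x. window x k n \<in> V} = (\<Union>u\<in>V. {x. window x k n = u})"
    by blast
  also have "prob \<dots> = (\<Sum>u\<in>V. prob {x. window x k n = u})"
  proof (rule finite_measure_finite_Union)
    show "finite V"
      using assms finite_words finite_subset by blast
    show "(\<lambda>u. {x. window x k n = u}) ` V \<subseteq> sets \<mu>"
      using window_set_measurable[of k n "{_}"] by auto
  qed (auto simp: disjoint_family_on_def)
  also have "\<dots> = (\<Sum>u\<in>V. m u)"
  proof (rule sum.cong[OF refl])
    fix u assume "u \<in> V"
    then have "length u = n"
      using assms by (auto simp: words_def)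
    then show "prob {x. window x k n = u} = m u"
      using frequencies[of k u] by simp
  qed
  finally show ?thesis .
qed

lemma AE_window_word: "AE x in \<mu>. window x k n \<in> words \<nu> n"
proof -
  have "prob {x. window x k n \<in> words \<nu> n} = 1"
    by (simp add: prob_window_finite sum_m)
  then show ?thesis
    by (simp add: prob_eq_1[OF window_set_measurable])
qed

text \<open>The value does not involve \<open>k\<close>: on cylinder sets this is already
  translation invariance.\<close>

lemma prob_window: "prob {x. window x k n \<in> U} = (\<Sum>u\<in>U \<inter> words \<nu> n. m u)"
proof -
  have "prob {x. window x k n \<in> U} = prob {x. window x k n \<in> U \<inter> words \<nu> n}"
    by (rule measure_eq_AE) (use AE_window_word[of k n] in \<open>auto intro: window_set_measurable\<close>)
  also have "\<dots> = (\<Sum>u\<in>U \<inter> words \<nu> n. m u)"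
    by (rule prob_window_finite) simp
  finally show ?thesis .
qed

lemma AE_symbols: "AE x in \<mu>. \<forall>i. x i < \<nu>"
proof (rule AE_all_countable[THEN iffD2], rule allI)
  fix i
  show "AE x in \<mu>. x i < \<nu>"
    using AE_window_word[of i 1] by eventually_elim (simp add: words_def window_def)
qed

lemma translation_invariant: "distr \<mu> \<mu> (translate t) = \<mu>"
proof (rule measure_eqI_generator_eq[where \<Omega> = UNIV and E = "{A. \<exists>N. determined N A}" and A = "\<lambda>_. UNIV"])
  have tm: "translate t \<in> \<mu> \<rightarrow>\<^sub>M \<mu>"
    using translate_measurable[of t] measurable_cong_sets[OF sets_\<mu> sets_\<mu>] by simp
  show "Int_stable {A. \<exists>N. determined N A}"
  proof (rule Int_stableI)
    fix A B assume "A \<in> {A. \<exists>N. determined N A}" "B \<in> {A. \<exists>N. determined N A}"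
    then obtain N N' where "determined N A" "determined N' B"
      by blast
    then have "determined (max N N') A" "determined (max N N') B"
      by (auto intro: determined_mono)
    then have "determined (max N N') (A \<inter> B)"
      unfolding determined_def by blast
    then show "A \<inter> B \<in> {A. \<exists>N. determined N A}"
      by blast
  qed
  fix B assume "B \<in> {A. \<exists>N. determined N A}"
  then obtain N where N: "determined N B"
    by blast
  define U where "U = (\<lambda>x. central x N) ` B"
  have B: "x \<in> B \<longleftrightarrow> central x N \<in> U" for x
  proof
    assume "central x N \<in> U"
    then obtain b where "b \<in> B" "central b N = central x N"
      by (auto simp: U_def)
    with N show "x \<in> B"
      unfolding determined_def by blast
  qed (simp add: U_def)
  have "B \<in> sets \<mu>"
    using determined_measurable[OF N] by (simp add: sets_\<mu>)
  then have "emeasure (distr \<mu> \<mu> (translate t)) B = emeasure \<mu> (translate t -` B \<inter> space \<mu>)"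
    by (rule emeasure_distr[OF tm])
  also have "translate t -` B \<inter> space \<mu> = {x. window x (- int N + t) (2 * N + 1) \<in> U}"
    by (auto simp: B central_def)
  also have "emeasure \<mu> \<dots> = emeasure \<mu> {x. window x (- int N) (2 * N + 1) \<in> U}"
    by (simp add: emeasure_eq_measure prob_window)
  also have "{x. window x (- int N) (2 * N + 1) \<in> U} = B"
    by (auto simp: B central_def)
  finally show "emeasure (distr \<mu> \<mu> (translate t)) B = emeasure \<mu> B" .
next
  show "sets (distr \<mu> \<mu> (translate t)) = sigma_sets UNIV {A. \<exists>N. determined N A}"
    "sets \<mu> = sigma_sets UNIV {A. \<exists>N. determined N A}"
    by (simp_all add: sets_\<mu> sets_borel_determined)
  show "range (\<lambda>_. UNIV) \<subseteq> {A. \<exists>N. determined N A}"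
    by (auto simp: determined_def)
  have "prob_space (distr \<mu> \<mu> (translate t))"
    using translate_measurable[of t] measurable_cong_sets[OF sets_\<mu> sets_\<mu>] by (intro prob_space_distr) simp
  then have "finite_measure (distr \<mu> \<mu> (translate t))"
    by (rule prob_space.axioms(1))
  then show "emeasure (distr \<mu> \<mu> (translate t)) UNIV \<noteq> \<infinity>"
    using finite_measure.emeasure_finite by auto
qed auto

end

text \<open>As \<open>r\<close> grows, the limit inequality bounds each increment
  \<open>word_entropy \<nu> m (Suc q) - word_entropy \<nu> m q\<close> from below by
  \<open>P\<close> minus the integral of \<open>F\<close>. The increments add up to the entropy of
  words of length \<open>n\<close>.\<close>

lemma (in full_shift) equilibrium_measure_exists:
  obtains \<mu> where "invariant_sequence_measure \<nu> F C \<theta> \<mu>"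
    "\<forall>n. real n * (P - (\<integral>x. F x \<partial>\<mu>)) \<le> rv_entropy \<mu> (\<lambda>x. window (\<lambda>i. x i mod \<nu>) 0 n)"
proof -
  obtain m where m: "\<And>u. 0 \<le> m u" "m [] = 1" "\<And>u. \<not> set u \<subseteq> {..<\<nu>} \<Longrightarrow> m u = 0"
    "\<And>u. (\<Sum>a<\<nu>. m (u @ [a])) = m u" "\<And>u. (\<Sum>a<\<nu>. m (a # u)) = m u"
    and le: "\<And>q r. P \<le> word_entropy \<nu> m (Suc q) - word_entropy \<nu> m q
        + (\<Sum>u\<in>words \<nu> (2 * r + 1). m u * F_word r u) + C * \<theta> ^ Suc r"
    using limit_frequencies by blast
  interpret consistent_frequencies \<nu> m
    by unfold_locales (rule m, assumption?)+
  obtain \<mu> where \<mu>: "prob_space \<mu>" "sets \<mu> = sets borel"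
    "\<And>k u. measure \<mu> {x. window x k (length u) = u} = m u"
    using measure_exists by blast
  interpret prob_space \<mu> by (rule \<mu>)
  interpret measure_with_frequencies \<nu> m \<mu>
    by unfold_locales (rule \<mu>)+
  interpret invariant_sequence_measure \<nu> F C \<theta> \<mu>
    by unfold_locales (rule translation_invariant AE_symbols)+
  have prob_reduce: "prob {x \<in> space \<mu>. window (reduce x) k n = u} = m u" if u: "u \<in> words \<nu> n" for u k n
  proof -
    have "prob {x \<in> space \<mu>. window (reduce x) k n = u} = prob {x. window x k n \<in> {u}}"
    proof (rule measure_eq_AE)
      show "AE x in \<mu>. x \<in> {x \<in> space \<mu>. window (reduce x) k n = u} \<longleftrightarrow> x \<in> {x. window x k n \<in> {u}}"
        using symbols by eventually_elim simp
    qed (auto intro: window_set_measurable[of _ _ "{_}", simplified] prob_event_meas[OF window_reduce_measurable, simplified])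
    also have "\<dots> = m u"
      using u by (simp only: prob_window) simp
    finally show ?thesis .
  qed
  have entropy: "rv_entropy \<mu> (\<lambda>x. window (reduce x) 0 n) = word_entropy \<nu> m n" for n
    unfolding rv_entropy_eq_sum[OF window_reduce_measurable finite_words] word_entropy_def
    by (intro arg_cong[where f = uminus] sum.cong refl) (simp only: prob_reduce)
  have integral: "(\<Sum>u\<in>words \<nu> (2 * r + 1). m u * F_word r u) \<le> (\<integral>x. F x \<partial>\<mu>) + C * \<theta> ^ Suc r" for r
  proof -
    note V = window_reduce_measurable[of "- int r" "2 * r + 1"]
    have "(\<Sum>u\<in>words \<nu> (2 * r + 1). m u * F_word r u) = (\<integral>x. F_word r (window (reduce x) (- int r) (2 * r + 1)) \<partial>\<mu>)"
      unfolding finite_rv_integral(2)[OF V finite_words] by (intro sum.cong refl) (simp only: prob_reduce)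
    also have "\<dots> \<le> (\<integral>x. F x + C * \<theta> ^ Suc r \<partial>\<mu>)"
    proof (rule integral_mono[OF finite_rv_integral(1)[OF V finite_words]])
      fix x
      show "F_word r (window (reduce x) (- int r) (2 * r + 1)) \<le> F x + C * \<theta> ^ Suc r"
        using F_word_close[of "reduce x" r] unfolding F_mod central_def by linarith
    qed (simp add: F_integrable)
    also have "\<dots> = (\<integral>x. F x \<partial>\<mu>) + C * \<theta> ^ Suc r"
      by (simp add: F_integrable)
    finally show ?thesis .
  qed
  have step: "P - (\<integral>x. F x \<partial>\<mu>) \<le> word_entropy \<nu> m (Suc q) - word_entropy \<nu> m q" for q
  proof -
    have "(\<lambda>r. \<theta> ^ Suc r) \<longlonglongrightarrow> 0"
      using C_bounds by (intro LIMSEQ_Suc LIMSEQ_power_zero) auto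
    then have "(\<lambda>r. word_entropy \<nu> m (Suc q) - word_entropy \<nu> m q + 2 * C * \<theta> ^ Suc r)
        \<longlonglongrightarrow> word_entropy \<nu> m (Suc q) - word_entropy \<nu> m q + 2 * C * 0"
      by (intro tendsto_intros)
    moreover have "P - (\<integral>x. F x \<partial>\<mu>) \<le> word_entropy \<nu> m (Suc q) - word_entropy \<nu> m q + 2 * C * \<theta> ^ Suc r" for r
      using le[of q r] integral[of r] by linarith
    ultimately have "P - (\<integral>x. F x \<partial>\<mu>) \<le> word_entropy \<nu> m (Suc q) - word_entropy \<nu> m q + 2 * C * 0"
      by (intro LIMSEQ_le_const) auto
    then show ?thesis by simp
  qed
  have "real n * (P - (\<integral>x. F x \<partial>\<mu>)) \<le> word_entropy \<nu> m n" for n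
  proof (induction n)
    case 0
    show ?case
      by (simp add: word_entropy_def m(2))
  next
    case (Suc n)
    with step[of n] show ?case
      by (simp add: algebra_simps)
  qed
  then have "\<forall>n. real n * (P - (\<integral>x. F x \<partial>\<mu>)) \<le> rv_entropy \<mu> (\<lambda>x. window (\<lambda>i. x i mod \<nu>) 0 n)"
    unfolding entropy by blast
  then show thesis
    by (rule that[OF invariant_sequence_measure_axioms])
qed

subsection \<open>Equilibrium states on the coloured shift\<close>

lemma rv_entropy_distr:
  assumes e: "e \<in> M \<rightarrow>\<^sub>M N" and Y: "Y \<in> N \<rightarrow>\<^sub>M count_space S" and S: "finite S" and M: "prob_space M"
  shows "rv_entropy (distr M N e) Y = rv_entropy M (\<lambda>x. Y (e x))"
proof -
  interpret M: prob_space M by (rule M)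
  interpret D: prob_space "distr M N e"
    by (rule M.prob_space_distr[OF e])
  have Y': "Y \<in> distr M N e \<rightarrow>\<^sub>M count_space S"
    using Y by simp
  have p: "measure (distr M N e) {y \<in> space (distr M N e). Y y = s} = measure M {x \<in> space M. Y (e x) = s}" for s
  proof -
    have "measure (distr M N e) {y \<in> space (distr M N e). Y y = s}
        = measure M (e -` {y \<in> space (distr M N e). Y y = s} \<inter> space M)"
      by (rule measure_distr[OF e]) (use D.prob_event_meas[OF Y', of s] in simp)
    also have "e -` {y \<in> space (distr M N e). Y y = s} \<inter> space M = {x \<in> space M. Y (e x) = s}"
      using measurable_space[OF e] by auto
    finally show ?thesis .
  qed
  show ?thesis
    unfolding D.rv_entropy_eq_sum[OF Y' S] M.rv_entropy_eq_sum[OF measurable_compose[OF e Y] S] p ..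
qed

lemma measurable_recolour: "recolour \<nu> j \<in> borel \<rightarrow>\<^sub>M borel"
proof (rule measurable_sequence)
  fix i
  show "(\<lambda>x. recolour \<nu> j x i) \<in> borel \<rightarrow>\<^sub>M count_space UNIV"
    unfolding recolour_apply by (rule measurable_compose[OF coordinate_measurable[of i]]) simp
qed

locale coloured_state = coloured_system + invariant_sequence_measure \<nu> F C \<theta> \<mu>
  for \<mu> :: "(int \<Rightarrow> nat) measure" +
  assumes entropy_ge: "real n * (P - (\<integral>x. F x \<partial>\<mu>)) \<le> rv_entropy \<mu> (\<lambda>x. window (\<lambda>i. x i mod \<nu>) 0 n)"
begin

abbreviation BX :: "(int \<Rightarrow> nat) measure" where
  "BX \<equiv> restrict_space borel X"

definition state :: "nat \<Rightarrow> (int \<Rightarrow> nat) measure" where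
  "state j = distr \<mu> BX (recolour \<nu> j)"

context
  fixes j assumes j: "j \<in> {1..L}"
begin

lemma recolour_measurable: "recolour \<nu> j \<in> \<mu> \<rightarrow>\<^sub>M BX"
proof (rule measurable_restrict_space2)
  show "recolour \<nu> j \<in> \<mu> \<rightarrow>\<^sub>M borel"
    using measurable_recolour measurable_cong_sets[OF sets_\<mu> refl] by blast
qed (use recolour_in_X[OF j] in simp)

lemma shift_recolour: "shift (recolour \<nu> j x) = recolour \<nu> j (shift x)"
  by (simp only: shift_eq_translate translate_recolour)

lemma shift_funpow_recolour: "(shift ^^ i) (recolour \<nu> j x) = recolour \<nu> j ((shift ^^ i) x)"
  by (simp only: shift_funpow translate_recolour)

lemma prob_space_state: "prob_space (state j)"
  unfolding state_def by (rule prob_space_distr[OF recolour_measurable])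

lemma space_state [simp]: "space (state j) = X" and sets_state [simp]: "sets (state j) = sets BX"
  by (simp_all add: state_def space_restrict_space)

lemma shift_measurable_state: "shift \<in> state j \<rightarrow>\<^sub>M state j"
proof -
  have "shift \<in> BX \<rightarrow>\<^sub>M BX"
  proof (rule measurable_restrict_space2)
    have "translate 1 \<in> BX \<rightarrow>\<^sub>M borel"
      by (rule measurable_restrict_space1) (rule translate_measurable)
    then show "shift \<in> BX \<rightarrow>\<^sub>M borel"
      by (simp add: shift_eq_translate[abs_def])
  qed (use translate_coloured_shift in \<open>auto simp: space_restrict_space shift_eq_translate\<close>)
  then show ?thesis
    by (simp add: state_def)
qed

lemma shift_invariant_state: "distr (state j) (state j) shift = state j"
proof -
  have "distr (state j) (state j) shift = distr (distr \<mu> BX (recolour \<nu> j)) BX shift"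
    unfolding state_def by (rule distr_cong) simp_all
  also have "\<dots> = distr \<mu> BX (shift \<circ> recolour \<nu> j)"
    using shift_measurable_state by (intro distr_distr recolour_measurable) (simp add: state_def)
  also have "shift \<circ> recolour \<nu> j = recolour \<nu> j \<circ> shift"
    by (simp add: fun_eq_iff shift_recolour del: translate_apply)
  also have "distr \<mu> BX (recolour \<nu> j \<circ> shift) = distr (distr \<mu> \<mu> shift) BX (recolour \<nu> j)"
    by (rule distr_distr[symmetric, OF recolour_measurable shift_measurable_\<mu>])
  finally show ?thesis
    by (simp only: shift_invariant state_def)
qed

lemma g_measurable: "g \<in> borel_measurable BX"
  by (rule borel_measurable_continuous_on_restrict[OF locally_holder_continuous[OF g_hol]])

lemma integral_g: "integrable (state j) g" "(\<integral>x. g x \<partial>state j) = (\<integral>x. F x \<partial>\<mu>)"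
  unfolding state_def
  by (simp_all add: integrable_distr_eq[OF recolour_measurable g_measurable]
      integral_distr[OF recolour_measurable g_measurable] g_recolour[OF j] F_integrable)

text \<open>The map \<open>recolour \<nu> j\<close> commutes with the shift, so a partition of
  \<open>X\<close> becomes a finite-valued function on the full shift with the same entropies, to
  which the variational inequality applies.\<close>

lemma partition_entropy_pullback:
  assumes \<P>: "finite_partition (state j) \<P>"
  shows "(\<lambda>x. part_of \<P> (recolour \<nu> j x)) \<in> \<mu> \<rightarrow>\<^sub>M count_space \<P>"
    and "partition_entropy (state j) (iterated_join (state j) shift \<P> n)
      = rv_entropy \<mu> (names shift (\<lambda>x. part_of \<P> (recolour \<nu> j x)) n)"
proof -
  interpret S: prob_space "state j" by (rule prob_space_state)
  have fin: "finite \<P>"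
    using \<P> by (simp add: finite_partition_def)
  have e: "recolour \<nu> j \<in> \<mu> \<rightarrow>\<^sub>M state j"
    using recolour_measurable by (simp add: state_def)
  show "(\<lambda>x. part_of \<P> (recolour \<nu> j x)) \<in> \<mu> \<rightarrow>\<^sub>M count_space \<P>"
    by (rule measurable_compose[OF e part_of_measurable[OF \<P>]])
  have N: "names shift (part_of \<P>) n \<in> state j \<rightarrow>\<^sub>M count_space (PiE {..<n} (\<lambda>_. \<P>))"
    by (rule names_measurable[OF part_of_measurable[OF \<P>] fin shift_measurable_state])
  have "rv_entropy (state j) (names shift (part_of \<P>) n) = rv_entropy \<mu> (\<lambda>x. names shift (part_of \<P>) n (recolour \<nu> j x))"
    using N rv_entropy_distr[OF recolour_measurable _ finite_PiE_const[OF fin] prob_space_axioms]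
    by (simp add: state_def)
  also have "(\<lambda>x. names shift (part_of \<P>) n (recolour \<nu> j x)) = names shift (\<lambda>x. part_of \<P> (recolour \<nu> j x)) n"
    by (simp add: names_def fun_eq_iff shift_funpow_recolour)
  finally show "partition_entropy (state j) (iterated_join (state j) shift \<P> n)
      = rv_entropy \<mu> (names shift (\<lambda>x. part_of \<P> (recolour \<nu> j x)) n)"
    using S.partition_entropy_iterated_join[OF \<P> shift_measurable_state] by simp
qed

lemma partition_entropy_lim:
  assumes \<P>: "finite_partition (state j) \<P>"
  obtains l where "(\<lambda>n. partition_entropy (state j) (iterated_join (state j) shift \<P> n) / real n) \<longlonglongrightarrow> l"
    "l \<le> P - (\<integral>x. F x \<partial>\<mu>)"
proof -
  have fin: "finite \<P>"
    using \<P> by (simp add: finite_partition_def)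
  obtain l where "(\<lambda>n. rv_entropy \<mu> (names shift (\<lambda>x. part_of \<P> (recolour \<nu> j x)) n) / real n) \<longlonglongrightarrow> l"
    by (rule rv_entropy_names_limit[OF partition_entropy_pullback(1)[OF \<P>] fin shift_measurable_\<mu> shift_invariant])
  with entropy_le[OF partition_entropy_pullback(1)[OF \<P>] fin this] show thesis
    using that by (simp only: partition_entropy_pullback(2)[OF \<P>])
qed

text \<open>The symbol \<open>a\<close> runs only over those that occur, since a partition has no
  empty member.\<close>

definition symbol_partition :: "(int \<Rightarrow> nat) set set" where
  "symbol_partition = {{x \<in> X. x 0 = a} | a. a \<in> (\<lambda>x. x 0) ` X}"

lemma finite_partition_symbol: "finite_partition (state j) symbol_partition"
  unfolding finite_partition_def
proof (intro conjI subsetI)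
  have "(\<lambda>x. x 0) ` X \<subseteq> {..L * \<nu>}"
    by (auto simp: coloured_shift_def)
  then have "finite ((\<lambda>x. x 0) ` X)"
    by (rule finite_subset) simp
  moreover have "symbol_partition = (\<lambda>a. {x \<in> X. x 0 = a}) ` (\<lambda>x. x 0) ` X"
    by (auto simp: symbol_partition_def)
  ultimately show "finite symbol_partition"
    by simp
  show "A \<in> sets (state j)" if A_in: "A \<in> symbol_partition" for A
  proof -
    obtain a where A: "A = {x \<in> X. x 0 = a}"
      using A_in unfolding symbol_partition_def by blast
    have "(\<lambda>x::int \<Rightarrow> nat. x 0) -` {a} \<inter> space borel \<in> sets borel"
      by (rule measurable_sets[OF coordinate_measurable]) simp
    moreover have "A = X \<inter> ((\<lambda>x. x 0) -` {a} \<inter> space borel)"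
      by (auto simp: A)
    ultimately show ?thesis
      by (auto simp: sets_restrict_space)
  qed
  show "partition_on (space (state j)) symbol_partition"
    unfolding space_state by (rule partition_onI) (auto simp: symbol_partition_def disjnt_def)
qed

text \<open>After recolouring, the symbol at 0 and \<open>x 0 mod \<nu>\<close> determine each
  other, so the names carry the same information as the reduced windows in
  \<open>entropy_ge\<close>. This one partition thus attains the upper bound on the entropy.\<close>

lemma symbol_partition_lim:
  "P - (\<integral>x. F x \<partial>\<mu>) \<le> lim (\<lambda>n. partition_entropy (state j) (iterated_join (state j) shift symbol_partition n) / real n)"
proof -
  define \<phi> where "\<phi> x = part_of symbol_partition (recolour \<nu> j x)" for x
  have part: "partition_on X symbol_partition"
    using finite_partition_symbol by (simp add: finite_partition_def)
  have \<phi>: "\<phi> x = {y \<in> X. y 0 = recolour \<nu> j x 0}" for x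
  proof -
    have "{y \<in> X. y 0 = recolour \<nu> j x 0} \<in> symbol_partition"
      unfolding symbol_partition_def using recolour_in_X[OF j] by blast
    moreover have "recolour \<nu> j x \<in> {y \<in> X. y 0 = recolour \<nu> j x 0}"
      using recolour_in_X[OF j] by simp
    ultimately show ?thesis
      unfolding \<phi>_def using part_of(3)[OF part recolour_in_X[OF j]] by blast
  qed
  have \<phi>_eq: "\<phi> x = \<phi> y \<longleftrightarrow> x 0 mod \<nu> = y 0 mod \<nu>" for x y
  proof
    assume "\<phi> x = \<phi> y"
    then have "recolour \<nu> j x \<in> \<phi> y"
      using recolour_in_X[OF j] unfolding \<phi>[of x, symmetric] by (metis (mono_tags, lifting) \<phi> mem_Collect_eq)
    then show "x 0 mod \<nu> = y 0 mod \<nu>"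
      unfolding \<phi> by (simp add: recolour_apply)
  qed (simp add: \<phi> recolour_apply)
  have entropy: "rv_entropy \<mu> (names shift \<phi> n) = rv_entropy \<mu> (\<lambda>x. window (reduce x) 0 n)" for n
    by (rule rv_entropy_cong) (simp add: names_eq_iff \<phi>_eq shift_funpow window_eq_iff)
  obtain l where l: "(\<lambda>n. partition_entropy (state j) (iterated_join (state j) shift symbol_partition n) / real n) \<longlonglongrightarrow> l"
    using partition_entropy_lim[OF finite_partition_symbol] by blast
  have "P - (\<integral>x. F x \<partial>\<mu>) \<le> l"
  proof (rule LIMSEQ_le_const[OF l], rule exI[of _ 1], intro allI impI)
    fix n :: nat assume "1 \<le> n"
    then show "P - (\<integral>x. F x \<partial>\<mu>)
        \<le> partition_entropy (state j) (iterated_join (state j) shift symbol_partition n) / real n"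
      using entropy_ge[of n] unfolding partition_entropy_pullback(2)[OF finite_partition_symbol] \<phi>_def[symmetric] entropy
      by (simp add: field_simps)
  qed
  with limI[OF l] show ?thesis
    by simp
qed

lemma metric_entropy_state: "metric_entropy (state j) shift = ereal (P - (\<integral>x. F x \<partial>\<mu>))"
  unfolding metric_entropy_def
proof (rule antisym)
  show "(SUP \<P>\<in>{\<P>. finite_partition (state j) \<P>}.
        ereal (lim (\<lambda>n. partition_entropy (state j) (iterated_join (state j) shift \<P> n) / real n)))
      \<le> ereal (P - (\<integral>x. F x \<partial>\<mu>))"
  proof (rule SUP_least)
    fix \<P> assume "\<P> \<in> {\<P>. finite_partition (state j) \<P>}"
    then obtain l where l: "(\<lambda>n. partition_entropy (state j) (iterated_join (state j) shift \<P> n) / real n) \<longlonglongrightarrow> l"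
      "l \<le> P - (\<integral>x. F x \<partial>\<mu>)"
      using partition_entropy_lim by blast
    from l(2) show "ereal (lim (\<lambda>n. partition_entropy (state j) (iterated_join (state j) shift \<P> n) / real n))
        \<le> ereal (P - (\<integral>x. F x \<partial>\<mu>))"
      unfolding limI[OF l(1)] by simp
  qed
  show "ereal (P - (\<integral>x. F x \<partial>\<mu>)) \<le> (SUP \<P>\<in>{\<P>. finite_partition (state j) \<P>}.
        ereal (lim (\<lambda>n. partition_entropy (state j) (iterated_join (state j) shift \<P> n) / real n)))"
    by (rule SUP_upper2[of symbol_partition]) (use finite_partition_symbol symbol_partition_lim in auto)
qed

lemma equilibrium_state_state:
  assumes "pressure X g = P"
  shows "equilibrium_state X g (state j)"
  unfolding equilibrium_state_def invariant_measure_def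
  using prob_space_state shift_measurable_state shift_invariant_state integral_g metric_entropy_state assms
  by simp

end

text \<open>The colour of the symbol at coordinate 0 separates the two measures.\<close>

lemma mutually_singular_states:
  assumes j: "j \<in> {1..L}" and k: "k \<in> {1..L}" and jk: "j \<noteq> k"
  shows "mutually_singular (state j) (state k)"
proof -
  define A where "A = {x \<in> X. x 0 \<in> colour_symbols \<nu> k}"
  have "(\<lambda>x::int \<Rightarrow> nat. x 0) -` colour_symbols \<nu> k \<inter> space borel \<in> sets borel"
    by (rule measurable_sets[OF coordinate_measurable]) simp
  moreover have "A = X \<inter> ((\<lambda>x. x 0) -` colour_symbols \<nu> k \<inter> space borel)"
    by (auto simp: A_def)
  ultimately have A: "A \<in> sets BX"
    by (auto simp: sets_restrict_space)
  have colour: "recolour \<nu> i x 0 \<in> colour_symbols \<nu> i" if "i \<in> {1..L}" for i x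
    using recolour_in_mono_shift[OF \<nu>_pos, of i x] that by (simp add: mono_shift_def)
  have "recolour \<nu> j x \<notin> A" for x
    using colour_symbols_unique[of "recolour \<nu> j x 0" \<nu> j k] colour[OF j, of x] j k jk by (auto simp: A_def)
  then have "recolour \<nu> j -` A \<inter> space \<mu> = {}"
    by blast
  then have "emeasure (state j) A = 0"
    unfolding state_def by (simp add: emeasure_distr[OF recolour_measurable[OF j] A])
  moreover have "recolour \<nu> k x \<in> A" for x
    using colour[OF k] recolour_in_X[OF k] by (simp add: A_def)
  then have "recolour \<nu> k -` (X - A) \<inter> space \<mu> = {}"
    by blast
  moreover have "X - A \<in> sets BX"
    using A sets.compl_sets[of A BX] by (simp add: space_restrict_space)
  ultimately have "emeasure (state j) A = 0" "emeasure (state k) (X - A) = 0"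
    unfolding state_def by (simp_all add: emeasure_distr[OF recolour_measurable[OF k]])
  with A show ?thesis
    unfolding mutually_singular_def sets_state[OF j] sets_state[OF k] space_state[OF k] by blast
qed

end

theorem lemma4:
  fixes L \<nu> :: nat and \<tau> :: real and f g :: "(int \<Rightarrow> nat) \<Rightarrow> real"
  assumes "L \<ge> 2" and "\<nu> \<ge> 3" and "\<tau> > 0"
    and "holder_continuous (mono_shift \<nu> 1) f"
    and "pressure (mono_shift \<nu> 1) f > (SUP x\<in>mono_shift \<nu> 1. f x) + ln 2"
    and "colour_extension L \<nu> \<tau> f g"
    and "\<tau> \<ge> ln (5 * real \<nu>) / (pressure (mono_shift \<nu> 1) f - (SUP x\<in>mono_shift \<nu> 1. f x)) - 1"
  shows "\<exists>\<mu> :: nat \<Rightarrow> (int \<Rightarrow> nat) measure.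
           (\<forall>j\<in>{1..L}. equilibrium_state (coloured_shift L \<nu> \<tau>) g (\<mu> j)) \<and>
           (\<forall>j\<in>{1..L}. \<forall>k\<in>{1..L}. j \<noteq> k \<longrightarrow> mutually_singular (\<mu> j) (\<mu> k))"
proof -
  obtain C \<theta> where hol: "locally_holder (mono_shift \<nu> 1) f C \<theta>"
    using holder_imp_locally_holder[OF assms(4)] by blast
  interpret coloured_system L \<nu> \<tau> f g C \<theta>
    using assms(1,2) hol assms(6) by unfold_locales auto
  have sup: "(SUP x\<in>mono_shift \<nu> 1. f x) = S"
    by (simp add: S_def)
  interpret coloured_pressure L \<nu> \<tau> f g C \<theta>
    using assms(3,5,7) unfolding pressure_mono_shift sup by unfold_locales auto
  obtain \<mu> where \<mu>: "invariant_sequence_measure \<nu> F C \<theta> \<mu>"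
    "\<forall>n. real n * (P - (\<integral>x. F x \<partial>\<mu>)) \<le> rv_entropy \<mu> (\<lambda>x. window (\<lambda>i. x i mod \<nu>) 0 n)"
    using equilibrium_measure_exists by blast
  interpret invariant_sequence_measure \<nu> F C \<theta> \<mu>
    by (rule \<mu>(1))
  interpret coloured_state L \<nu> \<tau> f g C \<theta> \<mu>
    by unfold_locales (use \<mu>(2) in blast)
  show ?thesis
    using equilibrium_state_state[OF _ pressure_coloured_shift] mutually_singular_states
    by (intro exI[of _ state]) blast
qed

end
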